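(* Let $A_1\xrightarrow{\alpha_1}A_2\xrightarrow{\alpha_2}\cdots\xrightarrow{\alpha_{n-1}}A_n\xrightarrow{\alpha_n}A_{n+1}$ be a sequence of simplicial morphisms between NCCW complexes of dimensions $m_1,m_2,\dots,m_{n+1}$ respectively. Then the NC mapping cylindrical telescope $T_n$ of this sequence is an NCCW complex of dimension $\max\{m_1,1+m_2,1+m_3,\dots,1+m_{n+1}\}$.
   Context: Morphisms of C*-algebras are $*$-homomorphisms. Notation: $\mathbb{I}=[0,1]$, $\mathbb{I}^k=[0,1]^k$, $\mathbb{I}_0^k=(0,1)^k$. For a C*-algebra $F$: $\mathbb{I}F=C(\mathbb{I}\to F)$, $\mathbb{I}^kF=C(\mathbb{I}^k\to F)$, $\mathbb{I}_0^kF=C_0(\mathbb{I}_0^k\to F)$, $S^{k-1}F=C(S^{k-1}\to F)$, where $S^{k-1}$ is identified with the boundary $\mathbb{I}^k\setminus\mathbb{I}_0^k$; all have pointwise operations and supremum norm. $\partial:\mathbb{I}^kF\to S^{k-1}F$ is restriction. NCCW complexes: an NCCW complex of dimension $0$ is a finite-dimensional C*-algebra $D_0$. An NCCW complex of dimension $d$ is given by a sequence of C*-algebras $\{D_0,D_1,\dots,D_d\}$, where $D_0$ is finite-dimensional and for each $1\le k\le d$ there are a finite-dimensional C*-algebra $F_k$ and an arbitrary morphism $\sigma_k:D_{k-1}\to S^{k-1}F_k$ with $D_k=\mathbb{I}^kF_k\bigoplus_{S^{k-1}F_k}D_{k-1}=\{f\oplus a\in \mathbb{I}^kF_k\oplus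 D_{k-1} : \partial f=\sigma_k(a)\}$ (the pullback); thus there is an extension $0\to\mathbb{I}_0^kF_k\to D_k\to D_{k-1}\to 0$. One calls $D=D_d$ itself the NCCW complex. It has a decreasing family of closed ideals (canonical ideals) $D=I_0\supset I_1\supset\dots\supset I_d\neq 0$, where for $k\ge 1$, $I_k$ is the kernel of the projection $D\to D_{k-1}$; so $I_d=\mathbb{I}_0^dF_d$, $I_k/I_{k+1}=\mathbb{I}_0^kF_k$ (with $F_0=D_0$, $I_{d+1}=0$), and $D/I_{k+1}=D_k$. Simplicial morphisms: let $D$, $E$ be NCCW complexes of dimensions $d,e$ with canonical ideals $I_0\supset\dots\supset I_d$ and $J_0\supset\dots\supset J_e$, and $I_k/I_{k+1}=\mathbb{I}_0^kF_k$, $J_k/J_{k+1}=\mathbb{I}_0^kG_k$. A morphism $\alpha:D\to E$ is simplicial if (i) $\alpha(I_k)\subset J_k$ for all $k$ (in particular $\alpha(I_k)=0$ for $k>e$), and (ii) for $0\le k\le d$, the induced homomorphism $\tilde\alpha_k:\mathbb{I}_0^kF_k\to\mathbb{I}_0^kG_k$ has the form $\tilde\alpha_k=i_k^*\otimes\varphi_k$ for some morphism $\varphi_k:F_k\to G_k$ and some homeomorphism $i_k$ of $\mathbb{I}^k$, where $i_k^*$ is the induced map on $C_0(\mathbb{I}_0^k)$ and $\mathbb{I}_0^kF_k$ is identified with $C_0(\mathbb{I}_0^k)\otimes F_k$ (similarly for $G_k$). NC mapping cylindrical telescope of the sequence $A_1\xrightarrow{\alpha_1}\cdots\xrightarrow{\alpha_n}A_{n+1}$: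 $$T_n=\{a\oplus f_2\oplus\dots\oplus f_{n+1}\in A_1\oplus\mathbb{I}A_2\oplus\dots\oplus\mathbb{I}A_{n+1} : f_{k+1}(1)=\alpha_k\circ\alpha_{k-1}\circ\dots\circ\alpha_1(a),\ k=1,\dots,n\}.$$ *)

theory Defs
  imports "HOL-Analysis.Analysis" "HOL-Algebra.Module"
begin

section \<open>C*-algebras\<close>

definition complex_ring :: "complex ring" where
  "complex_ring = \<lparr>carrier = UNIV, mult = (*), one = 1, zero = 0, add = (+)\<rparr>"

text \<open>C*-algebras are not required to be unital: the field \<open>one\<close>, inherited from the ring records
  of the library, is never used.\<close>

record 'a cstar = "(complex, 'a) module" +
  invol :: "'a \<Rightarrow> 'a"
  nrm :: "'a \<Rightarrow> real"

text \<open>The norm distance, set to 0 off the carrier because the locale \<open>Metric_space\<close> of the library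
  wants distances to be nonnegative and symmetric on the whole type.\<close>

definition cstar_dist :: "'a cstar \<Rightarrow> 'a \<Rightarrow> 'a \<Rightarrow> real" where
  "cstar_dist A x y = (if x \<in> carrier A \<and> y \<in> carrier A then nrm A (x \<ominus>\<^bsub>A\<^esub> y) else 0)"

definition cstar_topology :: "'a cstar \<Rightarrow> 'a topology" where
  "cstar_topology A = Metric_space.mtopology (carrier A) (cstar_dist A)"

locale cstar_algebra = Module.module complex_ring A for A :: "'a cstar" (structure) +
  assumes cstar_mult_closed: "\<lbrakk>x \<in> carrier A; y \<in> carrier A\<rbrakk> \<Longrightarrow> x \<otimes> y \<in> carrier A"
    and cstar_mult_assoc: "\<lbrakk>x \<in> carrier A; y \<in> carrier A; z \<in> carrier A\<rbrakk>
          \<Longrightarrow> (x \<otimes> y) \<otimes> z = x \<otimes> (y \<otimes> z)"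
    and cstar_distl: "\<lbrakk>x \<in> carrier A; y \<in> carrier A; z \<in> carrier A\<rbrakk>
          \<Longrightarrow> (x \<oplus> y) \<otimes> z = x \<otimes> z \<oplus> y \<otimes> z"
    and cstar_distr: "\<lbrakk>x \<in> carrier A; y \<in> carrier A; z \<in> carrier A\<rbrakk>
          \<Longrightarrow> x \<otimes> (y \<oplus> z) = x \<otimes> y \<oplus> x \<otimes> z"
    and cstar_smult_left: "\<lbrakk>x \<in> carrier A; y \<in> carrier A\<rbrakk>
          \<Longrightarrow> (c \<odot> x) \<otimes> y = c \<odot> (x \<otimes> y)"
    and cstar_smult_right: "\<lbrakk>x \<in> carrier A; y \<in> carrier A\<rbrakk>
          \<Longrightarrow> x \<otimes> (c \<odot> y) = c \<odot> (x \<otimes> y)"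
    and invol_closed: "x \<in> carrier A \<Longrightarrow> invol A x \<in> carrier A"
    and invol_invol: "x \<in> carrier A \<Longrightarrow> invol A (invol A x) = x"
    and invol_add: "\<lbrakk>x \<in> carrier A; y \<in> carrier A\<rbrakk>
          \<Longrightarrow> invol A (x \<oplus> y) = invol A x \<oplus> invol A y"
    and invol_smult: "x \<in> carrier A \<Longrightarrow> invol A (c \<odot> x) = cnj c \<odot> invol A x"
    and invol_mult: "\<lbrakk>x \<in> carrier A; y \<in> carrier A\<rbrakk>
          \<Longrightarrow> invol A (x \<otimes> y) = invol A y \<otimes> invol A x"
    and nrm_nonneg: "x \<in> carrier A \<Longrightarrow> 0 \<le> nrm A x"
    and nrm_eq_zero: "x \<in> carrier A \<Longrightarrow> nrm A x = 0 \<longleftrightarrow> x = \<zero>"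
    and nrm_triangle: "\<lbrakk>x \<in> carrier A; y \<in> carrier A\<rbrakk> \<Longrightarrow> nrm A (x \<oplus> y) \<le> nrm A x + nrm A y"
    and nrm_smult: "x \<in> carrier A \<Longrightarrow> nrm A (c \<odot> x) = cmod c * nrm A x"
    and nrm_mult: "\<lbrakk>x \<in> carrier A; y \<in> carrier A\<rbrakk> \<Longrightarrow> nrm A (x \<otimes> y) \<le> nrm A x * nrm A y"
    and nrm_cstar: "x \<in> carrier A \<Longrightarrow> nrm A (invol A x \<otimes> x) = (nrm A x)\<^sup>2"
    and cstar_complete: "Metric_space.mcomplete (carrier A) (cstar_dist A)"

definition fin_dim_cstar :: "'a cstar \<Rightarrow> bool" where
  "fin_dim_cstar A \<longleftrightarrow> cstar_algebra A \<and>
     (\<exists>B. finite B \<and> B \<subseteq> carrier A \<and>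
        (\<forall>x \<in> carrier A. \<exists>c. x = (\<Oplus>\<^bsub>A\<^esub>b\<in>B. c b \<odot>\<^bsub>A\<^esub> b)))"

definition star_hom :: "'a cstar \<Rightarrow> 'b cstar \<Rightarrow> ('a \<Rightarrow> 'b) set" where
  "star_hom A B = {h \<in> carrier A \<rightarrow> carrier B.
     (\<forall>x \<in> carrier A. \<forall>y \<in> carrier A. h (x \<oplus>\<^bsub>A\<^esub> y) = h x \<oplus>\<^bsub>B\<^esub> h y) \<and>
     (\<forall>x \<in> carrier A. \<forall>y \<in> carrier A. h (x \<otimes>\<^bsub>A\<^esub> y) = h x \<otimes>\<^bsub>B\<^esub> h y) \<and>
     (\<forall>c. \<forall>x \<in> carrier A. h (c \<odot>\<^bsub>A\<^esub> x) = c \<odot>\<^bsub>B\<^esub> h x) \<and>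
     (\<forall>x \<in> carrier A. h (invol A x) = invol B (h x))}"

text \<open>Between C*-algebras a bijective *-homomorphism is automatically isometric; the isometry is
  listed so that the isomorphism relation visibly concerns the norm as well.\<close>

definition cstar_iso :: "'a cstar \<Rightarrow> 'b cstar \<Rightarrow> bool" where
  "cstar_iso A B \<longleftrightarrow> (\<exists>h \<in> star_hom A B. bij_betw h (carrier A) (carrier B) \<and>
     (\<forall>x \<in> carrier A. nrm B (h x) = nrm A x))"

section \<open>Direct sums and algebras of continuous functions\<close>

definition prod_cstar :: "'a cstar \<Rightarrow> 'b cstar \<Rightarrow> ('a \<times> 'b) cstar" where
  "prod_cstar A B = \<lparr>
     carrier = carrier A \<times> carrier B,
     mult = (\<lambda>x y. (fst x \<otimes>\<^bsub>A\<^esub> fst y, snd x \<otimes>\<^bsub>B\<^esub> snd y)),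
     one = (\<one>\<^bsub>A\<^esub>, \<one>\<^bsub>B\<^esub>),
     zero = (\<zero>\<^bsub>A\<^esub>, \<zero>\<^bsub>B\<^esub>),
     add = (\<lambda>x y. (fst x \<oplus>\<^bsub>A\<^esub> fst y, snd x \<oplus>\<^bsub>B\<^esub> snd y)),
     smult = (\<lambda>c x. (c \<odot>\<^bsub>A\<^esub> fst x, c \<odot>\<^bsub>B\<^esub> snd x)),
     invol = (\<lambda>x. (invol A (fst x), invol B (snd x))),
     nrm = (\<lambda>x. max (nrm A (fst x)) (nrm B (snd x)))\<rparr>"

text \<open>The index set \<open>I\<close> is meant to be finite; it may be empty, hence the \<open>insert 0\<close>.\<close>

definition dsum_cstar :: "'i set \<Rightarrow> ('i \<Rightarrow> 'a cstar) \<Rightarrow> ('i \<Rightarrow> 'a) cstar" where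
  "dsum_cstar I A = \<lparr>
     carrier = (\<Pi>\<^sub>E i\<in>I. carrier (A i)),
     mult = (\<lambda>x y. \<lambda>i\<in>I. x i \<otimes>\<^bsub>A i\<^esub> y i),
     one = (\<lambda>i\<in>I. \<one>\<^bsub>A i\<^esub>),
     zero = (\<lambda>i\<in>I. \<zero>\<^bsub>A i\<^esub>),
     add = (\<lambda>x y. \<lambda>i\<in>I. x i \<oplus>\<^bsub>A i\<^esub> y i),
     smult = (\<lambda>c x. \<lambda>i\<in>I. c \<odot>\<^bsub>A i\<^esub> x i),
     invol = (\<lambda>x. \<lambda>i\<in>I. invol (A i) (x i)),
     nrm = (\<lambda>x. Max (insert 0 ((\<lambda>i. nrm (A i) (x i)) ` I)))\<rparr>"

text \<open>\<open>C(X \<rightarrow> F)\<close> for a compact space \<open>X\<close>; the functions are extensional on \<open>X\<close>.\<close>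

definition cont_cstar :: "'p topology \<Rightarrow> 'a cstar \<Rightarrow> ('p \<Rightarrow> 'a) cstar" where
  "cont_cstar X F = \<lparr>
     carrier = {f \<in> extensional (topspace X). continuous_map X (cstar_topology F) f},
     mult = (\<lambda>f g. \<lambda>p\<in>topspace X. f p \<otimes>\<^bsub>F\<^esub> g p),
     one = (\<lambda>p\<in>topspace X. \<one>\<^bsub>F\<^esub>),
     zero = (\<lambda>p\<in>topspace X. \<zero>\<^bsub>F\<^esub>),
     add = (\<lambda>f g. \<lambda>p\<in>topspace X. f p \<oplus>\<^bsub>F\<^esub> g p),
     smult = (\<lambda>c f. \<lambda>p\<in>topspace X. c \<odot>\<^bsub>F\<^esub> f p),
     invol = (\<lambda>f. \<lambda>p\<in>topspace X. invol F (f p)),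
     nrm = (\<lambda>f. Sup (insert 0 ((\<lambda>p. nrm F (f p)) ` topspace X)))\<rparr>"

section \<open>Cubes and spheres\<close>

text \<open>Points of \<open>\<real>\<^sup>k\<close> are, as in \<^const>\<open>Euclidean_space\<close>, the sequences vanishing from index \<open>k\<close> on.\<close>

definition cube :: "nat \<Rightarrow> (nat \<Rightarrow> real) set" where
  "cube k = {x \<in> topspace (Euclidean_space k). \<forall>i<k. 0 \<le> x i \<and> x i \<le> 1}"

definition open_cube :: "nat \<Rightarrow> (nat \<Rightarrow> real) set" where
  "open_cube k = {x \<in> topspace (Euclidean_space k). \<forall>i<k. 0 < x i \<and> x i < 1}"

definition cube_boundary :: "nat \<Rightarrow> (nat \<Rightarrow> real) set" where
  "cube_boundary k = cube k - open_cube k"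

definition cube_top :: "nat \<Rightarrow> (nat \<Rightarrow> real) topology" where
  "cube_top k = subtopology (Euclidean_space k) (cube k)"

definition sphere_top :: "nat \<Rightarrow> (nat \<Rightarrow> real) topology" where
  "sphere_top k = subtopology (Euclidean_space k) (cube_boundary k)"

section \<open>NCCW complexes\<close>

text \<open>An element of \<open>D\<^sub>k\<close> is written as the tuple \<open>(x 0, \<dots>, x k)\<close> of its components
  \<open>x j \<in> C(\<I>\<^sup>j \<rightarrow> F\<^sub>j)\<close>, extensional in \<open>j\<close>. The algebra \<open>D\<^sub>0 = F\<^sub>0\<close> appears as \<open>C(\<I>\<^sup>0 \<rightarrow> F\<^sub>0)\<close>,
  where \<open>\<I>\<^sup>0\<close> is a point.\<close>

type_synonym 'f nccw_elem = "nat \<Rightarrow> (nat \<Rightarrow> real) \<Rightarrow> 'f"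

text \<open>\<open>attach X k\<close> is the morphism \<open>\<sigma>\<^sub>k\<close>, relevant for \<open>1 \<le> k \<le> ncdim X\<close>.\<close>

record 'f nccw =
  ncdim :: nat
  cell_alg :: "nat \<Rightarrow> 'f cstar"
  attach :: "nat \<Rightarrow> 'f nccw_elem \<Rightarrow> (nat \<Rightarrow> real) \<Rightarrow> 'f"

definition cells_sum :: "'f nccw \<Rightarrow> nat \<Rightarrow> 'f nccw_elem cstar" where
  "cells_sum X k = dsum_cstar {..k} (\<lambda>j. cont_cstar (cube_top j) (cell_alg X j))"

text \<open>The pullback: \<open>x\<close> is \<open>f \<oplus> a\<close> with \<open>f = x (Suc k)\<close> and \<open>a\<close> the remaining components.\<close>

primrec skeleton_carrier :: "'f nccw \<Rightarrow> nat \<Rightarrow> 'f nccw_elem set" where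
  "skeleton_carrier X 0 = carrier (cells_sum X 0)"
| "skeleton_carrier X (Suc k) = {x \<in> carrier (cells_sum X (Suc k)).
     restrict x {..k} \<in> skeleton_carrier X k \<and>
     restrict (x (Suc k)) (cube_boundary (Suc k)) = attach X (Suc k) (restrict x {..k})}"

definition skeleton :: "'f nccw \<Rightarrow> nat \<Rightarrow> 'f nccw_elem cstar" where
  "skeleton X k = (cells_sum X k)\<lparr>carrier := skeleton_carrier X k\<rparr>"

definition nccw_alg :: "'f nccw \<Rightarrow> 'f nccw_elem cstar" where
  "nccw_alg X = skeleton X (ncdim X)"

text \<open>The projection \<open>D \<rightarrow> D\<^sub>k\<^sub>-\<^sub>1\<close> is restriction to the components up to \<open>k - 1\<close>.\<close>

definition canonical_ideal :: "'f nccw \<Rightarrow> nat \<Rightarrow> 'f nccw_elem set" where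
  "canonical_ideal X k =
     (if k = 0 then carrier (nccw_alg X)
      else if k \<le> ncdim X then
        {x \<in> carrier (nccw_alg X). restrict x {..k - 1} = \<zero>\<^bsub>skeleton X (k - 1)\<^esub>}
      else {\<zero>\<^bsub>nccw_alg X\<^esub>})"

definition nccw_complex :: "'f nccw \<Rightarrow> bool" where
  "nccw_complex X \<longleftrightarrow>
     (\<forall>k \<le> ncdim X. fin_dim_cstar (cell_alg X k)) \<and>
     (\<forall>k \<in> {1..ncdim X}.
        attach X k \<in> star_hom (skeleton X (k - 1)) (cont_cstar (sphere_top k) (cell_alg X k))) \<and>
     canonical_ideal X (ncdim X) \<noteq> {\<zero>\<^bsub>nccw_alg X\<^esub>}"

text \<open>The quotient map \<open>I\<^sub>k \<rightarrow> I\<^sub>k/I\<^sub>k\<^sub>+\<^sub>1 = C\<^sub>0((0,1)\<^sup>k \<rightarrow> F\<^sub>k)\<close> is \<open>x \<mapsto> x k\<close>, functions on the open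
  cube being identified with functions on the closed cube that vanish on the boundary. Under
  \<open>C\<^sub>0((0,1)\<^sup>k) \<otimes> F\<^sub>k = C\<^sub>0((0,1)\<^sup>k \<rightarrow> F\<^sub>k)\<close> the morphism \<open>i\<^sup>* \<otimes> \<phi>\<close> is \<open>h \<mapsto> \<phi> \<circ> h \<circ> i\<close>. For
  \<open>ncdim Y < k \<le> ncdim X\<close> the target \<open>J\<^sub>k/J\<^sub>k\<^sub>+\<^sub>1\<close> of the induced homomorphism is zero, so that the
  second condition has content only for \<open>k \<le> ncdim Y\<close>.\<close>

definition simplicial :: "'f nccw \<Rightarrow> 'g nccw \<Rightarrow> ('f nccw_elem \<Rightarrow> 'g nccw_elem) \<Rightarrow> bool" where
  "simplicial X Y \<alpha> \<longleftrightarrow>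
     \<alpha> \<in> star_hom (nccw_alg X) (nccw_alg Y) \<and>
     (\<forall>k. \<alpha> ` canonical_ideal X k \<subseteq> canonical_ideal Y k) \<and>
     (\<forall>k. k \<le> ncdim X \<and> k \<le> ncdim Y \<longrightarrow>
        (\<exists>i \<phi>. homeomorphic_map (cube_top k) (cube_top k) i \<and>
           \<phi> \<in> star_hom (cell_alg X k) (cell_alg Y k) \<and>
           (\<forall>x \<in> canonical_ideal X k. \<forall>p \<in> cube k. \<alpha> x k p = \<phi> (x k (i p)))))"

section \<open>The mapping cylindrical telescope\<close>

primrec composite :: "(nat \<Rightarrow> 'a \<Rightarrow> 'a) \<Rightarrow> nat \<Rightarrow> 'a \<Rightarrow> 'a" where
  "composite \<alpha> 0 = id"
| "composite \<alpha> (Suc k) = \<alpha> (Suc k) \<circ> composite \<alpha> k"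

definition telescope :: "nat \<Rightarrow> (nat \<Rightarrow> 'a cstar) \<Rightarrow> (nat \<Rightarrow> 'a \<Rightarrow> 'a) \<Rightarrow> ('a \<times> (nat \<Rightarrow> real \<Rightarrow> 'a)) cstar" where
  "telescope n A \<alpha> =
     (let S = prod_cstar (A 1) (dsum_cstar {2..n+1} (\<lambda>j. cont_cstar (top_of_set {0..1}) (A j)))
      in S\<lparr>carrier := {(a, f). (a, f) \<in> carrier S \<and> (\<forall>k \<in> {1..n}. f (k + 1) 1 = composite \<alpha> k a)}\<rparr>)"

end

theory Submission
  imports Defs
begin

text \<open>The telescope glues to \<open>A\<^sub>1\<close> one cylinder \<open>\<I>A\<^sub>j\<close> for each \<open>j \<ge> 2\<close>, along the end \<open>t = 1\<close>. A \<open>k\<close>-cell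
of such an \<open>A\<^sub>j\<close> with algebra \<open>F\<close> therefore contributes two cells with algebra \<open>F\<close>: its copy at the free end
\<open>t = 0\<close>, of dimension \<open>k\<close>, and its product with the open interval, of dimension \<open>k + 1\<close>. At the end
\<open>t = 1\<close> the cylinder is determined by \<open>A\<^sub>1\<close>, whose own cells are kept. So the algebra of the \<open>k\<close>-cells
is the direct sum of the \<open>k\<close>-cell algebras of all \<open>A\<^sub>j\<close> and of the \<open>(k-1)\<close>-cell algebras of the
\<open>A\<^sub>j\<close> with \<open>j \<ge> 2\<close>, and the dimension is the stated maximum.

To turn this into attaching morphisms the proof uses an intrinsic description of NCCW complexes, the
locale \<open>cell_filtration\<close>. Let \<open>h\<close> embed an involutive algebra \<open>T\<close> isometrically into the direct sum
of the \<open>C(\<I>\<^sup>k \<rightarrow> G\<^sub>k)\<close>, \<open>k \<le> M\<close>, such that (boundary) if the components of \<open>h t\<close> below \<open>k\<close> vanish, then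
the \<open>k\<close>-th one vanishes on the boundary of the cube, and (fill) every function in \<open>C\<^sub>0(\<I>\<^sub>0\<^sup>k \<rightarrow> G\<^sub>k)\<close> is
the \<open>k\<close>-th component of some \<open>h t\<close> whose lower components vanish. Then \<open>T\<close> is an NCCW complex:
\<open>\<sigma>\<^sub>k\<close> sends \<open>x \<in> D\<^sub>k\<^sub>-\<^sub>1\<close> to the boundary values of the \<open>k\<close>-th component of any \<open>t\<close> with lower components
\<open>x\<close>. By (boundary) the choice of \<open>t\<close> does not matter, and (fill) gives, by induction on \<open>k\<close>, that such
a \<open>t\<close> exists. That \<open>\<sigma>\<^sub>k\<close> is a morphism into continuous functions is then immediate.

For the telescope, \<open>h\<close> reads off \<open>a\<close>, the values \<open>f\<^sub>j(0)\<close>, and \<open>(q,t) \<mapsto> f\<^sub>j(t)(q)\<close>. In (boundary) there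
are three kinds of faces of the cell \<open>\<I>\<^sup>l \<times> \<I>\<close>: at \<open>t = 0\<close> a lower component is met, at \<open>t = 1\<close> a
component of the image of \<open>a\<close>, which vanishes because simplicial morphisms preserve canonical ideals,
and on the sides the attaching condition of \<open>A\<^sub>j\<close> applies (\<open>h_boundary\<close>). For (fill) a
function on a cell of \<open>A\<^sub>j\<close> is lifted to \<open>A\<^sub>j\<close> by extending boundary values radially into the
higher cubes (\<open>lift\<close>); a path of functions must be lifted to a norm continuous path, so
this lift has to be Lipschitz (\<open>lift_dist_le\<close>), which needs the attaching morphisms to be contractive.

That *-homomorphisms are contractive (\<open>star_hom_contractive\<close>) follows from the C*-identity: for
self-adjoint \<open>a\<close> of norm below 1 there is a self-adjoint \<open>b\<close>, commuting with \<open>a\<close>, with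
\<open>a\<^sup>2 + (1 - b)\<^sup>2 = 1\<close>. This identity is preserved by a homomorphism and says that the image of \<open>a\<close> is
the real part of a unitary, hence has norm at most 1. The existence of \<open>b\<close> uses the completeness of
the domain; so the skeleta have to be complete, which is proved together with
the continuity of the attaching morphisms by induction on the dimension.\<close>

section \<open>Calculus in C*-normed algebras\<close>

lemma complex_ring_simps [simp]:
  "carrier complex_ring = UNIV" "x \<otimes>\<^bsub>complex_ring\<^esub> y = x * y" "x \<oplus>\<^bsub>complex_ring\<^esub> y = x + y"
  "\<one>\<^bsub>complex_ring\<^esub> = 1" "\<zero>\<^bsub>complex_ring\<^esub> = 0"
  by (simp_all add: complex_ring_def)

lemma cring_complex_ring: "cring complex_ring"
proof (rule cringI)
  show "abelian_group complex_ring"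
  proof (rule abelian_groupI)
    fix x :: complex
    show "\<exists>y\<in>carrier complex_ring. y \<oplus>\<^bsub>complex_ring\<^esub> x = \<zero>\<^bsub>complex_ring\<^esub>"
      by (rule bexI[of _ "-x"]) auto
  qed auto
  show "comm_monoid complex_ring"
    by (rule comm_monoidI) auto
qed (auto simp: algebra_simps)

lemma complex_ring_minus [simp]: "\<ominus>\<^bsub>complex_ring\<^esub> c = - c"
proof -
  interpret cring complex_ring by (rule cring_complex_ring)
  show ?thesis
    by (rule minus_equality) auto
qed

text \<open>The axioms of a C*-algebra apart from completeness. Completeness of the algebras below is derived
from estimates for their norms, so the calculus of norms has to be available first.\<close>

locale pre_cstar = Module.module complex_ring A for A :: "'a cstar" (structure) +
  assumes cstar_mult_closed: "\<lbrakk>x \<in> carrier A; y \<in> carrier A\<rbrakk> \<Longrightarrow> x \<otimes> y \<in> carrier A"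
    and cstar_mult_assoc: "\<lbrakk>x \<in> carrier A; y \<in> carrier A; z \<in> carrier A\<rbrakk>
          \<Longrightarrow> (x \<otimes> y) \<otimes> z = x \<otimes> (y \<otimes> z)"
    and cstar_distl: "\<lbrakk>x \<in> carrier A; y \<in> carrier A; z \<in> carrier A\<rbrakk>
          \<Longrightarrow> (x \<oplus> y) \<otimes> z = x \<otimes> z \<oplus> y \<otimes> z"
    and cstar_distr: "\<lbrakk>x \<in> carrier A; y \<in> carrier A; z \<in> carrier A\<rbrakk>
          \<Longrightarrow> x \<otimes> (y \<oplus> z) = x \<otimes> y \<oplus> x \<otimes> z"
    and cstar_smult_left: "\<lbrakk>x \<in> carrier A; y \<in> carrier A\<rbrakk>
          \<Longrightarrow> (c \<odot> x) \<otimes> y = c \<odot> (x \<otimes> y)"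
    and cstar_smult_right: "\<lbrakk>x \<in> carrier A; y \<in> carrier A\<rbrakk>
          \<Longrightarrow> x \<otimes> (c \<odot> y) = c \<odot> (x \<otimes> y)"
    and invol_closed: "x \<in> carrier A \<Longrightarrow> invol A x \<in> carrier A"
    and invol_invol: "x \<in> carrier A \<Longrightarrow> invol A (invol A x) = x"
    and invol_add: "\<lbrakk>x \<in> carrier A; y \<in> carrier A\<rbrakk>
          \<Longrightarrow> invol A (x \<oplus> y) = invol A x \<oplus> invol A y"
    and invol_smult: "x \<in> carrier A \<Longrightarrow> invol A (c \<odot> x) = cnj c \<odot> invol A x"
    and invol_mult: "\<lbrakk>x \<in> carrier A; y \<in> carrier A\<rbrakk>
          \<Longrightarrow> invol A (x \<otimes> y) = invol A y \<otimes> invol A x"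
    and nrm_nonneg: "x \<in> carrier A \<Longrightarrow> 0 \<le> nrm A x"
    and nrm_eq_zero: "x \<in> carrier A \<Longrightarrow> nrm A x = 0 \<longleftrightarrow> x = \<zero>"
    and nrm_triangle: "\<lbrakk>x \<in> carrier A; y \<in> carrier A\<rbrakk> \<Longrightarrow> nrm A (x \<oplus> y) \<le> nrm A x + nrm A y"
    and nrm_smult: "x \<in> carrier A \<Longrightarrow> nrm A (c \<odot> x) = cmod c * nrm A x"
    and nrm_mult: "\<lbrakk>x \<in> carrier A; y \<in> carrier A\<rbrakk> \<Longrightarrow> nrm A (x \<otimes> y) \<le> nrm A x * nrm A y"
    and nrm_cstar: "x \<in> carrier A \<Longrightarrow> nrm A (invol A x \<otimes> x) = (nrm A x)\<^sup>2"

lemma cstar_algebra_iff: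
  "cstar_algebra A \<longleftrightarrow> pre_cstar A \<and> Metric_space.mcomplete (carrier A) (cstar_dist A)"
  unfolding cstar_algebra_def pre_cstar_def cstar_algebra_axioms_def pre_cstar_axioms_def
  by (simp only: conj_assoc)

context pre_cstar
begin

lemma smult_carrier [simp, intro]: "x \<in> carrier A \<Longrightarrow> c \<odot> x \<in> carrier A"
  by (rule smult_closed) auto

lemma smult_add_left: "x \<in> carrier A \<Longrightarrow> (c + d) \<odot> x = c \<odot> x \<oplus> d \<odot> x"
  using smult_l_distr[of c d x] by simp

lemma smult_add_right: "x \<in> carrier A \<Longrightarrow> y \<in> carrier A \<Longrightarrow> c \<odot> (x \<oplus> y) = c \<odot> x \<oplus> c \<odot> y"
  using smult_r_distr[of c x y] by simp

lemma smult_smult: "x \<in> carrier A \<Longrightarrow> c \<odot> (d \<odot> x) = (c * d) \<odot> x"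
  using smult_assoc1[of c d x] by simp

lemma smult_1 [simp]: "x \<in> carrier A \<Longrightarrow> 1 \<odot> x = x"
  using smult_one[of x] by simp

lemma smult_0 [simp]: "x \<in> carrier A \<Longrightarrow> 0 \<odot> x = \<zero>"
  using smult_l_null[of x] by simp

lemma smult_zero [simp]: "c \<odot> \<zero> = \<zero>"
  using smult_r_null[of c] by simp

lemma minus_conv_smult: "x \<in> carrier A \<Longrightarrow> \<ominus> x = (-1) \<odot> x"
  using smult_l_minus[of 1 x] by simp

lemma diff_conv_smult:
  "x \<in> carrier A \<Longrightarrow> y \<in> carrier A \<Longrightarrow> x \<ominus> y = x \<oplus> (-1) \<odot> y"
  by (simp add: M.minus_eq minus_conv_smult)

lemma diff_carrier [simp, intro]: "x \<in> carrier A \<Longrightarrow> y \<in> carrier A \<Longrightarrow> x \<ominus> y \<in> carrier A"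
  by simp

lemma nrm_zero [simp]: "nrm A \<zero> = 0"
  by (simp add: nrm_eq_zero)

lemma add_diff_cancel: "x \<in> carrier A \<Longrightarrow> y \<in> carrier A \<Longrightarrow> y \<oplus> (x \<ominus> y) = x"
  by (simp add: M.minus_eq M.a_lcomm M.r_neg)

lemma diff_eq_zero_iff: "x \<in> carrier A \<Longrightarrow> y \<in> carrier A \<Longrightarrow> x \<ominus> y = \<zero> \<longleftrightarrow> x = y"
  using add_diff_cancel[of x y] by (auto simp: M.minus_eq M.r_neg)

lemma diff_self [simp]: "x \<in> carrier A \<Longrightarrow> x \<ominus> x = \<zero>"
  by (simp add: diff_eq_zero_iff)

lemma diff_zero [simp]: "x \<in> carrier A \<Longrightarrow> x \<ominus> \<zero> = x"
  by (simp add: diff_conv_smult)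

lemma diff_add_diff:
  "x \<in> carrier A \<Longrightarrow> y \<in> carrier A \<Longrightarrow> z \<in> carrier A \<Longrightarrow> (x \<ominus> y) \<oplus> (y \<ominus> z) = x \<ominus> z"
  by (metis M.minus_eq M.a_assoc M.a_inv_closed M.l_neg M.l_zero M.minus_closed)

lemma add_diff_add:
  "\<lbrakk>x \<in> carrier A; y \<in> carrier A; u \<in> carrier A; v \<in> carrier A\<rbrakk>
    \<Longrightarrow> (x \<oplus> y) \<ominus> (u \<oplus> v) = (x \<ominus> u) \<oplus> (y \<ominus> v)"
  by (simp add: diff_conv_smult smult_add_right M.a_ac)

lemma smult_diff:
  "x \<in> carrier A \<Longrightarrow> y \<in> carrier A \<Longrightarrow> c \<odot> x \<ominus> c \<odot> y = c \<odot> (x \<ominus> y)"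
  by (simp add: diff_conv_smult smult_add_right smult_smult)

lemma smult_diff_left:
  "x \<in> carrier A \<Longrightarrow> c \<odot> x \<ominus> d \<odot> x = (c - d) \<odot> x"
  using smult_add_left[of x c "-d"] by (simp add: diff_conv_smult smult_smult)

lemma mult_diff_mult:
  "\<lbrakk>x \<in> carrier A; y \<in> carrier A; u \<in> carrier A; v \<in> carrier A\<rbrakk>
    \<Longrightarrow> x \<otimes> y \<ominus> u \<otimes> v = (x \<ominus> u) \<otimes> y \<oplus> u \<otimes> (y \<ominus> v)"
proof -
  assume c: "x \<in> carrier A" "y \<in> carrier A" "u \<in> carrier A" "v \<in> carrier A"
  note cl = cstar_mult_closed
  have "(x \<ominus> u) \<otimes> y = x \<otimes> y \<ominus> u \<otimes> y"
    using c by (simp add: diff_conv_smult cstar_distl cstar_smult_left cl)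
  moreover have "u \<otimes> (y \<ominus> v) = u \<otimes> y \<ominus> u \<otimes> v"
    using c by (simp add: diff_conv_smult cstar_distr cstar_smult_right cl)
  ultimately show ?thesis using c by (simp add: diff_add_diff cl)
qed

lemma invol_diff:
  "x \<in> carrier A \<Longrightarrow> y \<in> carrier A \<Longrightarrow> invol A x \<ominus> invol A y = invol A (x \<ominus> y)"
  by (simp add: diff_conv_smult invol_add invol_smult invol_closed)

lemma nrm_diff_commute:
  "x \<in> carrier A \<Longrightarrow> y \<in> carrier A \<Longrightarrow> nrm A (x \<ominus> y) = nrm A (y \<ominus> x)"
proof -
  assume c: "x \<in> carrier A" "y \<in> carrier A"
  then have "x \<ominus> y = (-1) \<odot> (y \<ominus> x)"
    by (simp add: diff_conv_smult smult_add_right smult_smult M.a_comm)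
  with c show ?thesis by (simp add: nrm_smult)
qed

lemma nrm_diff_triangle:
  "\<lbrakk>x \<in> carrier A; y \<in> carrier A; z \<in> carrier A\<rbrakk>
    \<Longrightarrow> nrm A (x \<ominus> z) \<le> nrm A (x \<ominus> y) + nrm A (y \<ominus> z)"
  by (metis diff_add_diff diff_carrier nrm_triangle)

lemma nrm_le_nrm_diff:
  "x \<in> carrier A \<Longrightarrow> y \<in> carrier A \<Longrightarrow> nrm A x \<le> nrm A y + nrm A (x \<ominus> y)"
  by (metis add_diff_cancel diff_carrier nrm_triangle)

text \<open>By the C*-identity the square of the norm of \<open>x\<close> is at most the product of the norms of \<open>x\<close> and of its
adjoint.\<close>

lemma nrm_invol [simp]: "x \<in> carrier A \<Longrightarrow> nrm A (invol A x) = nrm A x"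
proof -
  have le: "nrm A x \<le> nrm A (invol A x)" if x: "x \<in> carrier A" for x
  proof (cases "nrm A x = 0")
    case True
    then show ?thesis using nrm_nonneg[OF invol_closed[OF x]] by simp
  next
    case False
    have "nrm A x * nrm A x \<le> nrm A (invol A x) * nrm A x"
      using nrm_cstar[OF x] nrm_mult[OF invol_closed[OF x] x] by (simp add: power2_eq_square)
    with False nrm_nonneg[OF x] show ?thesis by simp
  qed
  assume "x \<in> carrier A"
  then show ?thesis using le[of x] le[of "invol A x"] by (simp add: invol_closed invol_invol)
qed

lemma invol_zero [simp]: "invol A \<zero> = \<zero>"
  using nrm_invol[of \<zero>] nrm_eq_zero[OF invol_closed[of \<zero>]] by simp

lemma zero_mult [simp]: "x \<in> carrier A \<Longrightarrow> \<zero> \<otimes> x = \<zero>"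
  using cstar_smult_left[of \<zero> x 0] by (simp add: cstar_mult_closed)

lemma mult_zero [simp]: "x \<in> carrier A \<Longrightarrow> x \<otimes> \<zero> = \<zero>"
  using cstar_smult_right[of x \<zero> 0] by (simp add: cstar_mult_closed)

lemma Metric_space_cstar: "Metric_space (carrier A) (cstar_dist A)"
proof
  show "0 \<le> cstar_dist A x y" for x y
    by (simp add: cstar_dist_def nrm_nonneg)
  show "cstar_dist A x y = cstar_dist A y x" for x y
    by (simp add: cstar_dist_def nrm_diff_commute)
  show "cstar_dist A x y = 0 \<longleftrightarrow> x = y" if "x \<in> carrier A" "y \<in> carrier A" for x y
    using that by (simp add: cstar_dist_def nrm_eq_zero diff_eq_zero_iff)
  show "cstar_dist A x z \<le> cstar_dist A x y + cstar_dist A y z"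
    if "x \<in> carrier A" "y \<in> carrier A" "z \<in> carrier A" for x y z
    using that by (simp add: cstar_dist_def nrm_diff_triangle)
qed

sublocale metric: Metric_space "carrier A" "cstar_dist A"
  by (rule Metric_space_cstar)

lemma complete_iff:
  "metric.mcomplete \<longleftrightarrow>
    (\<forall>\<sigma>. (\<forall>n. \<sigma> n \<in> carrier A) \<and>
         (\<forall>\<epsilon>>0. \<exists>N. \<forall>n\<ge>N. \<forall>n'\<ge>N. nrm A (\<sigma> n \<ominus> \<sigma> n') < \<epsilon>)
       \<longrightarrow> (\<exists>x\<in>carrier A. (\<lambda>n. nrm A (\<sigma> n \<ominus> x)) \<longlonglongrightarrow> 0))"
proof -
  have C: "metric.MCauchy \<sigma> \<longleftrightarrow> (\<forall>n. \<sigma> n \<in> carrier A) \<and>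
         (\<forall>\<epsilon>>0. \<exists>N. \<forall>n\<ge>N. \<forall>n'\<ge>N. nrm A (\<sigma> n \<ominus> \<sigma> n') < \<epsilon>)" for \<sigma>
    unfolding metric.MCauchy_def image_subset_iff cstar_dist_def by auto
  have L: "limitin metric.mtopology \<sigma> x sequentially \<longleftrightarrow>
      x \<in> carrier A \<and> (\<lambda>n. nrm A (\<sigma> n \<ominus> x)) \<longlonglongrightarrow> 0"
    if "\<forall>n. \<sigma> n \<in> carrier A" for \<sigma> x
    using that unfolding metric.limit_metric_sequentially LIMSEQ_def
    by (auto simp: cstar_dist_def nrm_nonneg)
  have "(\<exists>x. limitin metric.mtopology \<sigma> x sequentially) \<longleftrightarrow>
      (\<exists>x\<in>carrier A. (\<lambda>n. nrm A (\<sigma> n \<ominus> x)) \<longlonglongrightarrow> 0)" if "\<forall>n. \<sigma> n \<in> carrier A" for \<sigma>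
    by (simp add: L[OF that] Bex_def)
  then show ?thesis
    unfolding metric.mcomplete_def C by (intro all_cong1 imp_cong refl) (elim conjE)
qed

end

section \<open>*-homomorphisms are contractive\<close>

context pre_cstar
begin

text \<open>In the unitization the hypothesis \<open>eq\<close> reads \<open>x\<^sup>2 + (1 - y)\<^sup>2 = 1\<close>, so that \<open>u = x + \<i>(1 - y)\<close> is
unitary. To avoid adjoining a unit, \<open>u\<close> appears as the operator \<open>z \<mapsto> xz + \<i>(z - yz)\<close>; its being
isometric is the C*-identity applied to \<open>(uz)\<^sup>*(uz) = z\<^sup>*z\<close>.\<close>

lemma unitary_isometry:
  assumes c: "x \<in> carrier A" "y \<in> carrier A" "z \<in> carrier A"
    and sa: "invol A x = x" "invol A y = y" and comm: "x \<otimes> y = y \<otimes> x"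
    and eq: "x \<otimes> x = y \<oplus> (y \<ominus> y \<otimes> y)"
  shows "nrm A (x \<otimes> z \<oplus> \<i> \<odot> (z \<ominus> y \<otimes> z)) = nrm A z"
proof -
  note cl = cstar_mult_closed invol_closed
  define c where "c = invol A z"
  define v where "v = z \<ominus> y \<otimes> z"
  define w where "w = x \<otimes> z \<oplus> \<i> \<odot> v"
  have [simp]: "c \<in> carrier A" "v \<in> carrier A" "w \<in> carrier A"
    using c by (simp_all add: c_def v_def w_def cl)
  have iv: "invol A v = c \<ominus> c \<otimes> y"
    using c sa by (simp add: v_def c_def cl invol_mult flip: invol_diff)
  have iw: "invol A w = c \<otimes> x \<oplus> (-\<i>) \<odot> (c \<ominus> c \<otimes> y)"
    using c sa by (simp add: w_def invol_add invol_smult invol_mult cl iv c_def)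
  have right_diff: "p \<otimes> (q \<ominus> r) = p \<otimes> q \<ominus> p \<otimes> r"
    if "p \<in> carrier A" "q \<in> carrier A" "r \<in> carrier A" for p q r
    using that by (simp add: diff_conv_smult cstar_distr cstar_smult_right cl)
  have left_diff: "(q \<ominus> r) \<otimes> p = q \<otimes> p \<ominus> r \<otimes> p"
    if "p \<in> carrier A" "q \<in> carrier A" "r \<in> carrier A" for p q r
    using that by (simp add: diff_conv_smult cstar_distl cstar_smult_left cl)
  have xv: "x \<otimes> v = x \<otimes> z \<ominus> y \<otimes> (x \<otimes> z)"
    using c by (simp add: v_def right_diff cl comm flip: cstar_mult_assoc)
  have cross: "(c \<ominus> c \<otimes> y) \<otimes> (x \<otimes> z) = c \<otimes> (x \<otimes> v)"
    using c by (simp add: xv right_diff left_diff cl cstar_mult_assoc)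
  have xxz: "x \<otimes> (x \<otimes> z) = y \<otimes> z \<oplus> (y \<otimes> z \<ominus> y \<otimes> (y \<otimes> z))"
    using c by (simp add: eq cstar_distl left_diff cl flip: cstar_mult_assoc)
  have yv: "v \<ominus> y \<otimes> v = (z \<ominus> y \<otimes> z) \<ominus> (y \<otimes> z \<ominus> y \<otimes> (y \<otimes> z))"
    using c by (simp add: v_def right_diff cl)
  have sum: "x \<otimes> (x \<otimes> z) \<oplus> (v \<ominus> y \<otimes> v) = z"
  proof -
    have "(s \<oplus> d) \<oplus> ((z \<ominus> s) \<ominus> d) = z" if "s \<in> carrier A" "d \<in> carrier A" for s d
    proof -
      have "(s \<oplus> d) \<oplus> ((z \<ominus> s) \<ominus> d) = s \<oplus> (d \<oplus> ((z \<ominus> s) \<ominus> d))"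
        using that c by (simp add: M.a_assoc)
      then show ?thesis using that c by (simp add: add_diff_cancel)
    qed
    then show ?thesis unfolding xxz yv using c by (simp add: cl)
  qed
  have "invol A w \<otimes> w =
      (c \<otimes> (x \<otimes> (x \<otimes> z)) \<oplus> \<i> \<odot> (c \<otimes> (x \<otimes> v))) \<oplus>
      ((-\<i>) \<odot> (c \<otimes> (x \<otimes> v)) \<oplus> c \<otimes> (v \<ominus> y \<otimes> v))"
    unfolding iw using c
    by (simp add: w_def cstar_distl cstar_distr cstar_smult_left cstar_smult_right cl cross
        smult_smult smult_add_right cstar_mult_assoc left_diff right_diff M.a_ac)
  also have "\<dots> = (c \<otimes> (x \<otimes> (x \<otimes> z)) \<oplus> c \<otimes> (v \<ominus> y \<otimes> v)) \<oplus>
      (\<i> \<odot> (c \<otimes> (x \<otimes> v)) \<oplus> (-\<i>) \<odot> (c \<otimes> (x \<otimes> v)))"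
    using c by (simp add: M.a_ac cl)
  also have "\<i> \<odot> (c \<otimes> (x \<otimes> v)) \<oplus> (-\<i>) \<odot> (c \<otimes> (x \<otimes> v)) = \<zero>"
    using c smult_add_left[of "c \<otimes> (x \<otimes> v)" \<i> "-\<i>"] by (simp add: cl)
  also have "(c \<otimes> (x \<otimes> (x \<otimes> z)) \<oplus> c \<otimes> (v \<ominus> y \<otimes> v)) \<oplus> \<zero> = c \<otimes> z"
    using c by (simp add: cl sum flip: cstar_distr)
  finally have "(nrm A w)\<^sup>2 = (nrm A z)\<^sup>2"
    using c nrm_cstar[of w] nrm_cstar[of z] by (simp add: c_def)
  from power2_eq_imp_eq[OF this nrm_nonneg nrm_nonneg] show ?thesis
    using c by (simp flip: w_def v_def)
qed

text \<open>Here \<open>x\<close> is the real part of the unitary \<open>u\<close> of the previous lemma, so \<open>2xz\<close> has at most twice the norm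
of \<open>z\<close>; the choice \<open>z = x\<close> gives \<open>\<parallel>x\<parallel>\<^sup>2 \<le> \<parallel>x\<parallel>\<close>.\<close>

lemma nrm_le_1_of_complement:
  assumes c: "x \<in> carrier A" "y \<in> carrier A"
    and sa: "invol A x = x" "invol A y = y" and comm: "x \<otimes> y = y \<otimes> x"
    and eq: "x \<otimes> x = y \<oplus> (y \<ominus> y \<otimes> y)"
  shows "nrm A x \<le> 1"
proof -
  note cl = cstar_mult_closed
  define x' where "x' = (-1) \<odot> x"
  define v where "v = x \<ominus> y \<otimes> x"
  have v: "v \<in> carrier A" using c by (simp add: v_def cl)
  have 1: "nrm A (x \<otimes> x \<oplus> \<i> \<odot> v) = nrm A x"
    unfolding v_def by (rule unitary_isometry) (use assms in auto)
  \<comment> \<open>The hypotheses are symmetric in the sign of \<open>x\<close>, and the operator for \<open>-x\<close> is \<open>-u\<^sup>*\<close>.\<close>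
  have 2: "nrm A (x' \<otimes> x \<oplus> \<i> \<odot> v) = nrm A x"
    unfolding v_def by (rule unitary_isometry)
      (use assms in \<open>auto simp: x'_def invol_smult cstar_smult_left cstar_smult_right smult_smult cl\<close>)
  have "(x \<otimes> x \<oplus> \<i> \<odot> v) \<ominus> (x' \<otimes> x \<oplus> \<i> \<odot> v) = 2 \<odot> (x \<otimes> x)"
    using c v smult_diff_left[of "x \<otimes> x" 1 "-1"]
    by (simp add: x'_def add_diff_add cl cstar_smult_left)
  then have "2 * nrm A (x \<otimes> x) = nrm A ((x \<otimes> x \<oplus> \<i> \<odot> v) \<ominus> (x' \<otimes> x \<oplus> \<i> \<odot> v))"
    using c by (simp add: nrm_smult cl)
  also have "\<dots> \<le> nrm A (x \<otimes> x \<oplus> \<i> \<odot> v) + nrm A (x' \<otimes> x \<oplus> \<i> \<odot> v)"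
    using c v nrm_diff_triangle[of "x \<otimes> x \<oplus> \<i> \<odot> v" \<zero> "x' \<otimes> x \<oplus> \<i> \<odot> v"]
      nrm_diff_commute[of \<zero> "x' \<otimes> x \<oplus> \<i> \<odot> v"]
    by (simp add: cl x'_def)
  also have "\<dots> = 2 * nrm A x" using 1 2 by simp
  finally have "nrm A x * nrm A x \<le> nrm A x"
    using nrm_cstar[of x] c sa by (simp add: power2_eq_square)
  then show ?thesis
    using mult_le_cancel_right1[of "nrm A x" "nrm A x"] nrm_nonneg[of x] c
    by (cases "nrm A x = 0") (auto simp: mult_le_cancel_left2)
qed

lemma eq_of_tendsto:
  assumes "x \<in> carrier A" "y \<in> carrier A" "u \<longlonglongrightarrow> 0" "\<And>n. nrm A (x \<ominus> y) \<le> u n"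
  shows "x = y"
proof -
  have "nrm A (x \<ominus> y) \<le> 0"
    by (rule LIMSEQ_le_const[OF assms(3)]) (use assms in auto)
  then show ?thesis
    using assms nrm_nonneg[of "x \<ominus> y"] nrm_eq_zero[of "x \<ominus> y"] diff_eq_zero_iff[of x y] by simp
qed

end

sublocale cstar_algebra \<subseteq> pre_cstar
  using cstar_algebra_axioms by (simp add: cstar_algebra_iff)

text \<open>The element is \<open>b = 1 - sqrt (1 - a\<^sup>2)\<close>. It is the fixed point of \<open>b \<mapsto> (a\<^sup>2 + b\<^sup>2)/2\<close>, which maps the
ball whose radius \<open>r\<close> is the norm of \<open>a\<close> into itself and has Lipschitz constant \<open>r < 1\<close> there. Being self-adjoint
and commuting with \<open>a\<close> are preserved by this map and by limits.\<close>

lemma (in cstar_algebra) complement_exists: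
  assumes a: "a \<in> carrier A" "invol A a = a" "nrm A a < 1"
  shows "\<exists>b\<in>carrier A. invol A b = b \<and> a \<otimes> b = b \<otimes> a \<and> a \<otimes> a = b \<oplus> (b \<ominus> b \<otimes> b)"
proof -
  note cl = cstar_mult_closed invol_closed
  define r where "r = nrm A a"
  have r: "0 \<le> r" "r < 1" using a nrm_nonneg by (auto simp: r_def)
  define f where "f b = (1/2) \<odot> (a \<otimes> a \<oplus> b \<otimes> b)" for b
  define P where "P b \<longleftrightarrow> b \<in> carrier A \<and> invol A b = b \<and> a \<otimes> b = b \<otimes> a \<and> nrm A b \<le> r" for b
  have Pf: "P (f b)" if b: "P b" for b
  proof -
    have bc: "b \<in> carrier A" using b by (simp add: P_def)
    have "a \<otimes> (b \<otimes> b) = b \<otimes> b \<otimes> a"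
      using b a by (metis P_def cstar_mult_assoc)
    moreover have "nrm A (f b) \<le> r"
    proof -
      have "nrm A (f b) \<le> (1/2) * (nrm A (a \<otimes> a) + nrm A (b \<otimes> b))"
        using a bc nrm_triangle[of "a \<otimes> a" "b \<otimes> b"] by (simp add: f_def nrm_smult cl)
      also have "\<dots> \<le> (1/2) * (r * r + r * r)"
        using nrm_mult[of a a] nrm_mult[of b b] mult_mono[of "nrm A b" r "nrm A b" r] a b r
        by (simp add: P_def r_def nrm_nonneg)
      also have "\<dots> \<le> r" using r by (simp add: mult_left_le)
      finally show ?thesis .
    qed
    ultimately show ?thesis
      using a b by (simp add: P_def f_def cl invol_smult invol_add invol_mult
          cstar_smult_left cstar_smult_right cstar_distl cstar_distr cstar_mult_assoc)
  qed
  have lip: "nrm A (f b \<ominus> f c) \<le> r * nrm A (b \<ominus> c)" if b: "P b" and c: "P c" for b c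
  proof -
    have bc: "b \<in> carrier A" "c \<in> carrier A" using b c by (auto simp: P_def)
    have "f b \<ominus> f c = (1/2) \<odot> ((b \<ominus> c) \<otimes> b \<oplus> c \<otimes> (b \<ominus> c))"
      using a bc by (simp add: f_def smult_diff cl add_diff_add mult_diff_mult)
    then have "nrm A (f b \<ominus> f c) \<le> (1/2) * (nrm A ((b \<ominus> c) \<otimes> b) + nrm A (c \<otimes> (b \<ominus> c)))"
      using bc nrm_triangle[of "(b \<ominus> c) \<otimes> b" "c \<otimes> (b \<ominus> c)"] by (simp add: nrm_smult cl)
    also have "\<dots> \<le> (1/2) * (nrm A (b \<ominus> c) * r + r * nrm A (b \<ominus> c))"
      using bc nrm_mult[of "b \<ominus> c" b] nrm_mult[of c "b \<ominus> c"] b c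
        mult_left_mono[of "nrm A b" r "nrm A (b \<ominus> c)"] mult_right_mono[of "nrm A c" r "nrm A (b \<ominus> c)"]
      by (simp add: P_def nrm_nonneg mult.commute)
    finally show ?thesis by (simp add: mult.commute)
  qed
  define B where "B n = (f ^^ n) \<zero>" for n
  have P0: "P \<zero>" using a r by (simp add: P_def)
  have PB: "P (B n)" for n
    by (induction n) (auto simp: B_def P0 Pf)
  have Bc: "B n \<in> carrier A" for n using PB[of n] by (simp add: P_def)
  have iter: "nrm A ((f ^^ n) b \<ominus> (f ^^ n) c) \<le> r ^ n * nrm A (b \<ominus> c) \<and> P ((f ^^ n) b) \<and> P ((f ^^ n) c)"
    if "P b" "P c" for n b c
  proof (induction n)
    case (Suc n)
    then have "nrm A ((f ^^ Suc n) b \<ominus> (f ^^ Suc n) c) \<le> r * nrm A ((f ^^ n) b \<ominus> (f ^^ n) c)"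
      using lip by simp
    also have "\<dots> \<le> r * (r ^ n * nrm A (b \<ominus> c))"
      using Suc r by (intro mult_left_mono) auto
    finally show ?case using Suc Pf by (simp add: mult.assoc)
  qed (use that in auto)
  have cauchy: "\<exists>N. \<forall>n\<ge>N. \<forall>n'\<ge>N. nrm A (B n \<ominus> B n') < \<epsilon>" if "\<epsilon> > 0" for \<epsilon>
  proof -
    have "(\<lambda>n. r ^ n * 2) \<longlonglongrightarrow> 0 * 2"
      using r by (intro tendsto_mult LIMSEQ_power_zero tendsto_const) auto
    then have "\<forall>\<^sub>F n in sequentially. r ^ n * 2 < \<epsilon>"
      using that by (intro order_tendstoD) auto
    then obtain N where N: "r ^ N * 2 < \<epsilon>" by (auto simp: eventually_sequentially)
    have "nrm A (B n \<ominus> B n') < \<epsilon>" if n: "n \<ge> N" "n' \<ge> N" for n n'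
    proof -
      have split: "B k = (f ^^ N) (B (k - N))" if "k \<ge> N" for k
        using that by (simp add: B_def flip: funpow_add[unfolded o_def, THEN fun_cong])
      have "nrm A (B n \<ominus> B n') \<le> r ^ N * nrm A (B (n - N) \<ominus> B (n' - N))"
        using iter[OF PB PB, of N "n - N" "n' - N"] split n by simp
      also have "nrm A (B (n - N) \<ominus> B (n' - N)) \<le> nrm A (B (n - N)) + nrm A (B (n' - N))"
        using nrm_diff_triangle[OF Bc M.zero_closed Bc, of "n - N" "n' - N"]
          nrm_diff_commute[OF M.zero_closed Bc] Bc by simp
      also have "\<dots> \<le> 2"
        using PB[of "n - N"] PB[of "n' - N"] r by (simp add: P_def)
      finally show ?thesis using N r by (simp add: mult_left_mono)
    qed
    then show ?thesis by blast
  qed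
  obtain b where b: "b \<in> carrier A" and lim: "(\<lambda>n. nrm A (B n \<ominus> b)) \<longlonglongrightarrow> 0"
    using cstar_complete[unfolded complete_iff, rule_format, of B] Bc cauchy by blast
  have lim2: "(\<lambda>n. k * nrm A (B n \<ominus> b)) \<longlonglongrightarrow> 0" for k
    using tendsto_mult_left[OF lim, of k] by simp
  have sa: "invol A b = b"
  proof (rule eq_of_tendsto)
    show "(\<lambda>n. 2 * nrm A (B n \<ominus> b)) \<longlonglongrightarrow> 0" by (rule lim2)
    fix n
    have "nrm A (invol A b \<ominus> b) \<le> nrm A (invol A b \<ominus> B n) + nrm A (B n \<ominus> b)"
      using b Bc by (intro nrm_diff_triangle cl)
    also have "invol A b \<ominus> B n = invol A (b \<ominus> B n)"
      using PB[of n] b by (simp add: P_def flip: invol_diff)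
    also have "nrm A (invol A (b \<ominus> B n)) = nrm A (B n \<ominus> b)"
      using b Bc by (simp add: nrm_diff_commute)
    finally show "nrm A (invol A b \<ominus> b) \<le> 2 * nrm A (B n \<ominus> b)" by simp
  qed (use b in \<open>auto simp: cl\<close>)
  have comm: "a \<otimes> b = b \<otimes> a"
  proof (rule eq_of_tendsto)
    show "(\<lambda>n. 2 * nrm A (B n \<ominus> b)) \<longlonglongrightarrow> 0" by (rule lim2)
    fix n
    have "nrm A (a \<otimes> b \<ominus> b \<otimes> a) \<le> nrm A (a \<otimes> b \<ominus> a \<otimes> B n) + nrm A (a \<otimes> B n \<ominus> b \<otimes> a)"
      using a b Bc by (intro nrm_diff_triangle cl)
    also have "a \<otimes> b \<ominus> a \<otimes> B n = a \<otimes> (b \<ominus> B n)"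
      using a b Bc by (simp add: mult_diff_mult cl)
    also have "a \<otimes> B n \<ominus> b \<otimes> a = (B n \<ominus> b) \<otimes> a"
      using PB[of n] a b Bc by (simp add: P_def mult_diff_mult cl)
    also have "nrm A (a \<otimes> (b \<ominus> B n)) \<le> 1 * nrm A (B n \<ominus> b)"
      using a b Bc nrm_mult[of a "b \<ominus> B n"] mult_right_mono[of "nrm A a" 1 "nrm A (B n \<ominus> b)"]
      by (simp add: nrm_diff_commute[of b] nrm_nonneg)
    also have "nrm A ((B n \<ominus> b) \<otimes> a) \<le> nrm A (B n \<ominus> b) * 1"
      using a b Bc[of n] nrm_mult[of "B n \<ominus> b" a] mult_left_mono[of "nrm A a" 1 "nrm A (B n \<ominus> b)"]
      by (simp add: nrm_nonneg)
    finally show "nrm A (a \<otimes> b \<ominus> b \<otimes> a) \<le> 2 * nrm A (B n \<ominus> b)" by simp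
  qed (use a b in \<open>auto simp: cl\<close>)
  have "nrm A b \<le> r"
  proof (rule LIMSEQ_le_const)
    show "(\<lambda>n. r + nrm A (B n \<ominus> b)) \<longlonglongrightarrow> r"
      using tendsto_add[OF tendsto_const lim, of r] by simp
    have "nrm A b \<le> r + nrm A (B n \<ominus> b)" for n
      using nrm_le_nrm_diff[OF b Bc, of n] PB[of n] nrm_diff_commute[OF b Bc, of n] by (simp add: P_def)
    then show "\<exists>N. \<forall>n\<ge>N. nrm A b \<le> r + nrm A (B n \<ominus> b)" by blast
  qed
  then have Pb: "P b" using b sa comm by (simp add: P_def)
  have fb: "f b = b"
  proof (rule eq_of_tendsto)
    show "(\<lambda>n. r * nrm A (B n \<ominus> b) + nrm A (B (Suc n) \<ominus> b)) \<longlonglongrightarrow> 0"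
      using tendsto_add[OF lim2 LIMSEQ_Suc[OF lim], of r] by simp
    fix n
    have "nrm A (f b \<ominus> b) \<le> nrm A (f b \<ominus> B (Suc n)) + nrm A (B (Suc n) \<ominus> b)"
      using Pf[OF Pb] b Bc by (intro nrm_diff_triangle) (auto simp: P_def)
    also have "nrm A (f b \<ominus> B (Suc n)) \<le> r * nrm A (B n \<ominus> b)"
      using lip[OF Pb PB, of n] b Bc[of n] by (simp add: B_def nrm_diff_commute)
    finally show "nrm A (f b \<ominus> b) \<le> r * nrm A (B n \<ominus> b) + nrm A (B (Suc n) \<ominus> b)" by simp
  qed (use b Pf[OF Pb] in \<open>auto simp: P_def\<close>)
  have "b \<oplus> b = 2 \<odot> f b"
    using b smult_add_left[of b 1 1] by (simp add: fb)
  also have "\<dots> = a \<otimes> a \<oplus> b \<otimes> b"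
    using a b by (simp add: f_def smult_smult cl)
  finally have e: "a \<otimes> a \<oplus> b \<otimes> b = b \<oplus> b" ..
  have "a \<otimes> a = (a \<otimes> a \<oplus> b \<otimes> b) \<ominus> b \<otimes> b"
    using a b by (simp add: M.minus_eq M.a_assoc M.r_neg cl)
  also have "\<dots> = b \<oplus> (b \<ominus> b \<otimes> b)"
    unfolding e using b by (simp add: M.minus_eq M.a_assoc cl)
  finally show ?thesis using b sa comm by blast
qed

lemma star_homD:
  assumes "h \<in> star_hom A B"
  shows "x \<in> carrier A \<Longrightarrow> h x \<in> carrier B"
    and "x \<in> carrier A \<Longrightarrow> y \<in> carrier A \<Longrightarrow> h (x \<oplus>\<^bsub>A\<^esub> y) = h x \<oplus>\<^bsub>B\<^esub> h y"
    and "x \<in> carrier A \<Longrightarrow> y \<in> carrier A \<Longrightarrow> h (x \<otimes>\<^bsub>A\<^esub> y) = h x \<otimes>\<^bsub>B\<^esub> h y"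
    and "x \<in> carrier A \<Longrightarrow> h (c \<odot>\<^bsub>A\<^esub> x) = c \<odot>\<^bsub>B\<^esub> h x"
    and "x \<in> carrier A \<Longrightarrow> h (invol A x) = invol B (h x)"
  using assms by (auto simp: star_hom_def)

lemma star_hom_diff:
  assumes "pre_cstar A" "pre_cstar B" "h \<in> star_hom A B" "x \<in> carrier A" "y \<in> carrier A"
  shows "h (x \<ominus>\<^bsub>A\<^esub> y) = h x \<ominus>\<^bsub>B\<^esub> h y"
proof -
  interpret A: pre_cstar A by fact
  interpret B: pre_cstar B by fact
  show ?thesis
    using assms(4,5) by (simp add: A.diff_conv_smult B.diff_conv_smult star_homD[OF assms(3)])
qed

lemma star_hom_zero:
  assumes "pre_cstar A" "pre_cstar B" "h \<in> star_hom A B"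
  shows "h \<zero>\<^bsub>A\<^esub> = \<zero>\<^bsub>B\<^esub>"
proof -
  interpret A: pre_cstar A by fact
  interpret B: pre_cstar B by fact
  have "h (0 \<odot>\<^bsub>A\<^esub> \<zero>\<^bsub>A\<^esub>) = 0 \<odot>\<^bsub>B\<^esub> h \<zero>\<^bsub>A\<^esub>"
    by (rule star_homD[OF assms(3)]) simp
  then show ?thesis by (simp add: star_homD(1)[OF assms(3)])
qed

text \<open>The relation between \<open>a\<close> and \<open>b\<close> in \<open>complement_exists\<close> is algebraic, so it passes to the
images under \<open>h\<close> although \<open>h\<close> is not known to be continuous. This settles self-adjoint
elements of norm below 1; the others follow by scaling and from the C*-identity.\<close>

theorem star_hom_contractive:
  assumes "cstar_algebra A" "pre_cstar B" "h \<in> star_hom A B" "x \<in> carrier A"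
  shows "nrm B (h x) \<le> nrm A x"
proof -
  interpret A: cstar_algebra A by fact
  interpret B: pre_cstar B by fact
  note h = star_homD[OF assms(3)]
  have unit_ball: "nrm B (h a) \<le> 1" if a: "a \<in> carrier A" "invol A a = a" "nrm A a < 1" for a
  proof -
    obtain b where b: "b \<in> carrier A" "invol A b = b" "a \<otimes>\<^bsub>A\<^esub> b = b \<otimes>\<^bsub>A\<^esub> a"
        "a \<otimes>\<^bsub>A\<^esub> a = b \<oplus>\<^bsub>A\<^esub> (b \<ominus>\<^bsub>A\<^esub> b \<otimes>\<^bsub>A\<^esub> b)"
      using A.complement_exists[OF a] by blast
    have diff: "h (b \<ominus>\<^bsub>A\<^esub> b \<otimes>\<^bsub>A\<^esub> b) = h b \<ominus>\<^bsub>B\<^esub> h b \<otimes>\<^bsub>B\<^esub> h b"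
      using b star_hom_diff[OF A.pre_cstar_axioms assms(2,3)]
      by (simp add: h A.cstar_mult_closed)
    show ?thesis
    proof (rule B.nrm_le_1_of_complement)
      show "h a \<otimes>\<^bsub>B\<^esub> h a = h b \<oplus>\<^bsub>B\<^esub> (h b \<ominus>\<^bsub>B\<^esub> h b \<otimes>\<^bsub>B\<^esub> h b)"
        using a b diff by (metis A.cstar_mult_closed A.diff_carrier h(2,3))
      show "h a \<otimes>\<^bsub>B\<^esub> h b = h b \<otimes>\<^bsub>B\<^esub> h a" using a b by (metis h(3))
      show "invol B (h a) = h a" "invol B (h b) = h b" using a b by (metis h(5))+
    qed (use a b in \<open>auto simp: h\<close>)
  qed
  have self_adjoint: "nrm B (h a) \<le> nrm A a" if a: "a \<in> carrier A" "invol A a = a" for a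
  proof (rule field_le_epsilon)
    fix \<epsilon> :: real assume "0 < \<epsilon>"
    define t where "t = nrm A a + \<epsilon>"
    have t: "t > 0" "nrm A a < t" using A.nrm_nonneg[of a] a \<open>0 < \<epsilon>\<close> by (auto simp: t_def)
    have "nrm B (h (complex_of_real (1/t) \<odot>\<^bsub>A\<^esub> a)) \<le> 1"
      using a t by (intro unit_ball) (auto simp: A.invol_smult A.nrm_smult norm_divide)
    then have "(1/t) * nrm B (h a) \<le> 1"
      using a t by (simp add: h B.nrm_smult norm_divide)
    then show "nrm B (h a) \<le> nrm A a + \<epsilon>" using t by (simp add: field_simps t_def)
  qed
  have "(nrm B (h x))\<^sup>2 = nrm B (h (invol A x \<otimes>\<^bsub>A\<^esub> x))"
    using assms(4) by (simp add: h A.invol_closed B.nrm_cstar)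
  also have "\<dots> \<le> nrm A (invol A x \<otimes>\<^bsub>A\<^esub> x)"
    using assms(4) by (intro self_adjoint)
      (auto simp: A.invol_mult A.invol_closed A.invol_invol A.cstar_mult_closed)
  also have "\<dots> = (nrm A x)\<^sup>2" using assms(4) by (simp add: A.nrm_cstar)
  finally show ?thesis using A.nrm_nonneg[OF assms(4)] by (rule power2_le_imp_le)
qed

lemma star_hom_dist_le:
  assumes "cstar_algebra A" "pre_cstar B" "h \<in> star_hom A B" "x \<in> carrier A" "y \<in> carrier A"
  shows "nrm B (h x \<ominus>\<^bsub>B\<^esub> h y) \<le> nrm A (x \<ominus>\<^bsub>A\<^esub> y)"
proof -
  have A: "pre_cstar A" using assms(1) by (simp add: cstar_algebra_iff)
  interpret A: pre_cstar A by fact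
  show ?thesis
    using star_hom_contractive[OF assms(1-3), of "x \<ominus>\<^bsub>A\<^esub> y"] star_hom_diff[OF A assms(2-5)] assms(4,5)
    by simp
qed

section \<open>Algebras of sections with the supremum norm\<close>

text \<open>Direct sums, algebras of continuous functions and skeleta of NCCW complexes all consist of families
\<open>x i \<in> A i\<close>, \<open>i \<in> I\<close>, from a prescribed set \<open>S\<close>, with pointwise operations and the supremum norm. They are
treated together under this definition.\<close>

definition sections :: "'i set \<Rightarrow> ('i \<Rightarrow> 'a cstar) \<Rightarrow> ('i \<Rightarrow> 'a) set \<Rightarrow> ('i \<Rightarrow> 'a) cstar" where
  "sections I A S = \<lparr>
     carrier = S,
     mult = (\<lambda>x y. \<lambda>i\<in>I. x i \<otimes>\<^bsub>A i\<^esub> y i),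
     one = (\<lambda>i\<in>I. \<one>\<^bsub>A i\<^esub>),
     zero = (\<lambda>i\<in>I. \<zero>\<^bsub>A i\<^esub>),
     add = (\<lambda>x y. \<lambda>i\<in>I. x i \<oplus>\<^bsub>A i\<^esub> y i),
     smult = (\<lambda>c x. \<lambda>i\<in>I. c \<odot>\<^bsub>A i\<^esub> x i),
     invol = (\<lambda>x. \<lambda>i\<in>I. invol (A i) (x i)),
     nrm = (\<lambda>x. Sup (insert 0 ((\<lambda>i. nrm (A i) (x i)) ` I)))\<rparr>"

lemma sections_simps [simp]:
  "carrier (sections I A S) = S"
  "x \<otimes>\<^bsub>sections I A S\<^esub> y = (\<lambda>i\<in>I. x i \<otimes>\<^bsub>A i\<^esub> y i)"
  "\<zero>\<^bsub>sections I A S\<^esub> = (\<lambda>i\<in>I. \<zero>\<^bsub>A i\<^esub>)"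
  "x \<oplus>\<^bsub>sections I A S\<^esub> y = (\<lambda>i\<in>I. x i \<oplus>\<^bsub>A i\<^esub> y i)"
  "c \<odot>\<^bsub>sections I A S\<^esub> x = (\<lambda>i\<in>I. c \<odot>\<^bsub>A i\<^esub> x i)"
  "invol (sections I A S) x = (\<lambda>i\<in>I. invol (A i) (x i))"
  by (simp_all add: sections_def)

lemma nrm_sections:
  "nrm (sections I A S) x = Sup (insert 0 ((\<lambda>i. nrm (A i) (x i)) ` I))"
  by (simp add: sections_def)

lemma sections_carrier_update: "(sections I A S)\<lparr>carrier := S'\<rparr> = sections I A S'"
  by (simp add: sections_def)

locale section_space =
  fixes I :: "'i set" and A :: "'i \<Rightarrow> 'a cstar" and S :: "('i \<Rightarrow> 'a) set"
  assumes fibre: "i \<in> I \<Longrightarrow> pre_cstar (A i)"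
    and sub: "S \<subseteq> (\<Pi>\<^sub>E i\<in>I. carrier (A i))"
    and bdd: "x \<in> S \<Longrightarrow> bdd_above ((\<lambda>i. nrm (A i) (x i)) ` I)"
    and zero_mem: "(\<lambda>i\<in>I. \<zero>\<^bsub>A i\<^esub>) \<in> S"
    and add_mem: "\<lbrakk>x \<in> S; y \<in> S\<rbrakk> \<Longrightarrow> (\<lambda>i\<in>I. x i \<oplus>\<^bsub>A i\<^esub> y i) \<in> S"
    and mult_mem: "\<lbrakk>x \<in> S; y \<in> S\<rbrakk> \<Longrightarrow> (\<lambda>i\<in>I. x i \<otimes>\<^bsub>A i\<^esub> y i) \<in> S"
    and smult_mem: "x \<in> S \<Longrightarrow> (\<lambda>i\<in>I. c \<odot>\<^bsub>A i\<^esub> x i) \<in> S"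
    and invol_mem: "x \<in> S \<Longrightarrow> (\<lambda>i\<in>I. invol (A i) (x i)) \<in> S"
begin

abbreviation "Alg \<equiv> sections I A S"

lemma fibre_carrier: "x \<in> S \<Longrightarrow> i \<in> I \<Longrightarrow> x i \<in> carrier (A i)"
  using sub by auto

lemma section_extensional: "x \<in> S \<Longrightarrow> x \<in> extensional I"
  using sub by (auto simp: PiE_iff)

lemmas section_eqI = extensionalityI[of _ I]

text \<open>With this description of the norm, the inequalities between norms need no suprema: they hold because
they hold in each fibre.\<close>

lemma nrm_le_iff:
  assumes "x \<in> S"
  shows "nrm Alg x \<le> c \<longleftrightarrow> 0 \<le> c \<and> (\<forall>i\<in>I. nrm (A i) (x i) \<le> c)"
  unfolding nrm_sections using bdd[OF assms] by (subst cSup_le_iff) auto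

lemma nrm_fibre_le: "x \<in> S \<Longrightarrow> i \<in> I \<Longrightarrow> nrm (A i) (x i) \<le> nrm Alg x"
  using nrm_le_iff[of x "nrm Alg x"] by simp

lemma nrm_sections_nonneg: "x \<in> S \<Longrightarrow> 0 \<le> nrm Alg x"
  using nrm_le_iff[of x "nrm Alg x"] by simp

lemmas fibre_module = fibre[THEN pre_cstar.axioms(1)]
lemmas fibre_group = fibre_module[THEN module.axioms(2)]
lemmas fibre_monoid = fibre_group[THEN abelian_group.axioms(1)]

lemmas fibre_laws =
  fibre_monoid[THEN abelian_monoid.a_closed] fibre_monoid[THEN abelian_monoid.zero_closed]
  fibre[THEN pre_cstar.cstar_mult_closed] fibre[THEN pre_cstar.smult_carrier]
  fibre[THEN pre_cstar.invol_closed]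
  fibre_monoid[THEN abelian_monoid.a_assoc] fibre_monoid[THEN abelian_monoid.l_zero]
  fibre[THEN pre_cstar.smult_add_left] fibre[THEN pre_cstar.smult_add_right]
  fibre[THEN pre_cstar.smult_smult] fibre[THEN pre_cstar.smult_1]
  fibre[THEN pre_cstar.cstar_mult_assoc] fibre[THEN pre_cstar.cstar_distl]
  fibre[THEN pre_cstar.cstar_distr] fibre[THEN pre_cstar.cstar_smult_left]
  fibre[THEN pre_cstar.cstar_smult_right] fibre[THEN pre_cstar.invol_invol]
  fibre[THEN pre_cstar.invol_add] fibre[THEN pre_cstar.invol_smult]
  fibre[THEN pre_cstar.invol_mult]

lemma abelian_group_sections: "abelian_group Alg"
proof (rule abelian_groupI)
  note mem = zero_mem add_mem smult_mem
  fix x assume "x \<in> carrier Alg"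
  then have x: "x \<in> S" by simp
  show "\<exists>y\<in>carrier Alg. y \<oplus>\<^bsub>Alg\<^esub> x = \<zero>\<^bsub>Alg\<^esub>"
  proof (rule bexI)
    have "(-1) \<odot>\<^bsub>A i\<^esub> x i \<oplus>\<^bsub>A i\<^esub> x i = \<zero>\<^bsub>A i\<^esub>" if i: "i \<in> I" for i
    proof -
      interpret F: pre_cstar "A i" using i by (rule fibre)
      show ?thesis
        using x i F.smult_add_left[of "x i" "-1" 1] by (simp add: fibre_carrier)
    qed
    then show "((-1) \<odot>\<^bsub>Alg\<^esub> x) \<oplus>\<^bsub>Alg\<^esub> x = \<zero>\<^bsub>Alg\<^esub>"
      by (intro section_eqI) auto
    show "(-1) \<odot>\<^bsub>Alg\<^esub> x \<in> carrier Alg" using x by (simp add: mem)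
  qed
  fix y assume y: "y \<in> carrier Alg"
  show "x \<oplus>\<^bsub>Alg\<^esub> y = y \<oplus>\<^bsub>Alg\<^esub> x"
    using x y by (intro section_eqI)
      (auto simp: mem fibre_carrier intro!: abelian_monoid.a_comm[OF fibre_monoid])
qed (auto simp: zero_mem add_mem fibre_carrier fibre_laws section_extensional
      intro!: section_eqI)

sublocale pre_cstar Alg
proof (intro pre_cstar.intro moduleI cring_complex_ring abelian_group_sections pre_cstar_axioms.intro)
  fix x assume x: "x \<in> carrier Alg"
  then have xS: "x \<in> S" by simp
  show "0 \<le> nrm Alg x"
    using xS by (rule nrm_sections_nonneg)
  show "nrm Alg x = 0 \<longleftrightarrow> x = \<zero>\<^bsub>Alg\<^esub>"
  proof
    assume "nrm Alg x = 0"
    then have "nrm (A i) (x i) = 0" if "i \<in> I" for i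
      using nrm_fibre_le[OF xS that] pre_cstar.nrm_nonneg[OF fibre[OF that] fibre_carrier[OF xS that]] by simp
    then show "x = \<zero>\<^bsub>Alg\<^esub>"
      using xS by (intro section_eqI) (auto simp: section_extensional pre_cstar.nrm_eq_zero[OF fibre] fibre_carrier)
  next
    assume "x = \<zero>\<^bsub>Alg\<^esub>"
    then have "nrm Alg x \<le> 0"
      using xS by (subst nrm_le_iff) (auto simp: pre_cstar.nrm_zero[OF fibre])
    then show "nrm Alg x = 0" using nrm_sections_nonneg[OF xS] by simp
  qed
  have smult_le: "nrm Alg (c \<odot>\<^bsub>Alg\<^esub> x) \<le> cmod c * nrm Alg x" if "x \<in> S" for c x
    using that by (subst nrm_le_iff)
      (auto simp: smult_mem nrm_sections_nonneg pre_cstar.nrm_smult[OF fibre] fibre_carrier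
        intro!: mult_left_mono nrm_fibre_le)
  fix c
  show "nrm Alg (c \<odot>\<^bsub>Alg\<^esub> x) = cmod c * nrm Alg x"
  proof (cases "c = 0")
    case True
    then show ?thesis
      using smult_le[OF xS, of c] nrm_sections_nonneg[OF smult_mem[OF xS], of c] by simp
  next
    case False
    have "x = inverse c \<odot>\<^bsub>Alg\<^esub> (c \<odot>\<^bsub>Alg\<^esub> x)"
      using False xS
      by (intro section_eqI) (auto simp: fibre_laws fibre_carrier section_extensional)
    then have "nrm Alg x \<le> cmod (inverse c) * nrm Alg (c \<odot>\<^bsub>Alg\<^esub> x)"
      using smult_le[of "c \<odot>\<^bsub>Alg\<^esub> x" "inverse c"] xS smult_mem by simp
    then have "cmod c * nrm Alg x \<le> nrm Alg (c \<odot>\<^bsub>Alg\<^esub> x)"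
      using False by (simp add: norm_inverse norm_divide field_simps)
    then show ?thesis using smult_le[OF xS, of c] by simp
  qed
  show "nrm Alg (invol Alg x \<otimes>\<^bsub>Alg\<^esub> x) = (nrm Alg x)\<^sup>2"
  proof (rule antisym)
    have "nrm (A i) (invol (A i) (x i) \<otimes>\<^bsub>A i\<^esub> x i) \<le> (nrm Alg x)\<^sup>2" if "i \<in> I" for i
      using that xS by (simp add: pre_cstar.nrm_cstar[OF fibre] fibre_carrier
          power_mono nrm_fibre_le pre_cstar.nrm_nonneg[OF fibre])
    then show "nrm Alg (invol Alg x \<otimes>\<^bsub>Alg\<^esub> x) \<le> (nrm Alg x)\<^sup>2"
      using xS mult_mem[OF invol_mem[OF xS] xS] by (simp add: nrm_le_iff)
    let ?w = "invol Alg x \<otimes>\<^bsub>Alg\<^esub> x"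
    have w: "?w \<in> S" using mult_mem[OF invol_mem[OF xS] xS] by simp
    have "nrm (A i) (x i) \<le> sqrt (nrm Alg ?w)" if "i \<in> I" for i
    proof (rule real_le_rsqrt)
      show "(nrm (A i) (x i))\<^sup>2 \<le> nrm Alg ?w"
        using nrm_fibre_le[OF w that] that xS
        by (simp add: pre_cstar.nrm_cstar[OF fibre] fibre_carrier)
    qed
    then have "nrm Alg x \<le> sqrt (nrm Alg ?w)"
      using xS nrm_sections_nonneg[OF w] by (simp add: nrm_le_iff)
    then have "(nrm Alg x)\<^sup>2 \<le> (sqrt (nrm Alg ?w))\<^sup>2"
      using nrm_sections_nonneg[OF xS] by (rule power_mono)
    then show "(nrm Alg x)\<^sup>2 \<le> nrm Alg ?w"
      using nrm_sections_nonneg[OF w] by simp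
  qed
  fix y assume y: "y \<in> carrier Alg"
  then have yS: "y \<in> S" by simp
  show "nrm Alg (x \<oplus>\<^bsub>Alg\<^esub> y) \<le> nrm Alg x + nrm Alg y"
  proof -
    have "nrm (A i) (x i \<oplus>\<^bsub>A i\<^esub> y i) \<le> nrm Alg x + nrm Alg y" if "i \<in> I" for i
      using pre_cstar.nrm_triangle[OF fibre[OF that] fibre_carrier[OF xS that] fibre_carrier[OF yS that]]
        nrm_fibre_le[OF xS that] nrm_fibre_le[OF yS that] by simp
    then show ?thesis
      using add_mem[OF xS yS] nrm_sections_nonneg[OF xS] nrm_sections_nonneg[OF yS]
      by (simp add: nrm_le_iff)
  qed
  show "nrm Alg (x \<otimes>\<^bsub>Alg\<^esub> y) \<le> nrm Alg x * nrm Alg y"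
  proof -
    have "nrm (A i) (x i \<otimes>\<^bsub>A i\<^esub> y i) \<le> nrm Alg x * nrm Alg y" if "i \<in> I" for i
      using pre_cstar.nrm_mult[OF fibre[OF that] fibre_carrier[OF xS that] fibre_carrier[OF yS that]]
        mult_mono[OF nrm_fibre_le[OF xS that] nrm_fibre_le[OF yS that]] nrm_sections_nonneg[OF xS]
        pre_cstar.nrm_nonneg[OF fibre[OF that] fibre_carrier[OF yS that]] by simp
    then show ?thesis
      using mult_mem[OF xS yS] nrm_sections_nonneg[OF xS] nrm_sections_nonneg[OF yS]
      by (simp add: nrm_le_iff)
  qed
qed (auto simp: zero_mem add_mem mult_mem smult_mem invol_mem fibre_carrier fibre_laws section_extensional
      intro!: section_eqI)

lemma sections_diff:
  assumes "x \<in> S" "y \<in> S" "i \<in> I"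
  shows "(x \<ominus>\<^bsub>Alg\<^esub> y) i = x i \<ominus>\<^bsub>A i\<^esub> y i"
  using assms by (simp add: diff_conv_smult pre_cstar.diff_conv_smult[OF fibre] fibre_carrier)

text \<open>A Cauchy sequence of sections converges in every fibre, and uniformly so by the Cauchy condition; what
remains to be known is that \<open>S\<close> is closed under uniform limits.\<close>

theorem cstar_algebra_sections:
  assumes alg: "\<And>i. i \<in> I \<Longrightarrow> cstar_algebra (A i)"
    and closed: "\<And>(\<sigma> :: nat \<Rightarrow> 'i \<Rightarrow> 'a) x. \<lbrakk>\<And>n. \<sigma> n \<in> S; x \<in> (\<Pi>\<^sub>E i\<in>I. carrier (A i));
      \<And>\<epsilon>. \<epsilon> > 0 \<Longrightarrow> \<exists>N. \<forall>n\<ge>N. \<forall>i\<in>I. nrm (A i) (\<sigma> n i \<ominus>\<^bsub>A i\<^esub> x i) \<le> \<epsilon>\<rbrakk> \<Longrightarrow> x \<in> S"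
  shows "cstar_algebra Alg"
  unfolding cstar_algebra_iff
proof (intro conjI pre_cstar_axioms, unfold complete_iff, intro allI impI, elim conjE)
  fix \<sigma> :: "nat \<Rightarrow> 'i \<Rightarrow> 'a"
  assume "\<forall>n. \<sigma> n \<in> carrier Alg"
  then have \<sigma>: "\<sigma> n \<in> S" for n by simp
  assume "\<forall>\<epsilon>>0. \<exists>N. \<forall>n\<ge>N. \<forall>n'\<ge>N. nrm Alg (\<sigma> n \<ominus>\<^bsub>Alg\<^esub> \<sigma> n') < \<epsilon>"
  then have cauchy: "\<exists>N. \<forall>n\<ge>N. \<forall>n'\<ge>N. nrm Alg (\<sigma> n \<ominus>\<^bsub>Alg\<^esub> \<sigma> n') < \<epsilon>" if "\<epsilon> > 0" for \<epsilon>
    using that by blast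
  have diffS: "\<sigma> n \<ominus>\<^bsub>Alg\<^esub> \<sigma> n' \<in> S" for n n'
    using \<sigma> diff_carrier[of "\<sigma> n" "\<sigma> n'"] by simp
  have fibre_diff: "nrm (A i) (\<sigma> n i \<ominus>\<^bsub>A i\<^esub> \<sigma> n' i) \<le> nrm Alg (\<sigma> n \<ominus>\<^bsub>Alg\<^esub> \<sigma> n')"
    if "i \<in> I" for i n n'
    using nrm_fibre_le[OF diffS that, of n n'] sections_diff[OF \<sigma> \<sigma> that] by simp
  have "\<exists>l\<in>carrier (A i). (\<lambda>n. nrm (A i) (\<sigma> n i \<ominus>\<^bsub>A i\<^esub> l)) \<longlonglongrightarrow> 0" if i: "i \<in> I" for i
  proof -
    interpret F: cstar_algebra "A i" using i by (rule alg)
    have "\<exists>N. \<forall>n\<ge>N. \<forall>n'\<ge>N. nrm (A i) (\<sigma> n i \<ominus>\<^bsub>A i\<^esub> \<sigma> n' i) < \<epsilon>" if "\<epsilon> > 0" for \<epsilon>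
      using cauchy[OF that] fibre_diff[OF i] by (meson le_less_trans)
    then show ?thesis
      using F.cstar_complete[unfolded F.complete_iff, rule_format, of "\<lambda>n. \<sigma> n i"]
        fibre_carrier[OF \<sigma> i] by blast
  qed
  then obtain l where l: "\<And>i. i \<in> I \<Longrightarrow> l i \<in> carrier (A i)"
      "\<And>i. i \<in> I \<Longrightarrow> (\<lambda>n. nrm (A i) (\<sigma> n i \<ominus>\<^bsub>A i\<^esub> l i)) \<longlonglongrightarrow> 0"
    by metis
  define x where "x = restrict l I"
  have unif: "\<exists>N. \<forall>n\<ge>N. \<forall>i\<in>I. nrm (A i) (\<sigma> n i \<ominus>\<^bsub>A i\<^esub> x i) \<le> \<epsilon>" if "\<epsilon> > 0" for \<epsilon>
  proof -
    obtain N where N: "\<And>n n'. n \<ge> N \<Longrightarrow> n' \<ge> N \<Longrightarrow> nrm Alg (\<sigma> n \<ominus>\<^bsub>Alg\<^esub> \<sigma> n') < \<epsilon>"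
      using cauchy[OF \<open>\<epsilon> > 0\<close>] by blast
    have "nrm (A i) (\<sigma> n i \<ominus>\<^bsub>A i\<^esub> x i) \<le> \<epsilon>" if n: "n \<ge> N" and i: "i \<in> I" for n i
    proof (rule LIMSEQ_le_const)
      show "(\<lambda>k. \<epsilon> + nrm (A i) (\<sigma> k i \<ominus>\<^bsub>A i\<^esub> l i)) \<longlonglongrightarrow> \<epsilon>"
        using tendsto_add[OF tendsto_const l(2)[OF i], of \<epsilon>] by simp
      have "nrm (A i) (\<sigma> n i \<ominus>\<^bsub>A i\<^esub> x i) \<le> \<epsilon> + nrm (A i) (\<sigma> k i \<ominus>\<^bsub>A i\<^esub> l i)" if "k \<ge> N" for k
        using pre_cstar.nrm_diff_triangle[OF fibre[OF i] fibre_carrier[OF \<sigma> i] fibre_carrier[OF \<sigma> i] l(1)[OF i], of n k]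
          fibre_diff[OF i, of n k] N[OF n that] i by (simp add: x_def)
      then show "\<exists>M. \<forall>k\<ge>M. nrm (A i) (\<sigma> n i \<ominus>\<^bsub>A i\<^esub> x i) \<le> \<epsilon> + nrm (A i) (\<sigma> k i \<ominus>\<^bsub>A i\<^esub> l i)"
        by blast
    qed
    then show ?thesis by blast
  qed
  have xS: "x \<in> S"
    by (rule closed[of \<sigma>]) (use \<sigma> unif in \<open>auto simp: x_def l\<close>)
  have "(\<lambda>n. nrm Alg (\<sigma> n \<ominus>\<^bsub>Alg\<^esub> x)) \<longlonglongrightarrow> 0"
  proof (rule LIMSEQ_I)
    fix e :: real assume "0 < e"
    then obtain N where N: "\<And>n i. n \<ge> N \<Longrightarrow> i \<in> I \<Longrightarrow> nrm (A i) (\<sigma> n i \<ominus>\<^bsub>A i\<^esub> x i) \<le> e / 2"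
      using unif[of "e/2"] by auto
    have "nrm Alg (\<sigma> n \<ominus>\<^bsub>Alg\<^esub> x) \<le> e / 2" if "n \<ge> N" for n
      using nrm_le_iff[of "\<sigma> n \<ominus>\<^bsub>Alg\<^esub> x" "e/2"] diff_carrier[of "\<sigma> n" x] \<sigma>[of n] xS N[OF that] \<open>0 < e\<close>
      by (simp add: sections_diff)
    then have "nrm Alg (\<sigma> n \<ominus>\<^bsub>Alg\<^esub> x) < e" if "n \<ge> N" for n
      using that \<open>0 < e\<close> by fastforce
    moreover have "0 \<le> nrm Alg (\<sigma> n \<ominus>\<^bsub>Alg\<^esub> x)" for n
      using \<sigma>[of n] xS diff_carrier[of "\<sigma> n" x] by (intro nrm_nonneg) auto
    ultimately show "\<exists>N. \<forall>n\<ge>N. norm (nrm Alg (\<sigma> n \<ominus>\<^bsub>Alg\<^esub> x) - 0) < e"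
      by (intro exI[of _ N]) auto
  qed
  then show "\<exists>x\<in>carrier Alg. (\<lambda>n. nrm Alg (\<sigma> n \<ominus>\<^bsub>Alg\<^esub> x)) \<longlonglongrightarrow> 0"
    using xS by auto
qed

end

subsection \<open>Finite direct sums\<close>

lemma dsum_cstar_eq_sections:
  "finite I \<Longrightarrow> dsum_cstar I A = sections I A (\<Pi>\<^sub>E i\<in>I. carrier (A i))"
  by (simp add: dsum_cstar_def sections_def cSup_eq_Max)

lemma section_space_dsum:
  assumes "finite I" "\<And>i. i \<in> I \<Longrightarrow> pre_cstar (A i)"
  shows "section_space I A (\<Pi>\<^sub>E i\<in>I. carrier (A i))"
proof -
  have M: "abelian_monoid (A i)" if "i \<in> I" for i
    using assms(2)[OF that] by (simp add: pre_cstar_def module_def abelian_group_def)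
  show ?thesis
    by (rule section_space.intro)
      (auto simp: assms Pi_iff PiE_iff bdd_above_finite abelian_monoid.zero_closed[OF M] abelian_monoid.a_closed[OF M]
        pre_cstar.cstar_mult_closed[OF assms(2)] pre_cstar.smult_carrier[OF assms(2)]
        pre_cstar.invol_closed[OF assms(2)])
qed

lemma cstar_algebra_dsum:
  assumes "finite I" "\<And>i. i \<in> I \<Longrightarrow> cstar_algebra (A i)"
  shows "cstar_algebra (dsum_cstar I A)"
proof -
  have "section_space I A (\<Pi>\<^sub>E i\<in>I. carrier (A i))"
    using assms by (intro section_space_dsum) (auto simp: cstar_algebra_iff)
  then show ?thesis
    using assms by (simp add: dsum_cstar_eq_sections section_space.cstar_algebra_sections)
qed

context pre_cstar
begin

text \<open>The span of a finite set, in the form that the definition of finite-dimensional algebras uses.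
Knowing that it is closed under the operations spares the handling of explicit coefficients.\<close>

definition lin_span :: "'a set \<Rightarrow> 'a set" where
  "lin_span B = {x. \<exists>c. x = (\<Oplus>b\<in>B. c b \<odot> b)}"

context
  fixes B assumes B: "finite B" "B \<subseteq> carrier A"
begin

lemma lin_span_zero: "\<zero> \<in> lin_span B"
proof -
  have "(\<Oplus>b\<in>B. 0 \<odot> b) = \<zero>"
    using B by (intro M.add.finprod_one_eqI) auto
  then show ?thesis unfolding lin_span_def by (intro CollectI exI[of _ "\<lambda>_. 0"]) simp
qed

lemma lin_span_add:
  assumes "x \<in> lin_span B" "y \<in> lin_span B"
  shows "x \<oplus> y \<in> lin_span B"
proof -
  obtain c d where cd: "x = (\<Oplus>b\<in>B. c b \<odot> b)" "y = (\<Oplus>b\<in>B. d b \<odot> b)"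
    using assms by (auto simp: lin_span_def)
  have "(\<Oplus>b\<in>B. (c b + d b) \<odot> b) = (\<Oplus>b\<in>B. c b \<odot> b \<oplus> d b \<odot> b)"
    using B by (intro M.finsum_cong') (auto simp: smult_add_left)
  also have "\<dots> = x \<oplus> y"
    unfolding cd using B by (intro M.finsum_addf) auto
  finally show ?thesis unfolding lin_span_def by (intro CollectI exI[of _ "\<lambda>b. c b + d b"]) simp
qed

lemma lin_span_smult:
  assumes "x \<in> lin_span B"
  shows "k \<odot> x \<in> lin_span B"
proof -
  obtain c where c: "x = (\<Oplus>b\<in>B. c b \<odot> b)"
    using assms by (auto simp: lin_span_def)
  have "(\<Oplus>b\<in>B. (k * c b) \<odot> b) = (\<Oplus>b\<in>B. k \<odot> (c b \<odot> b))"
    using B by (intro M.finsum_cong') (auto simp: smult_smult)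
  also have "\<dots> = k \<odot> x"
    unfolding c using B by (intro finsum_smult_ldistr[symmetric]) auto
  finally show ?thesis unfolding lin_span_def by (intro CollectI exI[of _ "\<lambda>b. k * c b"]) simp
qed

lemma lin_span_base:
  assumes "b \<in> B"
  shows "b \<in> lin_span B"
proof -
  have "(\<Oplus>x\<in>B. (if b = x then 1 else 0) \<odot> x) = (\<Oplus>x\<in>B. if b = x then x else \<zero>)"
    using B by (intro M.finsum_cong') auto
  also have "\<dots> = b"
    using B assms by (intro M.finsum_singleton) auto
  finally show ?thesis unfolding lin_span_def
    by (intro CollectI exI[of _ "\<lambda>x. if b = x then 1 else 0"]) simp
qed

end

end

text \<open>A spanning set is the union of the embedded spanning sets of the summands.\<close>

lemma fin_dim_dsum:
  assumes I: "finite I" and fd: "\<And>i. i \<in> I \<Longrightarrow> fin_dim_cstar (A i)"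
  shows "fin_dim_cstar (dsum_cstar I A)"
proof -
  have alg: "cstar_algebra (A i)" if "i \<in> I" for i
    using fd[OF that] by (simp add: fin_dim_cstar_def)
  then have pre: "pre_cstar (A i)" if "i \<in> I" for i
    using that by (simp add: cstar_algebra_iff)
  let ?S = "\<Pi>\<^sub>E i\<in>I. carrier (A i)"
  interpret section_space I A ?S
    by (rule section_space_dsum[OF I pre])
  have "\<forall>i\<in>I. \<exists>B. finite B \<and> B \<subseteq> carrier (A i) \<and>
        (\<forall>x \<in> carrier (A i). \<exists>c. x = (\<Oplus>\<^bsub>A i\<^esub>b\<in>B. c b \<odot>\<^bsub>A i\<^esub> b))"
    using fd by (simp add: fin_dim_cstar_def)
  from bchoice[OF this] obtain B where "\<forall>i\<in>I. finite (B i) \<and> B i \<subseteq> carrier (A i) \<and>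
        (\<forall>x \<in> carrier (A i). \<exists>c. x = (\<Oplus>\<^bsub>A i\<^esub>b\<in>B i. c b \<odot>\<^bsub>A i\<^esub> b))" ..
  note B = bspec[OF this]
  define emb where "emb i v = (\<lambda>k\<in>I. if k = i then v else \<zero>\<^bsub>A k\<^esub>)" for i v
  define C where "C = (\<Union>i\<in>I. emb i ` B i)"
  have emb_carrier: "emb i v \<in> ?S" if "v \<in> carrier (A i)" for i v
    using that fibre_laws(2) by (auto simp: emb_def PiE_iff)
  have C: "finite C" "C \<subseteq> carrier Alg"
  proof -
    show "finite C" using B I by (simp add: C_def)
    show "C \<subseteq> carrier Alg" unfolding C_def sections_simps
    proof (intro UN_least image_subsetI)
      fix i b assume "i \<in> I" "b \<in> B i"
      with B[of i] show "emb i b \<in> ?S" by (intro emb_carrier) auto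
    qed
  qed
  have emb_add: "emb i (u \<oplus>\<^bsub>A i\<^esub> v) = emb i u \<oplus>\<^bsub>Alg\<^esub> emb i v" for i u v
    by (rule section_eqI) (auto simp: emb_def fibre_laws)
  have emb_smult: "emb i (c \<odot>\<^bsub>A i\<^esub> v) = c \<odot>\<^bsub>Alg\<^esub> emb i v" for i c v
    by (rule section_eqI) (auto simp: emb_def pre_cstar.smult_zero[OF fibre])
  have emb_span: "emb i v \<in> lin_span C" if i: "i \<in> I" and v: "v \<in> carrier (A i)" for i v
  proof -
    interpret F: pre_cstar "A i" using i by (rule pre)
    obtain c where c: "v = (\<Oplus>\<^bsub>A i\<^esub>b\<in>B i. c b \<odot>\<^bsub>A i\<^esub> b)" using B[OF i] v by blast
    have "emb i (\<Oplus>\<^bsub>A i\<^esub>b\<in>F. c b \<odot>\<^bsub>A i\<^esub> b) \<in> lin_span C" if "finite F" "F \<subseteq> B i" for F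
      using that
    proof (induction F rule: finite_induct)
      case empty
      have "emb i \<zero>\<^bsub>A i\<^esub> = \<zero>\<^bsub>Alg\<^esub>" by (auto simp: emb_def fun_eq_iff)
      show ?case unfolding F.M.finsum_empty \<open>emb i \<zero>\<^bsub>A i\<^esub> = \<zero>\<^bsub>Alg\<^esub>\<close> by (rule lin_span_zero[OF C])
    next
      case (insert b F)
      then have b: "b \<in> B i" "b \<in> carrier (A i)" and F: "F \<subseteq> carrier (A i)" using B[OF i] by auto
      have "(\<Oplus>\<^bsub>A i\<^esub>b\<in>insert b F. c b \<odot>\<^bsub>A i\<^esub> b) = c b \<odot>\<^bsub>A i\<^esub> b \<oplus>\<^bsub>A i\<^esub> (\<Oplus>\<^bsub>A i\<^esub>b\<in>F. c b \<odot>\<^bsub>A i\<^esub> b)"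
        using insert.hyps b F by (intro F.M.finsum_insert) auto
      moreover have "emb i b \<in> lin_span C"
        using b i by (intro lin_span_base[OF C]) (auto simp: C_def)
      ultimately show ?case
        using insert by (simp only: emb_add emb_smult) (auto intro!: lin_span_add[OF C] lin_span_smult[OF C]
            simp del: sections_simps)
    qed
    then show ?thesis using c B[OF i] by simp
  qed
  have "x \<in> lin_span C" if x: "x \<in> ?S" for x
  proof -
    have "(\<lambda>k\<in>I. if k \<in> J then x k else \<zero>\<^bsub>A k\<^esub>) \<in> lin_span C" if "finite J" "J \<subseteq> I" for J
      using that
    proof (induction J rule: finite_induct)
      case empty
      have "(\<lambda>k\<in>I. if k \<in> {} then x k else \<zero>\<^bsub>A k\<^esub>) = \<zero>\<^bsub>Alg\<^esub>"
        by (rule section_eqI) auto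
      then show ?case by (simp only: lin_span_zero[OF C])
    next
      case (insert j J)
      have "(\<lambda>k\<in>I. if k \<in> insert j J then x k else \<zero>\<^bsub>A k\<^esub>) =
          emb j (x j) \<oplus>\<^bsub>Alg\<^esub> (\<lambda>k\<in>I. if k \<in> J then x k else \<zero>\<^bsub>A k\<^esub>)"
        using insert x by (intro section_eqI)
          (auto simp: emb_def fibre_laws fibre_carrier abelian_monoid.r_zero[OF fibre_monoid])
      moreover have "emb j (x j) \<in> lin_span C"
        using insert x by (intro emb_span fibre_carrier) auto
      moreover have "(\<lambda>k\<in>I. if k \<in> J then x k else \<zero>\<^bsub>A k\<^esub>) \<in> lin_span C"
        by (rule insert.IH) (use insert.prems in blast)
      ultimately show ?case by (simp only: lin_span_add[OF C])
    qed
    from this[of I] have "(\<lambda>k\<in>I. if k \<in> I then x k else \<zero>\<^bsub>A k\<^esub>) \<in> lin_span C" using I by simp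
    moreover have "(\<lambda>k\<in>I. if k \<in> I then x k else \<zero>\<^bsub>A k\<^esub>) = x"
      using x by (intro section_eqI) (auto simp: section_extensional)
    ultimately show ?thesis by simp
  qed
  then show ?thesis
    using C cstar_algebra_dsum[OF I alg] unfolding fin_dim_cstar_def lin_span_def
    by (auto simp: dsum_cstar_eq_sections[OF I])
qed

section \<open>Algebras of continuous functions\<close>

text \<open>Continuity with values in a C*-algebra is tested on sequences. As all domains are first countable this is
the topological notion (\<open>continuous_map_iff_seq_cont\<close>), and every proof of continuity becomes an estimate by
a null sequence of real numbers.\<close>

definition seq_cont :: "'p::{first_countable_topology,t2_space} set \<Rightarrow> 'a cstar \<Rightarrow> ('p \<Rightarrow> 'a) \<Rightarrow> bool" where
  "seq_cont S F f \<longleftrightarrow> f \<in> S \<rightarrow> carrier F \<and>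
     (\<forall>p q. (\<forall>n. p n \<in> S) \<longrightarrow> q \<in> S \<longrightarrow> p \<longlonglongrightarrow> q \<longrightarrow>
        (\<lambda>n. nrm F (f (p n) \<ominus>\<^bsub>F\<^esub> f q)) \<longlonglongrightarrow> 0)"

lemma seq_contI:
  assumes "\<And>p. p \<in> S \<Longrightarrow> f p \<in> carrier F"
    and "\<And>p q. (\<And>n. p n \<in> S) \<Longrightarrow> q \<in> S \<Longrightarrow> p \<longlonglongrightarrow> q \<Longrightarrow>
        (\<lambda>n. nrm F (f (p n) \<ominus>\<^bsub>F\<^esub> f q)) \<longlonglongrightarrow> 0"
  shows "seq_cont S F f"
  using assms by (simp add: seq_cont_def)

lemma seq_cont_carrier: "seq_cont S F f \<Longrightarrow> p \<in> S \<Longrightarrow> f p \<in> carrier F"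
  by (auto simp: seq_cont_def)

lemma seq_contD:
  "seq_cont S F f \<Longrightarrow> (\<And>n. p n \<in> S) \<Longrightarrow> q \<in> S \<Longrightarrow> p \<longlonglongrightarrow> q \<Longrightarrow>
    (\<lambda>n. nrm F (f (p n) \<ominus>\<^bsub>F\<^esub> f q)) \<longlonglongrightarrow> 0"
  by (auto simp: seq_cont_def)

lemma seq_cont_cong: "(\<And>p. p \<in> S \<Longrightarrow> f p = g p) \<Longrightarrow> seq_cont S F f \<longleftrightarrow> seq_cont S F g"
proof -
  have imp: "seq_cont S F g" if eq: "\<And>p. p \<in> S \<Longrightarrow> f p = g p" and f: "seq_cont S F f" for f g
  proof (rule seq_contI)
    fix p q assume p: "\<And>n. p n \<in> S" "q \<in> S" "p \<longlonglongrightarrow> q"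
    show "(\<lambda>n. nrm F (g (p n) \<ominus>\<^bsub>F\<^esub> g q)) \<longlonglongrightarrow> 0"
      using seq_contD[OF f p] eq[OF p(1)] eq[OF p(2)] by simp
  qed (use seq_cont_carrier[OF f] eq in fastforce)
  assume "\<And>p. p \<in> S \<Longrightarrow> f p = g p"
  then show ?thesis using imp[of f g] imp[of g f] by auto
qed

lemma seq_cont_restrict [simp]: "seq_cont S F (restrict f S) \<longleftrightarrow> seq_cont S F f"
  by (rule seq_cont_cong) auto

lemma seq_cont_compose:
  assumes "seq_cont S F f" "continuous_on T g" "\<And>p. p \<in> T \<Longrightarrow> g p \<in> S"
  shows "seq_cont T F (\<lambda>p. f (g p))"
proof (rule seq_contI)
  fix p q assume p: "\<And>n. p n \<in> T" "q \<in> T" "p \<longlonglongrightarrow> q"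
  then have "(\<lambda>n. g (p n)) \<longlonglongrightarrow> g q"
    using assms(2) unfolding continuous_on_sequentially o_def by blast
  then show "(\<lambda>n. nrm F (f (g (p n)) \<ominus>\<^bsub>F\<^esub> f (g q))) \<longlonglongrightarrow> 0"
    using assms p by (intro seq_contD[OF assms(1)]) auto
qed (use assms seq_cont_carrier in blast)

lemma seq_cont_subset: "seq_cont S F f \<Longrightarrow> T \<subseteq> S \<Longrightarrow> seq_cont T F f"
  using seq_cont_compose[of S F f T "\<lambda>p. p"] by auto

context pre_cstar
begin

lemma null_sequence_le:
  assumes "u \<longlonglongrightarrow> (0::real)" "\<And>n. x n \<in> carrier A" "\<And>n. nrm A (x n) \<le> u n"
  shows "(\<lambda>n. nrm A (x n)) \<longlonglongrightarrow> 0"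
  by (rule Lim_null_comparison[OF _ assms(1)]) (use assms nrm_nonneg in auto)

lemma continuous_map_iff_seq_cont:
  "continuous_map (top_of_set S) (cstar_topology A) f \<longleftrightarrow> seq_cont S A f"
proof
  assume "continuous_map (top_of_set S) (cstar_topology A) f"
  then have L: "\<And>x \<epsilon>. x \<in> S \<Longrightarrow> \<epsilon> > 0 \<Longrightarrow>
      \<exists>U. openin (top_of_set S) U \<and> x \<in> U \<and> (\<forall>y\<in>U. f y \<in> metric.mball (f x) \<epsilon>)"
    by (simp add: cstar_topology_def metric.continuous_map_to_metric)
  have fc: "f p \<in> carrier A" if "p \<in> S" for p
    using L[OF that zero_less_one] by (auto simp: metric.in_mball)
  then show "seq_cont S A f"
  proof (rule seq_contI)
    fix p q assume p: "\<And>n. p n \<in> S" "q \<in> S" "p \<longlonglongrightarrow> q"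
    show "(\<lambda>n. nrm A (f (p n) \<ominus> f q)) \<longlonglongrightarrow> 0"
    proof (rule tendstoI)
      fix e :: real assume "e > 0"
      obtain U where U: "openin (top_of_set S) U" "q \<in> U" "\<And>y. y \<in> U \<Longrightarrow> f y \<in> metric.mball (f q) e"
        using L[OF p(2) \<open>e > 0\<close>] by blast
      then obtain T where T: "open T" "U = S \<inter> T" by (auto simp: openin_open)
      have "\<forall>\<^sub>F n in sequentially. p n \<in> T"
        using U T by (intro topological_tendstoD[OF p(3)]) auto
      then show "\<forall>\<^sub>F n in sequentially. dist (nrm A (f (p n) \<ominus> f q)) 0 < e"
      proof eventually_elim
        case (elim n)
        then have "cstar_dist A (f q) (f (p n)) < e"
          using U(3)[of "p n"] p(1) T by (simp add: metric.in_mball)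
        then show ?case
          using fc[OF p(1)] fc[OF p(2)]
          by (simp add: cstar_dist_def nrm_diff_commute nrm_nonneg)
      qed
    qed
  qed
next
  assume f: "seq_cont S A f"
  note fc = seq_cont_carrier[OF f]
  show "continuous_map (top_of_set S) (cstar_topology A) f"
    unfolding cstar_topology_def metric.continuous_map_to_metric
  proof (intro ballI allI impI)
    fix x and e :: real assume x: "x \<in> topspace (top_of_set S)" and "e > 0"
    then have xS: "x \<in> S" by simp
    have "continuous (at x within S) (\<lambda>p. nrm A (f p \<ominus> f x))"
      unfolding continuous_within_sequentially o_def
      using seq_contD[OF f _ xS] xS fc[OF xS] by auto
    then have "((\<lambda>p. nrm A (f p \<ominus> f x)) \<longlongrightarrow> 0) (at x within S)"
      using fc[OF xS] by (simp add: continuous_within)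
    then have "\<forall>\<^sub>F p in at x within S. nrm A (f p \<ominus> f x) < e"
      using \<open>e > 0\<close> by (rule order_tendstoD)
    then obtain T where T: "open T" "x \<in> T" "\<And>y. y \<in> T \<Longrightarrow> y \<noteq> x \<Longrightarrow> y \<in> S \<Longrightarrow> nrm A (f y \<ominus> f x) < e"
      unfolding eventually_at_topological by blast
    have "f y \<in> metric.mball (f x) e" if "y \<in> S \<inter> T" for y
      using that T(3)[of y] fc[of y] fc[OF xS] \<open>e > 0\<close>
      by (cases "y = x") (auto simp: metric.in_mball cstar_dist_def nrm_diff_commute)
    then show "\<exists>U. openin (top_of_set S) U \<and> x \<in> U \<and> (\<forall>y\<in>U. f y \<in> metric.mball (f x) e)"
      using T xS by (intro exI[of _ "S \<inter> T"]) (auto simp: openin_open)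
  qed
qed

lemma carrier_cont:
  "carrier (cont_cstar (top_of_set S) A) = {f \<in> extensional S. seq_cont S A f}"
  by (simp add: cont_cstar_def continuous_map_iff_seq_cont)

lemma seq_cont_const: "x \<in> carrier A \<Longrightarrow> seq_cont S A (\<lambda>_. x)"
  by (rule seq_contI) auto

lemma seq_cont_add:
  assumes f: "seq_cont S A f" and g: "seq_cont S A g"
  shows "seq_cont S A (\<lambda>p. f p \<oplus> g p)"
proof (rule seq_contI)
  note c = seq_cont_carrier[OF f] seq_cont_carrier[OF g]
  fix p q assume p: "\<And>n. p n \<in> S" "q \<in> S" "p \<longlonglongrightarrow> q"
  show "(\<lambda>n. nrm A ((f (p n) \<oplus> g (p n)) \<ominus> (f q \<oplus> g q))) \<longlonglongrightarrow> 0"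
  proof (rule null_sequence_le)
    show "(\<lambda>n. nrm A (f (p n) \<ominus> f q) + nrm A (g (p n) \<ominus> g q)) \<longlonglongrightarrow> 0"
      using tendsto_add[OF seq_contD[OF f p] seq_contD[OF g p]] by simp
    show "nrm A ((f (p n) \<oplus> g (p n)) \<ominus> (f q \<oplus> g q)) \<le> nrm A (f (p n) \<ominus> f q) + nrm A (g (p n) \<ominus> g q)" for n
      using c p by (simp add: add_diff_add nrm_triangle)
  qed (use c p in auto)
qed (use f g seq_cont_carrier in \<open>auto intro!: M.a_closed\<close>)

lemma seq_cont_mult:
  assumes f: "seq_cont S A f" and g: "seq_cont S A g"
  shows "seq_cont S A (\<lambda>p. f p \<otimes> g p)"
proof (rule seq_contI)
  note c = seq_cont_carrier[OF f] seq_cont_carrier[OF g]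
  fix p q assume p: "\<And>n. p n \<in> S" "q \<in> S" "p \<longlonglongrightarrow> q"
  define u where "u n = nrm A (f (p n) \<ominus> f q)" for n
  define v where "v n = nrm A (g (p n) \<ominus> g q)" for n
  have u: "u \<longlonglongrightarrow> 0" and v: "v \<longlonglongrightarrow> 0"
    using seq_contD[OF f p] seq_contD[OF g p] by (simp_all add: u_def[abs_def] v_def[abs_def])
  show "(\<lambda>n. nrm A (f (p n) \<otimes> g (p n) \<ominus> f q \<otimes> g q)) \<longlonglongrightarrow> 0"
  proof (rule null_sequence_le)
    have "(\<lambda>n. u n * (nrm A (g q) + v n) + nrm A (f q) * v n) \<longlonglongrightarrow> 0 * (nrm A (g q) + 0) + nrm A (f q) * 0"
      by (intro tendsto_intros u v)
    then show "(\<lambda>n. u n * (nrm A (g q) + v n) + nrm A (f q) * v n) \<longlonglongrightarrow> 0" by simp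
    fix n
    have "nrm A (f (p n) \<otimes> g (p n) \<ominus> f q \<otimes> g q)
        \<le> nrm A ((f (p n) \<ominus> f q) \<otimes> g (p n)) + nrm A (f q \<otimes> (g (p n) \<ominus> g q))"
      using c p by (simp add: mult_diff_mult nrm_triangle cstar_mult_closed)
    also have "\<dots> \<le> u n * nrm A (g (p n)) + nrm A (f q) * v n"
      unfolding u_def v_def using c p by (intro add_mono nrm_mult) auto
    also have "\<dots> \<le> u n * (nrm A (g q) + v n) + nrm A (f q) * v n"
      unfolding u_def v_def using c p
      by (intro add_right_mono mult_left_mono nrm_le_nrm_diff nrm_nonneg) auto
    finally show "nrm A (f (p n) \<otimes> g (p n) \<ominus> f q \<otimes> g q)
        \<le> u n * (nrm A (g q) + v n) + nrm A (f q) * v n" .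
  qed (use c p in \<open>auto simp: cstar_mult_closed\<close>)
qed (use f g seq_cont_carrier in \<open>auto intro!: cstar_mult_closed\<close>)

lemma seq_cont_smult:
  assumes f: "seq_cont S A f" and k: "continuous_on S k"
  shows "seq_cont S A (\<lambda>p. k p \<odot> f p)"
proof (rule seq_contI)
  note c = seq_cont_carrier[OF f]
  fix p q assume p: "\<And>n. p n \<in> S" "q \<in> S" "p \<longlonglongrightarrow> q"
  have kl: "(\<lambda>n. k (p n)) \<longlonglongrightarrow> k q"
    using k p unfolding continuous_on_sequentially o_def by blast
  define u where "u n = nrm A (f (p n) \<ominus> f q)" for n
  have u: "u \<longlonglongrightarrow> 0" using seq_contD[OF f p] by (simp add: u_def[abs_def])
  show "(\<lambda>n. nrm A (k (p n) \<odot> f (p n) \<ominus> k q \<odot> f q)) \<longlonglongrightarrow> 0"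
  proof (rule null_sequence_le)
    have "(\<lambda>n. cmod (k (p n)) * u n + cmod (k (p n) - k q) * nrm A (f q))
        \<longlonglongrightarrow> cmod (k q) * 0 + cmod (k q - k q) * nrm A (f q)"
      by (intro tendsto_intros u kl)
    then show "(\<lambda>n. cmod (k (p n)) * u n + cmod (k (p n) - k q) * nrm A (f q)) \<longlonglongrightarrow> 0" by simp
    fix n
    have "nrm A (k (p n) \<odot> f (p n) \<ominus> k q \<odot> f q)
        \<le> nrm A (k (p n) \<odot> f (p n) \<ominus> k (p n) \<odot> f q) + nrm A (k (p n) \<odot> f q \<ominus> k q \<odot> f q)"
      using c p by (intro nrm_diff_triangle) auto
    also have "\<dots> = cmod (k (p n)) * u n + cmod (k (p n) - k q) * nrm A (f q)"
      using c p by (simp add: smult_diff smult_diff_left nrm_smult u_def)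
    finally show "nrm A (k (p n) \<odot> f (p n) \<ominus> k q \<odot> f q)
        \<le> cmod (k (p n)) * u n + cmod (k (p n) - k q) * nrm A (f q)" .
  qed (use c p in auto)
qed (use seq_cont_carrier[OF f] in auto)

lemma seq_cont_invol:
  assumes f: "seq_cont S A f"
  shows "seq_cont S A (\<lambda>p. invol A (f p))"
proof (rule seq_contI)
  fix p q assume p: "\<And>n. p n \<in> S" "q \<in> S" "p \<longlonglongrightarrow> q"
  show "(\<lambda>n. nrm A (invol A (f (p n)) \<ominus> invol A (f q))) \<longlonglongrightarrow> 0"
    using seq_contD[OF f p] seq_cont_carrier[OF f] p by (simp add: invol_diff)
qed (use f seq_cont_carrier in \<open>auto intro!: invol_closed\<close>)

lemma seq_cont_norm:
  assumes f: "seq_cont S A f"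
  shows "continuous_on S (\<lambda>p. nrm A (f p))"
  unfolding continuous_on_sequentially o_def
proof (intro allI ballI impI, elim conjE)
  note c = seq_cont_carrier[OF f]
  fix p q assume q: "q \<in> S" and "\<forall>n. p n \<in> S" and lim: "p \<longlonglongrightarrow> q"
  then have p: "p n \<in> S" for n by simp
  have "(\<lambda>n. nrm A (f (p n)) - nrm A (f q)) \<longlonglongrightarrow> 0"
  proof (rule Lim_null_comparison[OF _ seq_contD[OF f p q lim]], intro always_eventually allI)
    fix n
    show "norm (nrm A (f (p n)) - nrm A (f q)) \<le> nrm A (f (p n) \<ominus> f q)"
      using nrm_le_nrm_diff[OF c[OF p] c[OF q], of n] nrm_le_nrm_diff[OF c[OF q] c[OF p], of n]
        nrm_diff_commute[OF c[OF q] c[OF p], of n] by simp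
  qed
  then show "(\<lambda>n. nrm A (f (p n))) \<longlonglongrightarrow> nrm A (f q)"
    by (simp add: LIM_zero_iff)
qed

lemma seq_cont_bdd:
  assumes "compact S" "seq_cont S A f"
  shows "bdd_above ((\<lambda>p. nrm A (f p)) ` S)"
  using compact_continuous_image[OF seq_cont_norm[OF assms(2)] assms(1)]
  by (intro bounded_imp_bdd_above compact_imp_bounded)

lemma seq_cont_uniform_limit:
  assumes \<sigma>: "\<And>n. seq_cont S A (\<sigma> n)" and f: "\<And>p. p \<in> S \<Longrightarrow> f p \<in> carrier A"
    and unif: "\<And>\<epsilon>. \<epsilon> > 0 \<Longrightarrow> \<exists>n::nat. \<forall>p\<in>S. nrm A (\<sigma> n p \<ominus> f p) \<le> \<epsilon>"
  shows "seq_cont S A f"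
proof (rule seq_contI[OF f])
  note c = seq_cont_carrier[OF \<sigma>]
  fix p q assume p: "\<And>n. p n \<in> S" "q \<in> S" "p \<longlonglongrightarrow> q"
  show "(\<lambda>n. nrm A (f (p n) \<ominus> f q)) \<longlonglongrightarrow> 0"
  proof (rule tendstoI)
    fix e :: real assume "e > 0"
    then obtain N where N: "\<And>p. p \<in> S \<Longrightarrow> nrm A (\<sigma> N p \<ominus> f p) \<le> e / 3"
      using unif[of "e/3"] by auto
    have "\<forall>\<^sub>F n in sequentially. nrm A (\<sigma> N (p n) \<ominus> \<sigma> N q) < e / 3"
      using \<open>e > 0\<close> by (intro order_tendstoD(2)[OF seq_contD[OF \<sigma> p]]) auto
    then show "\<forall>\<^sub>F n in sequentially. dist (nrm A (f (p n) \<ominus> f q)) 0 < e"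
    proof eventually_elim
      case (elim n)
      have "nrm A (f (p n) \<ominus> f q) \<le> nrm A (f (p n) \<ominus> \<sigma> N (p n)) + nrm A (\<sigma> N (p n) \<ominus> f q)"
        using c f p by (intro nrm_diff_triangle) auto
      also have "nrm A (\<sigma> N (p n) \<ominus> f q) \<le> nrm A (\<sigma> N (p n) \<ominus> \<sigma> N q) + nrm A (\<sigma> N q \<ominus> f q)"
        using c f p by (intro nrm_diff_triangle) auto
      also have "nrm A (f (p n) \<ominus> \<sigma> N (p n)) = nrm A (\<sigma> N (p n) \<ominus> f (p n))"
        using c f p by (simp add: nrm_diff_commute)
      finally have "nrm A (f (p n) \<ominus> f q) < e"
        using elim N[OF p(1), of n] N[OF p(2)] by linarith
      then show ?case using nrm_nonneg[of "f (p n) \<ominus> f q"] f p by simp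
    qed
  qed
qed

lemma cont_cstar_eq_sections:
  "cont_cstar (top_of_set S) A = sections S (\<lambda>_. A) (carrier (cont_cstar (top_of_set S) A))"
  by (simp add: cont_cstar_def sections_def)

lemma section_space_cont:
  fixes S :: "'p::{first_countable_topology,t2_space} set"
  assumes "compact S"
  shows "section_space S (\<lambda>_. A) (carrier (cont_cstar (top_of_set S) A))"
  by (rule section_space.intro)
    (auto simp: carrier_cont pre_cstar_axioms PiE_def seq_cont_carrier seq_cont_const
      intro!: seq_cont_add seq_cont_mult seq_cont_smult seq_cont_invol seq_cont_bdd[OF assms])

lemma pre_cstar_cont:
  fixes S :: "'p::{first_countable_topology,t2_space} set"
  assumes "compact S"
  shows "pre_cstar (cont_cstar (top_of_set S) A)"
proof -
  interpret C: section_space S "\<lambda>_. A" "carrier (cont_cstar (top_of_set S) A)"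
    by (rule section_space_cont[OF assms])
  show ?thesis using C.pre_cstar_axioms by (simp flip: cont_cstar_eq_sections)
qed

end

text \<open>Uniform limits of continuous functions are continuous, so \<open>cstar_algebra_sections\<close> applies.\<close>

lemma (in cstar_algebra) cstar_algebra_cont:
  fixes S :: "'p::{first_countable_topology,t2_space} set"
  assumes "compact S"
  shows "cstar_algebra (cont_cstar (top_of_set S) A)"
proof -
  interpret C: section_space S "\<lambda>_. A" "carrier (cont_cstar (top_of_set S) A)"
    by (rule section_space_cont[OF assms])
  have "cstar_algebra C.Alg"
  proof (rule C.cstar_algebra_sections)
    fix \<sigma> :: "nat \<Rightarrow> 'p \<Rightarrow> 'a" and f
    assume \<sigma>: "\<And>n. \<sigma> n \<in> carrier (cont_cstar (top_of_set S) A)"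
      and f: "f \<in> (\<Pi>\<^sub>E i\<in>S. carrier A)"
      and u: "\<And>\<epsilon>. \<epsilon> > 0 \<Longrightarrow> \<exists>N. \<forall>n\<ge>N. \<forall>i\<in>S. nrm A (\<sigma> n i \<ominus>\<^bsub>A\<^esub> f i) \<le> \<epsilon>"
    have "seq_cont S A f"
      by (rule seq_cont_uniform_limit[of _ \<sigma>]) (use \<sigma> f u in \<open>auto simp: carrier_cont, blast\<close>)
    then show "f \<in> carrier (cont_cstar (top_of_set S) A)"
      using f by (auto simp: carrier_cont PiE_iff)
  qed (rule cstar_algebra_axioms)
  then show ?thesis by (simp flip: cont_cstar_eq_sections)
qed

text \<open>The norm of a finite direct sum is at most the sum of the norms of the components.\<close>

lemma seq_cont_dsum_iff:
  assumes I: "finite I" and A: "\<And>i. i \<in> I \<Longrightarrow> pre_cstar (A i)"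
  shows "seq_cont S (dsum_cstar I A) f \<longleftrightarrow>
    (\<forall>p\<in>S. f p \<in> extensional I) \<and> (\<forall>i\<in>I. seq_cont S (A i) (\<lambda>p. f p i))"
proof -
  interpret D: section_space I A "\<Pi>\<^sub>E i\<in>I. carrier (A i)"
    by (rule section_space_dsum[OF assms])
  note eq = dsum_cstar_eq_sections[OF I]
  show ?thesis
  proof (intro iffI conjI ballI)
    assume f: "seq_cont S (dsum_cstar I A) f"
    note c = seq_cont_carrier[OF f, unfolded eq sections_simps]
    show "f p \<in> extensional I" if "p \<in> S" for p
      using c[OF that] by (rule D.section_extensional)
    fix i assume i: "i \<in> I"
    show "seq_cont S (A i) (\<lambda>p. f p i)"
    proof (rule seq_contI)
      fix p q assume p: "\<And>n. p n \<in> S" "q \<in> S" "p \<longlonglongrightarrow> q"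
      show "(\<lambda>n. nrm (A i) (f (p n) i \<ominus>\<^bsub>A i\<^esub> f q i)) \<longlonglongrightarrow> 0"
      proof (rule pre_cstar.null_sequence_le[OF A[OF i] seq_contD[OF f p]])
        show "f (p n) i \<ominus>\<^bsub>A i\<^esub> f q i \<in> carrier (A i)" for n
          using c p i D.fibre_carrier by (intro pre_cstar.diff_carrier[OF A[OF i]]) auto
        show "nrm (A i) (f (p n) i \<ominus>\<^bsub>A i\<^esub> f q i) \<le> nrm (dsum_cstar I A) (f (p n) \<ominus>\<^bsub>dsum_cstar I A\<^esub> f q)" for n
          using D.nrm_fibre_le[of "f (p n) \<ominus>\<^bsub>D.Alg\<^esub> f q" i] D.diff_carrier[of "f (p n)" "f q"]
            D.sections_diff[of "f (p n)" "f q" i] c p i by (simp add: eq)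
      qed
    qed (use c D.fibre_carrier i in blast)
  next
    assume "(\<forall>p\<in>S. f p \<in> extensional I) \<and> (\<forall>i\<in>I. seq_cont S (A i) (\<lambda>p. f p i))"
    then have ext: "\<And>p. p \<in> S \<Longrightarrow> f p \<in> extensional I"
      and f: "\<And>i. i \<in> I \<Longrightarrow> seq_cont S (A i) (\<lambda>p. f p i)" by auto
    have c: "f p \<in> (\<Pi>\<^sub>E i\<in>I. carrier (A i))" if "p \<in> S" for p
      using ext[OF that] seq_cont_carrier[OF f that] by (auto simp: PiE_iff)
    show "seq_cont S (dsum_cstar I A) f"
    proof (rule seq_contI)
      fix p q assume p: "\<And>n. p n \<in> S" "q \<in> S" "p \<longlonglongrightarrow> q"
      have dc: "f (p n) \<ominus>\<^bsub>D.Alg\<^esub> f q \<in> (\<Pi>\<^sub>E i\<in>I. carrier (A i))" for n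
        using D.diff_carrier[of "f (p n)" "f q"] c p by simp
      have fdc: "f (p n) i \<ominus>\<^bsub>A i\<^esub> f q i \<in> carrier (A i)" if "i \<in> I" for n i
        using that c p D.fibre_carrier by (intro pre_cstar.diff_carrier[OF A]) auto
      have "(\<lambda>n. nrm D.Alg (f (p n) \<ominus>\<^bsub>D.Alg\<^esub> f q)) \<longlonglongrightarrow> 0"
      proof (rule D.null_sequence_le)
        have "(\<lambda>n. \<Sum>i\<in>I. nrm (A i) (f (p n) i \<ominus>\<^bsub>A i\<^esub> f q i)) \<longlonglongrightarrow> (\<Sum>i\<in>I. 0)"
          using f p by (intro tendsto_sum seq_contD) auto
        then show "(\<lambda>n. \<Sum>i\<in>I. nrm (A i) (f (p n) i \<ominus>\<^bsub>A i\<^esub> f q i)) \<longlonglongrightarrow> 0" by simp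
        fix n
        have nn: "0 \<le> nrm (A i) (f (p n) i \<ominus>\<^bsub>A i\<^esub> f q i)" if "i \<in> I" for i
          using fdc that by (intro pre_cstar.nrm_nonneg[OF A]) auto
        have "nrm (A i) (f (p n) i \<ominus>\<^bsub>A i\<^esub> f q i) \<le> (\<Sum>i\<in>I. nrm (A i) (f (p n) i \<ominus>\<^bsub>A i\<^esub> f q i))"
          if "i \<in> I" for i
          using member_le_sum[of i I "\<lambda>i. nrm (A i) (f (p n) i \<ominus>\<^bsub>A i\<^esub> f q i)"] that nn I by auto
        then show "nrm D.Alg (f (p n) \<ominus>\<^bsub>D.Alg\<^esub> f q) \<le> (\<Sum>i\<in>I. nrm (A i) (f (p n) i \<ominus>\<^bsub>A i\<^esub> f q i))"
          using c p by (simp add: D.nrm_le_iff[OF dc] D.sections_diff sum_nonneg nn)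
      qed (use dc in simp)
      then show "(\<lambda>n. nrm (dsum_cstar I A) (f (p n) \<ominus>\<^bsub>dsum_cstar I A\<^esub> f q)) \<longlonglongrightarrow> 0" by (simp add: eq)
    qed (use c in \<open>simp add: eq\<close>)
  qed
qed

subsection \<open>Cubes\<close>

lemma cube_eq: "cube k = {x. (\<forall>i<k. 0 \<le> x i \<and> x i \<le> 1) \<and> (\<forall>i\<ge>k. x i = 0)}"
  by (auto simp: cube_def topspace_Euclidean_space)

lemma cube_boundary_eq: "cube_boundary k = {x \<in> cube k. \<exists>i<k. x i = 0 \<or> x i = 1}"
  by (force simp: cube_boundary_def open_cube_def cube_def topspace_Euclidean_space less_le)

lemma cube_boundary_subset: "cube_boundary k \<subseteq> cube k"
  by (auto simp: cube_boundary_def)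

lemma cube_top_eq: "cube_top k = top_of_set (cube k)"
  unfolding cube_top_def Euclidean_space_def subtopology_subtopology euclidean_product_topology
  by (rule arg_cong[of _ _ top_of_set]) (auto simp: cube_eq)

lemma sphere_top_eq: "sphere_top k = top_of_set (cube_boundary k)"
  unfolding sphere_top_def Euclidean_space_def subtopology_subtopology euclidean_product_topology
  by (rule arg_cong[of _ _ top_of_set]) (auto simp: cube_eq cube_boundary_eq)

lemma compact_cube: "compact (cube k)"
proof -
  have "cube k = (\<Pi>\<^sub>E i\<in>UNIV. if i < k then {0..1} else {0})"
    by (auto simp: cube_eq PiE_iff split: if_splits)
  moreover have "compactin (product_topology (\<lambda>i. euclideanreal) UNIV) (\<Pi>\<^sub>E i\<in>(UNIV::nat set). if i < k then {0..1} else {0})"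
    by (subst compactin_PiE) auto
  ultimately show ?thesis by (simp add: euclidean_product_topology)
qed

lemma compact_cube_boundary: "compact (cube_boundary k)"
proof -
  have cl: "closed {x :: nat \<Rightarrow> real. x i = c}" for i c
    by (intro closed_Collect_eq continuous_on_const continuous_on_product_coordinates)
  have "closed (\<Union>i\<in>{..<k}. {x :: nat \<Rightarrow> real. x i = 0} \<union> {x. x i = 1})"
    by (intro closed_UN closed_Un ballI cl finite_lessThan)
  moreover have "cube_boundary k = cube k \<inter> (\<Union>i\<in>{..<k}. {x. x i = 0} \<union> {x. x i = 1})"
    by (auto simp: cube_boundary_eq)
  ultimately show ?thesis using compact_cube by (simp add: compact_Int_closed)
qed

section \<open>Skeleta of NCCW complexes are C*-algebras\<close>

abbreviation cell :: "'f nccw \<Rightarrow> nat \<Rightarrow> ((nat \<Rightarrow> real) \<Rightarrow> 'f) cstar" where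
  "cell X j \<equiv> cont_cstar (cube_top j) (cell_alg X j)"

abbreviation cell_sphere :: "'f nccw \<Rightarrow> nat \<Rightarrow> ((nat \<Rightarrow> real) \<Rightarrow> 'f) cstar" where
  "cell_sphere X j \<equiv> cont_cstar (sphere_top j) (cell_alg X j)"

lemma cells_sum_eq_sections:
  "cells_sum X k = sections {..k} (cell X) (\<Pi>\<^sub>E j\<in>{..k}. carrier (cell X j))"
  by (simp add: cells_sum_def dsum_cstar_eq_sections)

lemma skeleton_eq_sections:
  "skeleton X k = sections {..k} (cell X) (skeleton_carrier X k)"
  by (simp add: skeleton_def cells_sum_eq_sections sections_carrier_update)

text \<open>The recursive pullback, unrolled: one attaching condition for each dimension.\<close>

lemma skeleton_carrier_iff:
  "x \<in> skeleton_carrier X k \<longleftrightarrow> x \<in> carrier (cells_sum X k) \<and>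
    (\<forall>l<k. restrict (x (Suc l)) (cube_boundary (Suc l)) = attach X (Suc l) (restrict x {..l}))"
proof (induction k arbitrary: x)
  case (Suc k)
  have r: "restrict (restrict x {..k}) {..l} = restrict x {..l}" if "l \<le> k" for l
    using that by (auto simp: restrict_def)
  define P where "P l \<longleftrightarrow> restrict (x (Suc l)) (cube_boundary (Suc l)) = attach X (Suc l) (restrict x {..l})" for l
  have P: "(\<forall>l<k. restrict (restrict x {..k} (Suc l)) (cube_boundary (Suc l)) =
      attach X (Suc l) (restrict (restrict x {..k}) {..l})) \<longleftrightarrow> (\<forall>l<k. P l)"
    unfolding P_def by (intro all_cong1 imp_cong refl) (simp add: r)
  have "restrict x {..k} \<in> carrier (cells_sum X k)" if "x \<in> carrier (cells_sum X (Suc k))"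
    using that by (auto simp: cells_sum_eq_sections PiE_iff)
  then show ?case
    unfolding skeleton_carrier.simps mem_Collect_eq Suc P P_def[symmetric] All_less_Suc by blast
qed simp

lemma restrict_star_hom:
  "l \<le> k \<Longrightarrow> (\<lambda>x. restrict x {..l}) \<in> star_hom (cells_sum X k) (cells_sum X l)"
  by (auto simp: star_hom_def cells_sum_eq_sections PiE_iff fun_eq_iff)

lemma cont_cstar_simps:
  "f \<otimes>\<^bsub>cont_cstar T F\<^esub> g = (\<lambda>p\<in>topspace T. f p \<otimes>\<^bsub>F\<^esub> g p)"
  "f \<oplus>\<^bsub>cont_cstar T F\<^esub> g = (\<lambda>p\<in>topspace T. f p \<oplus>\<^bsub>F\<^esub> g p)"
  "c \<odot>\<^bsub>cont_cstar T F\<^esub> f = (\<lambda>p\<in>topspace T. c \<odot>\<^bsub>F\<^esub> f p)"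
  "invol (cont_cstar T F) f = (\<lambda>p\<in>topspace T. invol F (f p))"
  "\<zero>\<^bsub>cont_cstar T F\<^esub> = (\<lambda>p\<in>topspace T. \<zero>\<^bsub>F\<^esub>)"
  by (simp_all add: cont_cstar_def)

lemma topspace_cube_top [simp]: "topspace (cube_top k) = cube k"
  by (simp add: cube_top_eq)

lemma topspace_sphere_top [simp]: "topspace (sphere_top k) = cube_boundary k"
  by (simp add: sphere_top_eq)

lemma boundary_star_hom:
  assumes "k \<le> n" "pre_cstar (cell_alg X k)"
  shows "(\<lambda>x. restrict (x k) (cube_boundary k)) \<in> star_hom (cells_sum X n) (cell_sphere X k)"
proof -
  interpret F: pre_cstar "cell_alg X k" by fact
  have sub: "cube_boundary k \<subseteq> cube k" by (rule cube_boundary_subset)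
  have S: "carrier (cell_sphere X k) = {f \<in> extensional (cube_boundary k). seq_cont (cube_boundary k) (cell_alg X k) f}"
    by (simp add: sphere_top_eq F.carrier_cont)
  have C: "x k \<in> extensional (cube k) \<and> seq_cont (cube k) (cell_alg X k) (x k)"
    if "x \<in> carrier (cells_sum X n)" for x
  proof -
    have "x k \<in> carrier (cell X k)" using that assms(1) by (auto simp: cells_sum_eq_sections)
    then show ?thesis by (simp add: cube_top_eq F.carrier_cont)
  qed
  show ?thesis
    unfolding star_hom_def
  proof (intro CollectI conjI ballI allI funcsetI)
    fix x assume "x \<in> carrier (cells_sum X n)"
    from seq_cont_subset[OF conjunct2[OF C[OF this]] sub]
    show "restrict (x k) (cube_boundary k) \<in> carrier (cell_sphere X k)"
      by (simp add: S)
  qed (use assms(1) sub in \<open>auto simp: cells_sum_eq_sections cont_cstar_simps restrict_def fun_eq_iff\<close>)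
qed

locale nccw_space =
  fixes X :: "'f nccw"
  assumes complex: "nccw_complex X"
begin

abbreviation "n \<equiv> ncdim X"

lemma cell_alg_cstar: "k \<le> n \<Longrightarrow> cstar_algebra (cell_alg X k)"
  using complex by (simp add: nccw_complex_def fin_dim_cstar_def)

lemma cell_alg_pre: "k \<le> n \<Longrightarrow> pre_cstar (cell_alg X k)"
  using cell_alg_cstar by (simp add: cstar_algebra_iff)

lemma cell_cstar: "k \<le> n \<Longrightarrow> cstar_algebra (cell X k)"
  unfolding cube_top_eq by (intro cstar_algebra.cstar_algebra_cont cell_alg_cstar compact_cube)

lemma cell_pre: "k \<le> n \<Longrightarrow> pre_cstar (cell X k)"
  using cell_cstar by (simp add: cstar_algebra_iff)

lemma sphere_pre: "k \<le> n \<Longrightarrow> pre_cstar (cell_sphere X k)"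
  unfolding sphere_top_eq by (intro pre_cstar.pre_cstar_cont cell_alg_pre compact_cube_boundary)

lemma attach_hom:
  "Suc k \<le> n \<Longrightarrow> attach X (Suc k) \<in> star_hom (skeleton X k) (cell_sphere X (Suc k))"
proof -
  assume "Suc k \<le> n"
  then have "Suc k \<in> {1..n}" by simp
  then have "attach X (Suc k) \<in> star_hom (skeleton X (Suc k - 1)) (cell_sphere X (Suc k))"
    using complex unfolding nccw_complex_def by blast
  then show ?thesis by simp
qed

lemma cells_section_space: "k \<le> n \<Longrightarrow> section_space {..k} (cell X) (\<Pi>\<^sub>E j\<in>{..k}. carrier (cell X j))"
  by (rule section_space_dsum) (auto intro: cell_pre)

lemma cells_sum_cstar: "k \<le> n \<Longrightarrow> cstar_algebra (cells_sum X k)"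
  unfolding cells_sum_def by (rule cstar_algebra_dsum) (auto intro: cell_cstar)

text \<open>The two assertions depend on each other across dimensions: the attaching morphism out of \<open>D\<^sub>k\<close> is
contractive once \<open>D\<^sub>k\<close> is complete, and its continuity makes the pullback \<open>D\<^sub>k\<^sub>+\<^sub>1\<close> closed under uniform
limits, hence complete.\<close>

lemma skeleton_section_space_and_closed:
  assumes "k \<le> n"
  shows "section_space {..k} (cell X) (skeleton_carrier X k) \<and>
    (\<forall>(\<sigma> :: nat \<Rightarrow> 'f nccw_elem) x. (\<forall>m. \<sigma> m \<in> skeleton_carrier X k) \<longrightarrow>
      x \<in> (\<Pi>\<^sub>E j\<in>{..k}. carrier (cell X j)) \<longrightarrow>
      (\<forall>\<epsilon>>0. \<exists>N. \<forall>m\<ge>N. \<forall>j\<in>{..k}. nrm (cell X j) (\<sigma> m j \<ominus>\<^bsub>cell X j\<^esub> x j) \<le> \<epsilon>) \<longrightarrow>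
      x \<in> skeleton_carrier X k)"
  using assms
proof (induction k)
  case 0
  then show ?case
    using cells_section_space[of 0] by (simp add: cells_sum_eq_sections)
next
  case (Suc k)
  let ?S = "skeleton_carrier X (Suc k)"
  let ?C = "cells_sum X (Suc k)"
  let ?r = "\<lambda>x :: 'f nccw_elem. restrict x {..k}"
  let ?b = "\<lambda>x :: 'f nccw_elem. restrict (x (Suc k)) (cube_boundary (Suc k))"
  let ?B = "cell_sphere X (Suc k)"
  have k: "k \<le> n" using Suc.prems by simp
  interpret C: section_space "{..Suc k}" "cell X" "\<Pi>\<^sub>E j\<in>{..Suc k}. carrier (cell X j)"
    by (rule cells_section_space[OF Suc.prems])
  note Ceq = cells_sum_eq_sections[of X "Suc k"]
  interpret K: section_space "{..k}" "cell X" "skeleton_carrier X k"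
    using Suc.IH k by blast
  have Kclosed: "x \<in> skeleton_carrier X k"
    if "\<And>m. \<sigma> m \<in> skeleton_carrier X k" "x \<in> (\<Pi>\<^sub>E j\<in>{..k}. carrier (cell X j))"
      "\<And>\<epsilon>. \<epsilon> > 0 \<Longrightarrow> \<exists>N. \<forall>m\<ge>N. \<forall>j\<in>{..k}. nrm (cell X j) (\<sigma> m j \<ominus>\<^bsub>cell X j\<^esub> x j) \<le> \<epsilon>"
    for \<sigma> :: "nat \<Rightarrow> 'f nccw_elem" and x
    using conjunct2[OF Suc.IH[OF k], rule_format, of \<sigma> x] that by blast
  note Keq = skeleton_eq_sections[of X k]
  have Kcstar: "cstar_algebra (skeleton X k)"
    unfolding Keq using Kclosed k by (intro K.cstar_algebra_sections cell_cstar) auto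
  interpret B: pre_cstar ?B by (rule sphere_pre[OF Suc.prems])
  note r = star_homD[OF restrict_star_hom[of k "Suc k" X, OF le_SucI[OF order_refl]]]
  have bh: "?b \<in> star_hom ?C ?B"
    using Suc.prems cell_alg_pre by (intro boundary_star_hom) auto
  note b = star_homD[OF bh]
  have ah: "attach X (Suc k) \<in> star_hom (skeleton X k) ?B"
    by (rule attach_hom[OF Suc.prems])
  note a = star_homD[OF ah]
  have S: "x \<in> ?S \<longleftrightarrow> x \<in> carrier ?C \<and> ?r x \<in> carrier (skeleton X k) \<and> ?b x = attach X (Suc k) (?r x)" for x
    by (simp add: Keq)
  have ops: "x \<oplus>\<^bsub>cells_sum X k\<^esub> y = x \<oplus>\<^bsub>skeleton X k\<^esub> y" "x \<otimes>\<^bsub>cells_sum X k\<^esub> y = x \<otimes>\<^bsub>skeleton X k\<^esub> y"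
    "c \<odot>\<^bsub>cells_sum X k\<^esub> x = c \<odot>\<^bsub>skeleton X k\<^esub> x" "invol (cells_sum X k) x = invol (skeleton X k) x"
    "\<zero>\<^bsub>cells_sum X k\<^esub> = \<zero>\<^bsub>skeleton X k\<^esub>" for x y c
    by (simp_all add: skeleton_def)
  interpret K': cstar_algebra "skeleton X k" by fact
  have Cc: "cstar_algebra ?C" by (rule cells_sum_cstar[OF Suc.prems])
  interpret C': cstar_algebra ?C by fact
  note r = r[unfolded ops]
  have zero: "\<zero>\<^bsub>?C\<^esub> \<in> ?S"
  proof -
    have "?b \<zero>\<^bsub>?C\<^esub> = \<zero>\<^bsub>?B\<^esub>" by (rule star_hom_zero[OF C'.pre_cstar_axioms B.pre_cstar_axioms bh])
    moreover have "?r \<zero>\<^bsub>?C\<^esub> = \<zero>\<^bsub>skeleton X k\<^esub>"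
      by (auto simp: Ceq Keq restrict_def fun_eq_iff)
    moreover have "attach X (Suc k) \<zero>\<^bsub>skeleton X k\<^esub> = \<zero>\<^bsub>?B\<^esub>"
      by (rule star_hom_zero[OF K'.pre_cstar_axioms B.pre_cstar_axioms ah])
    ultimately show ?thesis unfolding S by simp
  qed
  have sp: "section_space {..Suc k} (cell X) ?S"
  proof (rule section_space.intro)
    show "?S \<subseteq> (\<Pi>\<^sub>E j\<in>{..Suc k}. carrier (cell X j))"
    proof (rule subsetI)
      fix x assume "x \<in> ?S"
      then have "x \<in> carrier ?C" unfolding S by blast
      then show "x \<in> (\<Pi>\<^sub>E j\<in>{..Suc k}. carrier (cell X j))" by (simp only: Ceq sections_simps)
    qed
    show "(\<lambda>j\<in>{..Suc k}. \<zero>\<^bsub>cell X j\<^esub>) \<in> ?S"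
      using zero by (simp add: Ceq)
    fix x assume x: "x \<in> ?S"
    show "bdd_above ((\<lambda>j. nrm (cell X j) (x j)) ` {..Suc k})"
      by (simp add: bdd_above_finite)
    have "c \<odot>\<^bsub>?C\<^esub> x \<in> ?S" for c
      using x unfolding S by (simp add: r b a)
    then show "(\<lambda>j\<in>{..Suc k}. c \<odot>\<^bsub>cell X j\<^esub> x j) \<in> ?S" for c by (simp only: Ceq sections_simps)
    have "invol ?C x \<in> ?S"
      using x unfolding S by (simp add: r b a C'.invol_closed K'.invol_closed)
    then show "(\<lambda>j\<in>{..Suc k}. invol (cell X j) (x j)) \<in> ?S" by (simp only: Ceq sections_simps)
    fix y assume y: "y \<in> ?S"
    have "x \<oplus>\<^bsub>?C\<^esub> y \<in> ?S"
      using x y unfolding S by (simp add: r b a)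
    then show "(\<lambda>j\<in>{..Suc k}. x j \<oplus>\<^bsub>cell X j\<^esub> y j) \<in> ?S" by (simp only: Ceq sections_simps)
    have "x \<otimes>\<^bsub>?C\<^esub> y \<in> ?S"
      using x y unfolding S by (simp add: r b a C'.cstar_mult_closed K'.cstar_mult_closed)
    then show "(\<lambda>j\<in>{..Suc k}. x j \<otimes>\<^bsub>cell X j\<^esub> y j) \<in> ?S" by (simp only: Ceq sections_simps)
  qed (use Suc.prems cell_pre in auto)
  have cl: "x \<in> ?S" if \<sigma>: "\<And>m. \<sigma> m \<in> ?S" and x: "x \<in> (\<Pi>\<^sub>E j\<in>{..Suc k}. carrier (cell X j))"
      and u: "\<And>\<epsilon>. \<epsilon> > 0 \<Longrightarrow> \<exists>N. \<forall>m\<ge>N. \<forall>j\<in>{..Suc k}. nrm (cell X j) (\<sigma> m j \<ominus>\<^bsub>cell X j\<^esub> x j) \<le> \<epsilon>"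
    for \<sigma> :: "nat \<Rightarrow> 'f nccw_elem" and x
  proof -
    have xC: "x \<in> carrier ?C" using x by (simp add: Ceq)
    have \<sigma>': "\<sigma> m \<in> carrier ?C" "?r (\<sigma> m) \<in> carrier (skeleton X k)" "?b (\<sigma> m) = attach X (Suc k) (?r (\<sigma> m))" for m
      using \<sigma>[of m] unfolding S by auto
    have rx: "?r x \<in> carrier (skeleton X k)"
      unfolding Keq sections_simps
    proof (rule Kclosed[of "\<lambda>m. ?r (\<sigma> m)"])
      show "?r (\<sigma> m) \<in> skeleton_carrier X k" for m using \<sigma>'(2)[of m] by (simp add: Keq)
      show "?r x \<in> (\<Pi>\<^sub>E j\<in>{..k}. carrier (cell X j))" using x by (auto simp: PiE_iff)
      fix \<epsilon> :: real assume "\<epsilon> > 0"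
      then obtain N where "\<forall>m\<ge>N. \<forall>j\<in>{..Suc k}. nrm (cell X j) (\<sigma> m j \<ominus>\<^bsub>cell X j\<^esub> x j) \<le> \<epsilon>"
        using u by blast
      then show "\<exists>N. \<forall>m\<ge>N. \<forall>j\<in>{..k}. nrm (cell X j) (?r (\<sigma> m) j \<ominus>\<^bsub>cell X j\<^esub> ?r x j) \<le> \<epsilon>"
        by (intro exI[of _ N]) auto
    qed
    \<comment> \<open>Both sides of the attaching condition are limits of the corresponding values at \<open>\<sigma>\<close>, which agree.\<close>
    have "nrm ?B (?b x \<ominus>\<^bsub>?B\<^esub> attach X (Suc k) (?r x)) \<le> 0"
    proof (rule field_le_epsilon)
      fix \<epsilon> :: real assume "\<epsilon> > 0"
      then obtain N where N: "\<And>j. j \<in> {..Suc k} \<Longrightarrow> nrm (cell X j) (\<sigma> N j \<ominus>\<^bsub>cell X j\<^esub> x j) \<le> \<epsilon> / 2"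
        using u[of "\<epsilon>/2"] by auto
      have "nrm ?B (?b x \<ominus>\<^bsub>?B\<^esub> attach X (Suc k) (?r x)) \<le>
          nrm ?B (?b x \<ominus>\<^bsub>?B\<^esub> ?b (\<sigma> N)) + nrm ?B (?b (\<sigma> N) \<ominus>\<^bsub>?B\<^esub> attach X (Suc k) (?r x))"
        using xC \<sigma>'(1)[of N] rx by (intro B.nrm_diff_triangle b a)
      also have "nrm ?B (?b x \<ominus>\<^bsub>?B\<^esub> ?b (\<sigma> N)) \<le> nrm ?C (x \<ominus>\<^bsub>?C\<^esub> \<sigma> N)"
        by (rule star_hom_dist_le[OF Cc B.pre_cstar_axioms bh xC \<sigma>'(1)])
      also have "nrm ?C (x \<ominus>\<^bsub>?C\<^esub> \<sigma> N) = nrm ?C (\<sigma> N \<ominus>\<^bsub>?C\<^esub> x)"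
        by (rule C'.nrm_diff_commute[OF xC \<sigma>'(1)])
      also have "nrm ?C (\<sigma> N \<ominus>\<^bsub>?C\<^esub> x) \<le> \<epsilon> / 2"
        using C'.diff_carrier[OF \<sigma>'(1) xC, of N] \<sigma>'(1)[of N] xC N \<open>\<epsilon> > 0\<close>
        unfolding Ceq sections_simps by (subst C.nrm_le_iff) (auto simp: C.sections_diff)
      also have "nrm ?B (?b (\<sigma> N) \<ominus>\<^bsub>?B\<^esub> attach X (Suc k) (?r x)) \<le>
          nrm (skeleton X k) (?r (\<sigma> N) \<ominus>\<^bsub>skeleton X k\<^esub> ?r x)"
        unfolding \<sigma>'(3) by (rule star_hom_dist_le[OF Kcstar B.pre_cstar_axioms ah \<sigma>'(2) rx])
      also have "\<dots> \<le> \<epsilon> / 2"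
        using K'.diff_carrier[OF \<sigma>'(2) rx, of N] \<sigma>'(2)[of N] rx N \<open>\<epsilon> > 0\<close>
        unfolding Keq sections_simps by (subst K.nrm_le_iff) (auto simp: K.sections_diff)
      also have "\<epsilon> / 2 + \<epsilon> / 2 = 0 + \<epsilon>" by simp
      finally show "nrm ?B (?b x \<ominus>\<^bsub>?B\<^esub> attach X (Suc k) (?r x)) \<le> 0 + \<epsilon>" by (simp only:)
    qed
    then have "?b x = attach X (Suc k) (?r x)"
      using b(1)[OF xC] a(1)[OF rx] B.nrm_nonneg B.nrm_eq_zero B.diff_eq_zero_iff
      by (meson B.diff_carrier order_antisym)
    then show "x \<in> ?S" using xC rx unfolding S by blast
  qed
  show ?case using sp cl by blast
qed

lemma skeleton_section_space: "k \<le> n \<Longrightarrow> section_space {..k} (cell X) (skeleton_carrier X k)"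
  using skeleton_section_space_and_closed by blast

lemma skeleton_cstar:
  assumes "k \<le> n"
  shows "cstar_algebra (skeleton X k)"
proof -
  interpret K: section_space "{..k}" "cell X" "skeleton_carrier X k"
    by (rule skeleton_section_space[OF assms])
  show ?thesis unfolding skeleton_eq_sections
  proof (rule K.cstar_algebra_sections)
    show "cstar_algebra (cell X i)" if "i \<in> {..k}" for i using that assms cell_cstar by simp
  qed (use conjunct2[OF skeleton_section_space_and_closed[OF assms], rule_format] in blast)
qed

lemma skeleton_pre: "k \<le> n \<Longrightarrow> pre_cstar (skeleton X k)"
  using skeleton_cstar by (simp add: cstar_algebra_iff)

end

section \<open>Lifting functions from a cell to the whole complex\<close>

text \<open>The distance from the centre of the cube in the maximum norm, scaled to be 1 on the boundary.\<close>

primrec cube_gauge :: "nat \<Rightarrow> (nat \<Rightarrow> real) \<Rightarrow> real" where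
  "cube_gauge 0 p = 0"
| "cube_gauge (Suc k) p = max (cube_gauge k p) \<bar>2 * p k - 1\<bar>"

text \<open>The projection of the cube onto its boundary from the centre, where it takes a default value.\<close>

definition cube_proj :: "nat \<Rightarrow> (nat \<Rightarrow> real) \<Rightarrow> nat \<Rightarrow> real" where
  "cube_proj k p = (\<lambda>i. if i < k then 1/2 + (p i - 1/2) / cube_gauge k p else 0)"

text \<open>The extension of a function from the boundary to the cube that is linear on every ray from the centre,
with value zero there. It does not increase distances between functions and takes the zero function to zero.\<close>

definition radial :: "'a cstar \<Rightarrow> nat \<Rightarrow> ((nat \<Rightarrow> real) \<Rightarrow> 'a) \<Rightarrow> (nat \<Rightarrow> real) \<Rightarrow> 'a" where
  "radial F k f = (\<lambda>p\<in>cube k. if cube_gauge k p = 0 then \<zero>\<^bsub>F\<^esub>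
     else complex_of_real (cube_gauge k p) \<odot>\<^bsub>F\<^esub> f (cube_proj k p))"

lemma cube_gauge_nonneg: "0 \<le> cube_gauge k p"
  by (induction k) auto

lemma cube_gauge_ge: "i < k \<Longrightarrow> \<bar>2 * p i - 1\<bar> \<le> cube_gauge k p"
  by (induction k) (auto simp: less_Suc_eq)

lemma cube_gauge_attained: "0 < cube_gauge k p \<Longrightarrow> \<exists>i<k. cube_gauge k p = \<bar>2 * p i - 1\<bar>"
  by (induction k) (auto simp: less_Suc_eq max_def)

lemma cube_gauge_le_1: "p \<in> cube k \<Longrightarrow> cube_gauge k p \<le> 1"
proof (rule ccontr)
  assume p: "p \<in> cube k" and "\<not> cube_gauge k p \<le> 1"
  then obtain i where "i < k" "cube_gauge k p = \<bar>2 * p i - 1\<bar>" "cube_gauge k p > 1"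
    using cube_gauge_attained[of k p] by auto
  moreover from this p have "0 \<le> p i" "p i \<le> 1" by (auto simp: cube_eq)
  ultimately show False by linarith
qed

lemma cube_gauge_boundary: "p \<in> cube_boundary k \<Longrightarrow> cube_gauge k p = 1"
proof -
  assume "p \<in> cube_boundary k"
  then obtain i where "p \<in> cube k" "i < k" "p i = 0 \<or> p i = 1" by (auto simp: cube_boundary_eq)
  then show ?thesis using cube_gauge_ge[of i k p] cube_gauge_le_1[of p k] by auto
qed

lemma continuous_on_coordinate: "continuous_on S (\<lambda>p :: nat \<Rightarrow> real. p i)"
  by (rule continuous_on_subset[OF continuous_on_product_coordinates]) simp

lemma continuous_on_cube_gauge: "continuous_on S (cube_gauge k)"
proof (induction k)
  case (Suc k)
  have "continuous_on S (\<lambda>p. max (cube_gauge k p) \<bar>2 * p k - 1\<bar>)"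
    by (intro continuous_intros Suc continuous_on_coordinate)
  then show ?case by simp
qed simp

lemma cube_proj_boundary:
  assumes p: "p \<in> cube k" and g: "cube_gauge k p \<noteq> 0"
  shows "cube_proj k p \<in> cube_boundary k"
proof -
  have pos: "cube_gauge k p > 0" using g cube_gauge_nonneg[of k p] by simp
  have ge: "0 \<le> 1/2 + (p i - 1/2) / cube_gauge k p \<and> 1/2 + (p i - 1/2) / cube_gauge k p \<le> 1"
    if "i < k" for i
    using cube_gauge_ge[OF that, of p] pos by (auto simp: field_simps abs_le_iff)
  obtain i where i: "i < k" "cube_gauge k p = \<bar>2 * p i - 1\<bar>"
    using cube_gauge_attained[OF pos] by blast
  then have "1/2 + (p i - 1/2) / cube_gauge k p = 0 \<or> 1/2 + (p i - 1/2) / cube_gauge k p = 1"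
    using pos by (auto simp: field_simps abs_if split: if_splits)
  with i(1) ge show ?thesis
    by (auto simp: cube_boundary_eq cube_eq cube_proj_def intro!: exI[of _ i])
qed

lemma cube_proj_id: "p \<in> cube_boundary k \<Longrightarrow> cube_proj k p = p"
  using cube_gauge_boundary[of p k] by (auto simp: cube_proj_def cube_boundary_eq cube_eq fun_eq_iff)

lemma radial_boundary:
  assumes "pre_cstar F" "p \<in> cube_boundary k" "f p \<in> carrier F"
  shows "radial F k f p = f p"
  using assms cube_gauge_boundary[of p k] cube_proj_id[of p k] cube_boundary_subset[of k]
    pre_cstar.smult_1[of F "f p"]
  by (auto simp: radial_def)

context pre_cstar
begin

lemma radial_carrier:
  assumes "\<And>p. p \<in> cube_boundary k \<Longrightarrow> f p \<in> carrier A" "p \<in> cube k"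
  shows "radial A k f p \<in> carrier A"
  using assms cube_proj_boundary[of p k] by (simp add: radial_def)

lemma radial_zero: "p \<in> cube k \<Longrightarrow> radial A k (\<lambda>p\<in>cube_boundary k. \<zero>) p = \<zero>"
  using cube_proj_boundary[of p k] by (simp add: radial_def)

lemma radial_dist_le:
  assumes f: "\<And>p. p \<in> cube_boundary k \<Longrightarrow> f p \<in> carrier A"
    and g: "\<And>p. p \<in> cube_boundary k \<Longrightarrow> g p \<in> carrier A"
    and d: "\<And>p. p \<in> cube_boundary k \<Longrightarrow> nrm A (f p \<ominus> g p) \<le> c" and c: "0 \<le> c"
    and p: "p \<in> cube k"
  shows "nrm A (radial A k f p \<ominus> radial A k g p) \<le> c"
proof (cases "cube_gauge k p = 0")
  case True
  then show ?thesis using p c by (simp add: radial_def)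
next
  case False
  note q = cube_proj_boundary[OF p False]
  have "nrm A (radial A k f p \<ominus> radial A k g p) = cube_gauge k p * nrm A (f (cube_proj k p) \<ominus> g (cube_proj k p))"
    using False p f[OF q] g[OF q] cube_gauge_nonneg[of k p]
    by (simp add: radial_def smult_diff nrm_smult)
  also have "\<dots> \<le> 1 * c"
    using f[OF q] g[OF q] d[OF q] cube_gauge_le_1[OF p] by (intro mult_mono nrm_nonneg) auto
  finally show ?thesis by simp
qed

text \<open>Away from the centre this is a composition of continuous maps; at the centre the gauge tends to zero while
\<open>f\<close> stays bounded.\<close>

lemma seq_cont_radial:
  assumes f: "seq_cont (cube_boundary k) A f"
  shows "seq_cont (cube k) A (radial A k f)"
proof (rule seq_contI)
  note fc = seq_cont_carrier[OF f]
  show rc: "radial A k f p \<in> carrier A" if "p \<in> cube k" for p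
    using radial_carrier[OF fc that] .
  fix p q assume p: "\<And>n. p n \<in> cube k" "q \<in> cube k" "p \<longlonglongrightarrow> q"
  have glim: "(\<lambda>n. cube_gauge k (p n)) \<longlonglongrightarrow> cube_gauge k q"
    using continuous_on_cube_gauge[of UNIV k] p unfolding continuous_on_sequentially o_def by blast
  show "(\<lambda>n. nrm A (radial A k f (p n) \<ominus> radial A k f q)) \<longlonglongrightarrow> 0"
  proof (cases "cube_gauge k q = 0")
    case True
    obtain M where M: "\<And>q. q \<in> cube_boundary k \<Longrightarrow> nrm A (f q) \<le> M"
      using seq_cont_bdd[OF compact_cube_boundary f] by (auto simp: bdd_above_def)
    have "nrm A (radial A k f (p n)) \<le> cube_gauge k (p n) * M" for n
    proof (cases "cube_gauge k (p n) = 0")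
      case False
      note q = cube_proj_boundary[OF p(1) False]
      show ?thesis
        using False p(1)[of n] fc[OF q] M[OF q] cube_gauge_nonneg[of k "p n"]
        by (simp add: radial_def nrm_smult mult_left_mono)
    qed (use p(1)[of n] in \<open>simp add: radial_def\<close>)
    moreover have "(\<lambda>n. cube_gauge k (p n) * M) \<longlonglongrightarrow> 0"
      using tendsto_mult_right[OF glim, of M] True by simp
    ultimately have "(\<lambda>n. nrm A (radial A k f (p n))) \<longlonglongrightarrow> 0"
      using rc p by (intro null_sequence_le[of "\<lambda>n. cube_gauge k (p n) * M"]) auto
    moreover have "radial A k f q = \<zero>" using True p by (simp add: radial_def)
    ultimately show ?thesis using rc p by simp
  next
    case False
    let ?U = "{p \<in> cube k. cube_gauge k p \<noteq> 0}"
    have "continuous_on ?U (\<lambda>p. cube_proj k p i)" for i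
      by (cases "i < k")
        (auto simp: cube_proj_def intro!: continuous_intros continuous_on_coordinate continuous_on_cube_gauge)
    then have "continuous_on ?U (cube_proj k)"
      by (rule continuous_on_coordinatewise_then_product)
    then have "seq_cont ?U A (\<lambda>p. f (cube_proj k p))"
      by (rule seq_cont_compose[OF f]) (auto intro: cube_proj_boundary)
    then have "seq_cont ?U A (\<lambda>p. complex_of_real (cube_gauge k p) \<odot> f (cube_proj k p))"
      by (rule seq_cont_smult) (intro continuous_intros continuous_on_cube_gauge)
    then have cont: "seq_cont ?U A (radial A k f)"
      by (rule seq_cont_cong[THEN iffD1, rotated]) (auto simp: radial_def)
    \<comment> \<open>The finitely many terms at the centre are replaced by \<open>q\<close>, so that the whole sequence lies in \<open>?U\<close>.\<close>
    define p' where "p' n = (if cube_gauge k (p n) \<noteq> 0 then p n else q)" for n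
    have "\<forall>\<^sub>F n in sequentially. cube_gauge k (p n) \<noteq> 0"
      using tendsto_imp_eventually_ne[OF glim False] .
    then have ev: "\<forall>\<^sub>F n in sequentially. p' n = p n"
      by eventually_elim (simp add: p'_def)
    have "p' \<longlonglongrightarrow> q"
      using p(3) ev by (simp add: tendsto_cong)
    moreover have "p' n \<in> ?U" "q \<in> ?U" for n
      using p False by (auto simp: p'_def)
    ultimately have "(\<lambda>n. nrm A (radial A k f (p' n) \<ominus> radial A k f q)) \<longlonglongrightarrow> 0"
      by (intro seq_contD[OF cont])
    moreover have "\<forall>\<^sub>F n in sequentially. nrm A (radial A k f (p' n) \<ominus> radial A k f q) =
        nrm A (radial A k f (p n) \<ominus> radial A k f q)"
      using ev by eventually_elim simp
    ultimately show ?thesis by (rule Lim_transform_eventually)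
  qed
qed

end

text \<open>An element of \<open>D\<^sub>l\<close> is extended to one of \<open>D\<^sub>l\<^sub>+\<^sub>d\<close>: in each new dimension the attaching morphism dictates the
boundary values, and these are extended radially.\<close>

primrec skel_extend :: "'f nccw \<Rightarrow> nat \<Rightarrow> 'f nccw_elem \<Rightarrow> nat \<Rightarrow> 'f nccw_elem" where
  "skel_extend X l x 0 = x"
| "skel_extend X l x (Suc d) = (\<lambda>j\<in>{..Suc (l + d)}. if j = Suc (l + d)
     then radial (cell_alg X j) j (attach X j (skel_extend X l x d)) else skel_extend X l x d j)"

text \<open>A section of the quotient map from the canonical ideal \<open>I\<^sub>l\<close> to \<open>C\<^sub>0(\<I>\<^sub>0\<^sup>l \<rightarrow> F\<^sub>l)\<close>.\<close>

definition lift :: "'f nccw \<Rightarrow> nat \<Rightarrow> ((nat \<Rightarrow> real) \<Rightarrow> 'f) \<Rightarrow> 'f nccw_elem" where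
  "lift X l g = skel_extend X l (\<lambda>j\<in>{..l}. if j = l then g else \<zero>\<^bsub>cell X j\<^esub>) (ncdim X - l)"

declare skel_extend.simps(2) [simp del] skeleton_carrier.simps(2) [simp del]

lemma skel_extend_below: "j \<le> l \<Longrightarrow> skel_extend X l x d j = x j"
  by (induction d) (auto simp: skel_extend.simps)

lemma skel_extend_top:
  "skel_extend X l x (Suc d) (Suc (l + d)) =
    radial (cell_alg X (Suc (l + d))) (Suc (l + d)) (attach X (Suc (l + d)) (skel_extend X l x d))"
  by (simp add: skel_extend.simps)

lemma skel_extend_lower: "j \<le> l + d \<Longrightarrow> skel_extend X l x (Suc d) j = skel_extend X l x d j"
  by (simp add: skel_extend.simps)

context nccw_space
begin

lemma cell_carrier:
  "k \<le> n \<Longrightarrow> carrier (cell X k) = {f \<in> extensional (cube k). seq_cont (cube k) (cell_alg X k) f}"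
  using pre_cstar.carrier_cont[OF cell_alg_pre] by (simp add: cube_top_eq)

lemma sphere_carrier:
  "k \<le> n \<Longrightarrow> carrier (cell_sphere X k) =
    {f \<in> extensional (cube_boundary k). seq_cont (cube_boundary k) (cell_alg X k) f}"
  using pre_cstar.carrier_cont[OF cell_alg_pre] by (simp add: sphere_top_eq)

lemma cell_section_space:
  "k \<le> n \<Longrightarrow> section_space (cube k) (\<lambda>_. cell_alg X k) (carrier (cell X k))"
  unfolding cube_top_eq by (intro pre_cstar.section_space_cont cell_alg_pre compact_cube)

lemma sphere_section_space:
  "k \<le> n \<Longrightarrow> section_space (cube_boundary k) (\<lambda>_. cell_alg X k) (carrier (cell_sphere X k))"
  unfolding sphere_top_eq by (intro pre_cstar.section_space_cont cell_alg_pre compact_cube_boundary)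

lemma cell_eq_sections:
  "k \<le> n \<Longrightarrow> cell X k = sections (cube k) (\<lambda>_. cell_alg X k) (carrier (cell X k))"
  unfolding cube_top_eq by (intro pre_cstar.cont_cstar_eq_sections cell_alg_pre)

lemma sphere_eq_sections:
  "k \<le> n \<Longrightarrow> cell_sphere X k = sections (cube_boundary k) (\<lambda>_. cell_alg X k) (carrier (cell_sphere X k))"
  unfolding sphere_top_eq by (intro pre_cstar.cont_cstar_eq_sections cell_alg_pre)

lemma skeleton_carrierD:
  "k \<le> n \<Longrightarrow> x \<in> skeleton_carrier X k \<Longrightarrow> j \<le> k \<Longrightarrow> x j \<in> carrier (cell X j)"
  by (auto simp: skeleton_carrier_iff cells_sum_eq_sections)

lemma skel_extend_Suc:
  assumes d: "Suc (l + d) \<le> n" and x: "skel_extend X l x d \<in> skeleton_carrier X (l + d)"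
  shows "skel_extend X l x (Suc d) \<in> skeleton_carrier X (Suc (l + d))"
    and "restrict (skel_extend X l x (Suc d)) {..l + d} = skel_extend X l x d"
proof -
  let ?k = "Suc (l + d)" and ?y = "skel_extend X l x d"
  have c: "?y \<in> (\<Pi>\<^sub>E j\<in>{..l + d}. carrier (cell X j))"
    using x by (simp add: skeleton_carrier_iff cells_sum_eq_sections)
  show r: "restrict (skel_extend X l x (Suc d)) {..l + d} = ?y"
    using c by (auto simp: skel_extend.simps fun_eq_iff restrict_def PiE_iff extensional_def)
  have a: "attach X ?k ?y \<in> carrier (cell_sphere X ?k)"
    using star_homD(1)[OF attach_hom[OF d], of ?y] x by (simp add: skeleton_eq_sections)
  then have a': "attach X ?k ?y \<in> extensional (cube_boundary ?k)"
      "seq_cont (cube_boundary ?k) (cell_alg X ?k) (attach X ?k ?y)"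
    using d by (auto simp: sphere_carrier)
  have rad: "radial (cell_alg X ?k) ?k (attach X ?k ?y) \<in> carrier (cell X ?k)"
    using pre_cstar.seq_cont_radial[OF cell_alg_pre[OF d] a'(2)] d
    by (simp add: cell_carrier) (simp add: radial_def)
  have "restrict (radial (cell_alg X ?k) ?k (attach X ?k ?y)) (cube_boundary ?k) = attach X ?k ?y"
    by (rule extensionalityI[of _ "cube_boundary ?k"])
      (auto simp: a' radial_boundary[OF cell_alg_pre[OF d]] seq_cont_carrier[OF a'(2)])
  moreover have "skel_extend X l x (Suc d) \<in> carrier (cells_sum X ?k)"
    using c rad by (auto simp: skel_extend.simps cells_sum_eq_sections PiE_iff le_Suc_eq)
  moreover have "skel_extend X l x (Suc d) ?k = radial (cell_alg X ?k) ?k (attach X ?k ?y)"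
    by (simp add: skel_extend.simps)
  ultimately show "skel_extend X l x (Suc d) \<in> skeleton_carrier X ?k"
    unfolding skeleton_carrier.simps mem_Collect_eq r using x by (simp only: simp_thms)
qed

lemma skel_extend_mem:
  "l + d \<le> n \<Longrightarrow> x \<in> skeleton_carrier X l \<Longrightarrow> skel_extend X l x d \<in> skeleton_carrier X (l + d)"
proof (induction d)
  case (Suc d)
  then show ?case using skel_extend_Suc(1)[of l d x] by simp
qed simp

text \<open>Neither the attaching morphisms, by \<open>star_hom_contractive\<close>, nor the radial extension increase distances.\<close>

lemma skel_extend_dist_le:
  assumes "l + d \<le> n" "x \<in> skeleton_carrier X l" "y \<in> skeleton_carrier X l"
  shows "nrm (skeleton X (l + d)) (skel_extend X l x d \<ominus>\<^bsub>skeleton X (l + d)\<^esub> skel_extend X l y d)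
    \<le> nrm (skeleton X l) (x \<ominus>\<^bsub>skeleton X l\<^esub> y)"
  using assms(1)
proof (induction d)
  case (Suc d)
  let ?k = "Suc (l + d)" and ?c = "nrm (skeleton X l) (x \<ominus>\<^bsub>skeleton X l\<^esub> y)"
  let ?x = "skel_extend X l x d" and ?y = "skel_extend X l y d"
  have k: "?k \<le> n" "l + d \<le> n" "l \<le> n" using Suc.prems by auto
  note ex = skel_extend_mem[OF k(2) assms(2)] and ey = skel_extend_mem[OF k(2) assms(3)]
  interpret L: cstar_algebra "skeleton X l" by (rule skeleton_cstar[OF k(3)])
  interpret D: section_space "{..l + d}" "cell X" "skeleton_carrier X (l + d)"
    by (rule skeleton_section_space[OF k(2)])
  interpret K: section_space "{..?k}" "cell X" "skeleton_carrier X ?k"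
    by (rule skeleton_section_space[OF k(1)])
  interpret S: section_space "cube_boundary ?k" "\<lambda>_. cell_alg X ?k" "carrier (cell_sphere X ?k)"
    by (rule sphere_section_space[OF k(1)])
  interpret C: section_space "cube ?k" "\<lambda>_. cell_alg X ?k" "carrier (cell X ?k)"
    by (rule cell_section_space[OF k(1)])
  interpret F: pre_cstar "cell_alg X ?k" by (rule cell_alg_pre[OF k(1)])
  note eqD = skeleton_eq_sections[of X "l + d"] and eqK = skeleton_eq_sections[of X ?k]
  have c0: "0 \<le> ?c"
    using assms by (intro L.nrm_nonneg L.diff_carrier) (auto simp: skeleton_eq_sections)
  have IH: "nrm (skeleton X (l + d)) (?x \<ominus>\<^bsub>skeleton X (l + d)\<^esub> ?y) \<le> ?c"
    using Suc.IH k by simp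
  have xd: "?x \<ominus>\<^bsub>skeleton X (l + d)\<^esub> ?y \<in> skeleton_carrier X (l + d)"
    using D.diff_carrier[of ?x ?y] ex ey by (simp add: eqD)
  have comp: "nrm (cell X j) (?x j \<ominus>\<^bsub>cell X j\<^esub> ?y j) \<le> ?c" if "j \<le> l + d" for j
    using that IH xd D.nrm_fibre_le[of "?x \<ominus>\<^bsub>D.Alg\<^esub> ?y" j] D.sections_diff[OF ex ey, of j]
    by (simp add: eqD)
  let ?a = "\<lambda>x. attach X ?k x"
  note ah = attach_hom[OF k(1)]
  have ac: "?a ?x \<in> carrier (cell_sphere X ?k)" "?a ?y \<in> carrier (cell_sphere X ?k)"
    using star_homD(1)[OF ah] ex ey by (auto simp: eqD)
  have "nrm (cell_sphere X ?k) (?a ?x \<ominus>\<^bsub>cell_sphere X ?k\<^esub> ?a ?y) \<le> ?c"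
    using star_hom_dist_le[OF skeleton_cstar[OF k(2)] sphere_pre[OF k(1)] ah, of ?x ?y] ex ey IH
    by (simp add: eqD)
  then have bd: "nrm (cell_alg X ?k) (?a ?x p \<ominus>\<^bsub>cell_alg X ?k\<^esub> ?a ?y p) \<le> ?c" if "p \<in> cube_boundary ?k" for p
    using S.nrm_fibre_le[of "?a ?x \<ominus>\<^bsub>S.Alg\<^esub> ?a ?y" p] S.diff_carrier[of "?a ?x" "?a ?y"] ac
      S.sections_diff[OF ac that] that
    by (simp flip: sphere_eq_sections[OF k(1)])
  have top: "nrm (cell X ?k) (radial (cell_alg X ?k) ?k (?a ?x) \<ominus>\<^bsub>cell X ?k\<^esub> radial (cell_alg X ?k) ?k (?a ?y)) \<le> ?c"
  proof -
    let ?u = "radial (cell_alg X ?k) ?k (?a ?x)" and ?v = "radial (cell_alg X ?k) ?k (?a ?y)"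
    have uv: "?u \<in> carrier (cell X ?k)" "?v \<in> carrier (cell X ?k)"
      using skeleton_carrierD[OF k(1) skel_extend_Suc(1)[OF k(1) ex], of ?k]
        skeleton_carrierD[OF k(1) skel_extend_Suc(1)[OF k(1) ey], of ?k]
      by (simp_all add: skel_extend_top)
    have "nrm (cell_alg X ?k) (?u p \<ominus>\<^bsub>cell_alg X ?k\<^esub> ?v p) \<le> ?c" if "p \<in> cube ?k" for p
      using ac S.fibre_carrier bd c0 that by (intro F.radial_dist_le) auto
    then have "nrm C.Alg (?u \<ominus>\<^bsub>C.Alg\<^esub> ?v) \<le> ?c"
      using C.diff_carrier[of ?u ?v] uv c0
      by (subst C.nrm_le_iff) (auto simp: C.sections_diff[OF uv])
    then show ?thesis by (simp flip: cell_eq_sections[OF k(1)])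
  qed
  have eK: "skel_extend X l x (Suc d) \<in> skeleton_carrier X ?k" "skel_extend X l y (Suc d) \<in> skeleton_carrier X ?k"
    using skel_extend_Suc(1)[OF k(1) ex] skel_extend_Suc(1)[OF k(1) ey] by blast+
  have "nrm (cell X j) (skel_extend X l x (Suc d) j \<ominus>\<^bsub>cell X j\<^esub> skel_extend X l y (Suc d) j) \<le> ?c" if "j \<le> ?k" for j
    using that comp top by (cases "j = ?k") (auto simp: skel_extend.simps)
  then have "nrm K.Alg (skel_extend X l x (Suc d) \<ominus>\<^bsub>K.Alg\<^esub> skel_extend X l y (Suc d)) \<le> ?c"
    using K.diff_carrier[of "skel_extend X l x (Suc d)" "skel_extend X l y (Suc d)"] eK c0
    by (subst K.nrm_le_iff) (auto simp: K.sections_diff)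
  then show ?case by (simp add: eqK)
qed simp

lemma cell_zero: "\<zero>\<^bsub>cell X j\<^esub> = (\<lambda>p\<in>cube j. \<zero>\<^bsub>cell_alg X j\<^esub>)"
  by (simp add: cont_cstar_simps)

lemma cell_zero_carrier: "j \<le> n \<Longrightarrow> \<zero>\<^bsub>cell X j\<^esub> \<in> carrier (cell X j)"
  using cell_pre[of j] by (simp add: pre_cstar_def module_def abelian_group_def abelian_monoid.zero_closed)

lemma attach_zero:
  assumes "Suc k \<le> n"
  shows "attach X (Suc k) (\<lambda>j\<in>{..k}. \<zero>\<^bsub>cell X j\<^esub>) = (\<lambda>p\<in>cube_boundary (Suc k). \<zero>\<^bsub>cell_alg X (Suc k)\<^esub>)"
  using star_hom_zero[OF skeleton_pre sphere_pre attach_hom[OF assms]] assms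
  by (simp add: skeleton_eq_sections cont_cstar_simps)

text \<open>The lower components determine the boundary values through the attaching morphism, which maps zero to
zero.\<close>

lemma vanishes_on_boundary:
  assumes x: "x \<in> skeleton_carrier X m" and k: "Suc k \<le> m" "m \<le> n"
    and z: "\<And>j. j \<le> k \<Longrightarrow> x j = \<zero>\<^bsub>cell X j\<^esub>" and p: "p \<in> cube_boundary (Suc k)"
  shows "x (Suc k) p = \<zero>\<^bsub>cell_alg X (Suc k)\<^esub>"
proof -
  have "restrict x {..k} = (\<lambda>j\<in>{..k}. \<zero>\<^bsub>cell X j\<^esub>)"
    using z by (intro restrict_ext) auto
  then have "restrict (x (Suc k)) (cube_boundary (Suc k)) = (\<lambda>p\<in>cube_boundary (Suc k). \<zero>\<^bsub>cell_alg X (Suc k)\<^esub>)"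
    using x k attach_zero[of k] unfolding skeleton_carrier_iff by (metis Suc_le_eq le_trans)
  then show ?thesis using p by (metis restrict_apply')
qed

lemma skel_extend_zero:
  "l + d \<le> n \<Longrightarrow> skel_extend X l (\<lambda>j\<in>{..l}. \<zero>\<^bsub>cell X j\<^esub>) d = (\<lambda>j\<in>{..l + d}. \<zero>\<^bsub>cell X j\<^esub>)"
proof (induction d)
  case (Suc d)
  let ?k = "Suc (l + d)"
  have "radial (cell_alg X ?k) ?k (\<lambda>p\<in>cube_boundary ?k. \<zero>\<^bsub>cell_alg X ?k\<^esub>) = \<zero>\<^bsub>cell X ?k\<^esub>"
    using pre_cstar.radial_zero[OF cell_alg_pre[of ?k], of _ ?k] Suc.prems
    by (intro extensionalityI[of _ "cube ?k"]) (auto simp: cell_zero radial_def[of _ _ "restrict _ _"])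
  note rad = this
  let ?z = "\<lambda>i. \<lambda>j\<in>{..i}. \<zero>\<^bsub>cell X j\<^esub>"
  have IH: "skel_extend X l (?z l) d = ?z (l + d)" using Suc by (intro Suc.IH) simp
  show ?case
  proof (rule extensionalityI[of _ "{..l + Suc d}"])
    show "skel_extend X l (?z l) (Suc d) \<in> extensional {..l + Suc d}"
      by (simp only: skel_extend.simps(2) restrict_extensional add_Suc_right)
    fix j assume "j \<in> {..l + Suc d}"
    then consider "j = ?k" | "j \<le> l + d" by force
    then show "skel_extend X l (?z l) (Suc d) j = ?z (l + Suc d) j"
    proof cases
      case 1
      have "Suc (l + d) \<le> n" using Suc.prems by simp
      from attach_zero[OF this] show ?thesis
        unfolding 1 skel_extend_top IH by (simp only: rad) simp
    next
      case 2
      then show ?thesis unfolding skel_extend_lower[OF 2] IH by simp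
    qed
  qed (rule restrict_extensional)
qed simp

text \<open>\<open>C\<^sub>0(\<I>\<^sub>0\<^sup>l \<rightarrow> F\<^sub>l)\<close>, as functions on the closed cube that vanish on its boundary.\<close>

definition rel_cells :: "nat \<Rightarrow> ((nat \<Rightarrow> real) \<Rightarrow> 'f) set" where
  "rel_cells l = {g \<in> carrier (cell X l). \<forall>p\<in>cube_boundary l. g p = \<zero>\<^bsub>cell_alg X l\<^esub>}"

abbreviation lift_base :: "nat \<Rightarrow> ((nat \<Rightarrow> real) \<Rightarrow> 'f) \<Rightarrow> 'f nccw_elem" where
  "lift_base l g \<equiv> (\<lambda>j\<in>{..l}. if j = l then g else \<zero>\<^bsub>cell X j\<^esub>)"

lemma lift_base_mem:
  assumes l: "l \<le> n" and g: "g \<in> rel_cells l"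
  shows "lift_base l g \<in> skeleton_carrier X l"
  unfolding skeleton_carrier_iff
proof (intro conjI allI impI)
  show "lift_base l g \<in> carrier (cells_sum X l)"
    using assms cell_zero_carrier by (auto simp: cells_sum_eq_sections rel_cells_def)
  fix i assume i: "i < l"
  have "restrict (lift_base l g) {..i} = (\<lambda>j\<in>{..i}. \<zero>\<^bsub>cell X j\<^esub>)"
    using i by (auto simp: fun_eq_iff restrict_def)
  then have "attach X (Suc i) (restrict (lift_base l g) {..i}) =
      (\<lambda>p\<in>cube_boundary (Suc i). \<zero>\<^bsub>cell_alg X (Suc i)\<^esub>)"
    using attach_zero[of i] i l by simp
  moreover have "restrict (lift_base l g (Suc i)) (cube_boundary (Suc i)) =
      (\<lambda>p\<in>cube_boundary (Suc i). \<zero>\<^bsub>cell_alg X (Suc i)\<^esub>)"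
    using i g cube_boundary_subset[of "Suc i"]
    by (intro restrict_ext) (auto simp: rel_cells_def cell_zero)
  ultimately show "restrict (lift_base l g (Suc i)) (cube_boundary (Suc i)) =
      attach X (Suc i) (restrict (lift_base l g) {..i})" by (simp only:)
qed

lemma nccw_alg_carrier: "carrier (nccw_alg X) = skeleton_carrier X n"
  by (simp add: nccw_alg_def skeleton_eq_sections)

lemma lift_mem:
  assumes "l \<le> n" "g \<in> rel_cells l"
  shows "lift X l g \<in> carrier (nccw_alg X)"
  using skel_extend_mem[of l "n - l", OF _ lift_base_mem[OF assms]] assms
  by (simp add: lift_def nccw_alg_carrier)

lemma lift_below: "j < l \<Longrightarrow> lift X l g j = \<zero>\<^bsub>cell X j\<^esub>"
  by (simp add: lift_def skel_extend_below)

lemma lift_at: "lift X l g l = g"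
  by (simp add: lift_def skel_extend_below)

lemma lift_zero: "l \<le> n \<Longrightarrow> lift X l \<zero>\<^bsub>cell X l\<^esub> = \<zero>\<^bsub>nccw_alg X\<^esub>"
proof -
  assume l: "l \<le> n"
  have "lift_base l \<zero>\<^bsub>cell X l\<^esub> = (\<lambda>j\<in>{..l}. \<zero>\<^bsub>cell X j\<^esub>)"
    by (intro restrict_ext) auto
  then show ?thesis
    using skel_extend_zero[of l "n - l"] l by (simp add: lift_def nccw_alg_def skeleton_eq_sections)
qed

lemma lift_dist_le:
  assumes l: "l \<le> n" and g: "g \<in> rel_cells l" "g' \<in> rel_cells l"
  shows "nrm (nccw_alg X) (lift X l g \<ominus>\<^bsub>nccw_alg X\<^esub> lift X l g') \<le> nrm (cell X l) (g \<ominus>\<^bsub>cell X l\<^esub> g')"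
proof -
  interpret L: section_space "{..l}" "cell X" "skeleton_carrier X l"
    by (rule skeleton_section_space[OF l])
  interpret C: pre_cstar "cell X l" by (rule cell_pre[OF l])
  note m = lift_base_mem[OF l g(1)] lift_base_mem[OF l g(2)]
  have gc: "g \<in> carrier (cell X l)" "g' \<in> carrier (cell X l)" using g by (auto simp: rel_cells_def)
  have "nrm (nccw_alg X) (lift X l g \<ominus>\<^bsub>nccw_alg X\<^esub> lift X l g') \<le>
      nrm (skeleton X l) (lift_base l g \<ominus>\<^bsub>skeleton X l\<^esub> lift_base l g')"
    using skel_extend_dist_le[of l "n - l", OF _ m] l by (simp add: lift_def nccw_alg_def)
  also have "\<dots> \<le> nrm (cell X l) (g \<ominus>\<^bsub>cell X l\<^esub> g')"
  proof -
    have "nrm (cell X j) (lift_base l g j \<ominus>\<^bsub>cell X j\<^esub> lift_base l g' j) \<le> nrm (cell X l) (g \<ominus>\<^bsub>cell X l\<^esub> g')"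
      if j: "j \<le> l" for j
    proof (cases "j = l")
      case False
      interpret J: pre_cstar "cell X j" by (rule cell_pre) (use j l in simp)
      show ?thesis using False j C.nrm_nonneg[OF C.diff_carrier[OF gc]] by simp
    qed simp
    then show ?thesis
      using L.diff_carrier[of "lift_base l g" "lift_base l g'"] m C.nrm_nonneg[OF C.diff_carrier[OF gc]]
      unfolding skeleton_eq_sections by (subst L.nrm_le_iff) (auto simp: L.sections_diff)
  qed
  finally show ?thesis .
qed

text \<open>One description for all \<open>k\<close>: beyond the dimension of the complex all components have to vanish.\<close>

lemma canonical_ideal_iff:
  "x \<in> canonical_ideal X k \<longleftrightarrow>
    x \<in> carrier (nccw_alg X) \<and> (\<forall>j<k. j \<le> n \<longrightarrow> x j = \<zero>\<^bsub>cell X j\<^esub>)"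
proof -
  consider "k = 0" | "0 < k" "k \<le> n" | "n < k" by linarith
  then show ?thesis
  proof cases
    case 2
    have "restrict x {..k - 1} = \<zero>\<^bsub>skeleton X (k - 1)\<^esub> \<longleftrightarrow> (\<forall>j<k. j \<le> n \<longrightarrow> x j = \<zero>\<^bsub>cell X j\<^esub>)"
    proof
      assume e: "restrict x {..k - 1} = \<zero>\<^bsub>skeleton X (k - 1)\<^esub>"
      show "\<forall>j<k. j \<le> n \<longrightarrow> x j = \<zero>\<^bsub>cell X j\<^esub>"
      proof (intro allI impI)
        fix j assume "j < k"
        then have "j \<le> k - 1" by simp
        then show "x j = \<zero>\<^bsub>cell X j\<^esub>"
          using fun_cong[OF e, of j] by (simp add: skeleton_eq_sections)
      qed
    next
      assume "\<forall>j<k. j \<le> n \<longrightarrow> x j = \<zero>\<^bsub>cell X j\<^esub>"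
      then show "restrict x {..k - 1} = \<zero>\<^bsub>skeleton X (k - 1)\<^esub>"
        unfolding skeleton_eq_sections sections_simps using 2 by (intro restrict_ext) auto
    qed
    then show ?thesis using 2 by (simp add: canonical_ideal_def)
  next
    case 3
    interpret N: section_space "{..n}" "cell X" "skeleton_carrier X n"
      by (rule skeleton_section_space) simp
    have z: "\<zero>\<^bsub>nccw_alg X\<^esub> = (\<lambda>j\<in>{..n}. \<zero>\<^bsub>cell X j\<^esub>)"
      by (simp add: nccw_alg_def skeleton_eq_sections)
    have "x = \<zero>\<^bsub>nccw_alg X\<^esub> \<longleftrightarrow> x \<in> carrier (nccw_alg X) \<and> (\<forall>j\<le>n. x j = \<zero>\<^bsub>cell X j\<^esub>)"
      unfolding z nccw_alg_carrier
      using N.zero_mem N.section_extensional by (auto intro!: extensionalityI[of _ "{..n}"])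
    then show ?thesis using 3 by (auto simp: canonical_ideal_def)
  qed (simp add: canonical_ideal_def)
qed

text \<open>If the top cell algebra were zero, then so would be the top canonical ideal.\<close>

lemma top_cell_nontrivial: "\<exists>v\<in>carrier (cell_alg X n). v \<noteq> \<zero>\<^bsub>cell_alg X n\<^esub>"
proof (rule ccontr)
  assume triv: "\<not> ?thesis"
  interpret N: section_space "{..n}" "cell X" "skeleton_carrier X n"
    by (rule skeleton_section_space) simp
  have z: "\<zero>\<^bsub>nccw_alg X\<^esub> = (\<lambda>j\<in>{..n}. \<zero>\<^bsub>cell X j\<^esub>)"
    by (simp add: nccw_alg_def skeleton_eq_sections)
  have "x = \<zero>\<^bsub>nccw_alg X\<^esub>" if x: "x \<in> canonical_ideal X n" for x
  proof -
    have xS: "x \<in> skeleton_carrier X n" using x by (simp add: canonical_ideal_iff nccw_alg_carrier)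
    have "x n \<in> carrier (cell X n)" using skeleton_carrierD[OF _ xS] by simp
    then have xn: "x n \<in> extensional (cube n)" "seq_cont (cube n) (cell_alg X n) (x n)"
      by (auto simp: cell_carrier)
    have "x n = \<zero>\<^bsub>cell X n\<^esub>"
      using triv seq_cont_carrier[OF xn(2)] xn(1)
      by (intro extensionalityI[of _ "cube n"]) (auto simp: cell_zero)
    then have "x j = \<zero>\<^bsub>cell X j\<^esub>" if "j \<le> n" for j
      using x that by (cases "j = n") (auto simp: canonical_ideal_iff)
    then show ?thesis
      unfolding z using N.section_extensional[OF xS] by (intro extensionalityI[of _ "{..n}"]) auto
  qed
  moreover have "\<zero>\<^bsub>nccw_alg X\<^esub> \<in> canonical_ideal X n"
    using N.zero_mem by (simp add: canonical_ideal_iff nccw_alg_carrier z)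
  ultimately have "canonical_ideal X n = {\<zero>\<^bsub>nccw_alg X\<^esub>}" by blast
  then show False using complex by (simp add: nccw_complex_def)
qed

end

section \<open>A criterion for NCCW complexes\<close>

lemma cube_center: "(\<lambda>i. if i < k then 1/2 else 0) \<in> cube k"
  by (auto simp: cube_eq)

text \<open>The function is the multiple of \<open>v\<close> by the product of all \<open>p\<^sub>i (1 - p\<^sub>i)\<close>.\<close>

lemma bump_function:
  assumes F: "pre_cstar F" and v: "v \<in> carrier F" "v \<noteq> \<zero>\<^bsub>F\<^esub>"
  obtains g where "g \<in> carrier (cont_cstar (cube_top k) F)" "\<And>p. p \<in> cube_boundary k \<Longrightarrow> g p = \<zero>\<^bsub>F\<^esub>"
    "g \<noteq> \<zero>\<^bsub>cont_cstar (cube_top k) F\<^esub>"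
proof -
  interpret F: pre_cstar F by fact
  define \<beta> where "\<beta> p = (\<Prod>i<k. complex_of_real (p i * (1 - p i)))" for p :: "nat \<Rightarrow> real"
  define g where "g = (\<lambda>p\<in>cube k. \<beta> p \<odot>\<^bsub>F\<^esub> v)"
  let ?c = "\<lambda>i. if i < k then 1/2 else (0 :: real)"
  show thesis
  proof (rule that)
    have "continuous_on (cube k) \<beta>"
      unfolding \<beta>_def by (intro continuous_intros continuous_on_coordinate)
    then have "seq_cont (cube k) F g"
      unfolding g_def by (simp add: F.seq_cont_smult F.seq_cont_const v)
    then show "g \<in> carrier (cont_cstar (cube_top k) F)"
      by (simp add: cube_top_eq F.carrier_cont) (simp add: g_def)
    show "g p = \<zero>\<^bsub>F\<^esub>" if p: "p \<in> cube_boundary k" for p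
    proof -
      obtain i where i: "p \<in> cube k" "i < k" "p i = 0 \<or> p i = 1" using p by (auto simp: cube_boundary_eq)
      then have "\<beta> p = 0" unfolding \<beta>_def by (auto intro!: prod_zero bexI[of _ i])
      then show ?thesis using i v by (simp add: g_def)
    qed
    have "\<beta> ?c = (\<Prod>i<k. 1/4)" unfolding \<beta>_def by (intro prod.cong) auto
    then have "\<beta> ?c \<noteq> 0" by simp
    then have "nrm F (\<beta> ?c \<odot>\<^bsub>F\<^esub> v) \<noteq> 0"
      using v by (simp add: F.nrm_smult F.nrm_eq_zero)
    then have "g ?c \<noteq> \<zero>\<^bsub>F\<^esub>"
      using cube_center[of k] by (auto simp: g_def)
    then show "g \<noteq> \<zero>\<^bsub>cont_cstar (cube_top k) F\<^esub>"
      using cube_center[of k] by (auto simp: cont_cstar_simps fun_eq_iff)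
  qed
qed

text \<open>Think of \<open>h t k\<close> as the restriction of \<open>t\<close> to the \<open>k\<close>-cells. The elements whose restrictions to all cells of dimension below \<open>k\<close>
vanish form a filtration of \<open>T\<close> by ideals; \<open>boundary\<close> and \<open>fill\<close> say that \<open>h\<close> identifies its \<open>k\<close>-th
subquotient with \<open>C\<^sub>0(\<I>\<^sub>0\<^sup>k \<rightarrow> G\<^sub>k)\<close>. Such a \<open>T\<close> is an NCCW complex.\<close>

locale cell_filtration =
  fixes T :: "'t cstar" and M :: nat and G :: "nat \<Rightarrow> 'g cstar"
    and h :: "'t \<Rightarrow> 'g nccw_elem"
  assumes G: "k \<le> M \<Longrightarrow> fin_dim_cstar (G k)"
    and T_add: "\<lbrakk>s \<in> carrier T; t \<in> carrier T\<rbrakk> \<Longrightarrow> s \<oplus>\<^bsub>T\<^esub> t \<in> carrier T"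
    and T_mult: "\<lbrakk>s \<in> carrier T; t \<in> carrier T\<rbrakk> \<Longrightarrow> s \<otimes>\<^bsub>T\<^esub> t \<in> carrier T"
    and T_smult: "t \<in> carrier T \<Longrightarrow> c \<odot>\<^bsub>T\<^esub> t \<in> carrier T"
    and T_invol: "t \<in> carrier T \<Longrightarrow> invol T t \<in> carrier T"
    and hom: "h \<in> star_hom T (dsum_cstar {..M} (\<lambda>k. cont_cstar (cube_top k) (G k)))"
    and inj: "inj_on h (carrier T)"
    and isometric: "t \<in> carrier T \<Longrightarrow>
      nrm (dsum_cstar {..M} (\<lambda>k. cont_cstar (cube_top k) (G k))) (h t) = nrm T t"
    and boundary: "\<lbrakk>t \<in> carrier T; Suc k \<le> M; \<And>j. j \<le> k \<Longrightarrow> h t j = \<zero>\<^bsub>cont_cstar (cube_top j) (G j)\<^esub>;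
      p \<in> cube_boundary (Suc k)\<rbrakk> \<Longrightarrow> h t (Suc k) p = \<zero>\<^bsub>G (Suc k)\<^esub>"
    and fill: "\<lbrakk>k \<le> M; g \<in> carrier (cont_cstar (cube_top k) (G k));
      \<And>p. p \<in> cube_boundary k \<Longrightarrow> g p = \<zero>\<^bsub>G k\<^esub>\<rbrakk> \<Longrightarrow>
      \<exists>t\<in>carrier T. (\<forall>j<k. h t j = \<zero>\<^bsub>cont_cstar (cube_top j) (G j)\<^esub>) \<and> h t k = g"
    and nontrivial: "\<exists>v\<in>carrier (G M). v \<noteq> \<zero>\<^bsub>G M\<^esub>"
begin

text \<open>The attaching morphism takes \<open>x\<close> to the boundary values of any element restricting to \<open>x\<close> on the
cells of lower dimension; \<open>boundary_determined\<close> shows that the choice is immaterial.\<close>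

definition E :: "'g nccw" where
  "E = \<lparr>ncdim = M, cell_alg = G,
     attach = (\<lambda>k x. restrict (h (SOME t. t \<in> carrier T \<and> restrict (h t) {..k - 1} = x) k) (cube_boundary k))\<rparr>"

lemma E_simps [simp]: "ncdim E = M" "cell_alg E = G"
  by (simp_all add: E_def)

lemma G_cstar: "k \<le> M \<Longrightarrow> cstar_algebra (G k)"
  using G by (simp add: fin_dim_cstar_def)

lemma G_pre: "k \<le> M \<Longrightarrow> pre_cstar (G k)"
  using G_cstar by (simp add: cstar_algebra_iff)

lemma cell_pre: "k \<le> M \<Longrightarrow> pre_cstar (cell E k)"
  unfolding cube_top_eq using G_pre by (intro pre_cstar.pre_cstar_cont compact_cube) simp

lemma hom': "h \<in> star_hom T (cells_sum E M)"
  using hom by (simp add: cells_sum_def)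

lemmas h = star_homD[OF hom']

lemma h_carrier: "t \<in> carrier T \<Longrightarrow> h t \<in> (\<Pi>\<^sub>E j\<in>{..M}. carrier (cell E j))"
  using h(1) by (simp add: cells_sum_eq_sections)

lemma h_cell: "t \<in> carrier T \<Longrightarrow> j \<le> M \<Longrightarrow> h t j \<in> carrier (cell E j)"
  using h_carrier by (auto simp: PiE_iff)

lemma h_fibre: "t \<in> carrier T \<Longrightarrow> j \<le> M \<Longrightarrow> p \<in> cube j \<Longrightarrow> h t j p \<in> carrier (G j)"
  using h_cell[of t j] pre_cstar.carrier_cont[OF G_pre, of j "cube j"] by (auto simp: cube_top_eq seq_cont_carrier)

definition T_diff :: "'t \<Rightarrow> 't \<Rightarrow> 't" where
  "T_diff s t = s \<oplus>\<^bsub>T\<^esub> ((-1) \<odot>\<^bsub>T\<^esub> t)"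

lemma T_diff_carrier: "s \<in> carrier T \<Longrightarrow> t \<in> carrier T \<Longrightarrow> T_diff s t \<in> carrier T"
  by (simp add: T_diff_def T_add T_smult)

lemma h_diff:
  assumes "s \<in> carrier T" "t \<in> carrier T" "j \<le> M"
  shows "h (T_diff s t) j = h s j \<ominus>\<^bsub>cell E j\<^esub> h t j"
  using assms pre_cstar.diff_conv_smult[OF cell_pre h_cell h_cell, of j s t]
  by (simp add: T_diff_def h T_smult cells_sum_eq_sections)

lemma h_add:
  assumes "s \<in> carrier T" "t \<in> carrier T" "j \<le> M"
  shows "h (s \<oplus>\<^bsub>T\<^esub> t) j = h s j \<oplus>\<^bsub>cell E j\<^esub> h t j"
  using assms by (simp add: h cells_sum_eq_sections)

text \<open>Apply \<open>boundary\<close> to the difference of the two elements.\<close>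

lemma boundary_determined:
  assumes s: "s \<in> carrier T" and t: "t \<in> carrier T" and k: "Suc k \<le> M"
    and eq: "restrict (h s) {..k} = restrict (h t) {..k}"
  shows "restrict (h s (Suc k)) (cube_boundary (Suc k)) = restrict (h t (Suc k)) (cube_boundary (Suc k))"
proof (rule restrict_ext)
  interpret F: pre_cstar "G (Suc k)" by (rule G_pre[OF k])
  fix p assume p: "p \<in> cube_boundary (Suc k)"
  then have pc: "p \<in> cube (Suc k)" using cube_boundary_subset by blast
  have "h (T_diff s t) (Suc k) p = \<zero>\<^bsub>G (Suc k)\<^esub>"
  proof (rule boundary[OF T_diff_carrier[OF s t] k _ p])
    fix j assume j: "j \<le> k"
    then have "h s j = h t j" using fun_cong[OF eq, of j] by simp
    then show "h (T_diff s t) j = \<zero>\<^bsub>cont_cstar (cube_top j) (G j)\<^esub>"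
      using h_diff[OF s t, of j] pre_cstar.diff_self[OF cell_pre h_cell[OF t], of j] j k by simp
  qed
  moreover have "h (T_diff s t) (Suc k) p = h s (Suc k) p \<ominus>\<^bsub>G (Suc k)\<^esub> h t (Suc k) p"
    using s t k pc h_fibre
    by (simp add: T_diff_def h T_smult cells_sum_eq_sections cont_cstar_simps F.diff_conv_smult)
  ultimately show "h s (Suc k) p = h t (Suc k) p"
    using F.diff_eq_zero_iff[of "h s (Suc k) p" "h t (Suc k) p"] h_fibre s t k pc by simp
qed

lemma attach_E:
  assumes t: "t \<in> carrier T" and k: "Suc k \<le> M"
  shows "attach E (Suc k) (restrict (h t) {..k}) = restrict (h t (Suc k)) (cube_boundary (Suc k))"
proof -
  define s where "s = (SOME s. s \<in> carrier T \<and> restrict (h s) {..k} = restrict (h t) {..k})"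
  have "s \<in> carrier T \<and> restrict (h s) {..k} = restrict (h t) {..k}"
    unfolding s_def by (rule someI[of _ t]) (use t in simp)
  then have "restrict (h s (Suc k)) (cube_boundary (Suc k)) = restrict (h t (Suc k)) (cube_boundary (Suc k))"
    using boundary_determined[OF _ t k] by blast
  then show ?thesis by (simp add: E_def flip: s_def)
qed

text \<open>Every element of \<open>D\<^sub>k\<close> comes from \<open>T\<close>: an element of \<open>T\<close> with the right components below the top one exists
by induction, its top component is right on the boundary, and \<open>fill\<close> corrects it in the interior.\<close>

lemma skeleton_E:
  "k \<le> M \<Longrightarrow> skeleton_carrier E k = (\<lambda>t. restrict (h t) {..k}) ` carrier T"
proof (induction k)
  case 0
  show ?case
  proof (intro equalityI subsetI)
    fix x assume x: "x \<in> skeleton_carrier E 0"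
    then have xc: "x \<in> (\<Pi>\<^sub>E j\<in>{..0}. carrier (cell E j))" by (simp add: cells_sum_eq_sections)
    then obtain t where t: "t \<in> carrier T" "h t 0 = x 0"
      using fill[of 0 "x 0"] by (auto simp: cube_boundary_eq)
    then have "x = restrict (h t) {..0}"
      using xc by (intro extensionalityI[of _ "{..0}"]) (auto simp: PiE_iff)
    then show "x \<in> (\<lambda>t. restrict (h t) {..0}) ` carrier T" using t by blast
  next
    fix x assume "x \<in> (\<lambda>t. restrict (h t) {..0}) ` carrier T"
    then show "x \<in> skeleton_carrier E 0"
      using h_cell[of _ 0] by (auto simp: cells_sum_eq_sections)
  qed
next
  case (Suc k)
  have k: "k \<le> M" using Suc.prems by simp
  note IH = Suc.IH[OF k]
  interpret C: pre_cstar "cell E (Suc k)" by (rule cell_pre[OF Suc.prems])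
  have rr: "restrict (restrict y {..Suc k}) {..k} = restrict y {..k}" for y :: "'g nccw_elem"
    by (auto simp: restrict_def)
  show ?case
  proof (intro equalityI subsetI)
    fix x assume x: "x \<in> skeleton_carrier E (Suc k)"
    then have xc: "x \<in> (\<Pi>\<^sub>E j\<in>{..Suc k}. carrier (cell E j))"
      by (simp add: skeleton_carrier_iff cells_sum_eq_sections)
    from x have "restrict x {..k} \<in> skeleton_carrier E k"
      and att: "restrict (x (Suc k)) (cube_boundary (Suc k)) = attach E (Suc k) (restrict x {..k})"
      by (auto simp only: skeleton_carrier.simps mem_Collect_eq)
    then obtain t where t: "t \<in> carrier T" "restrict x {..k} = restrict (h t) {..k}"
      unfolding IH by blast
    define g where "g = x (Suc k) \<ominus>\<^bsub>cell E (Suc k)\<^esub> h t (Suc k)"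
    have xk: "x (Suc k) \<in> carrier (cell E (Suc k))" using xc by auto
    have hk: "h t (Suc k) \<in> carrier (cell E (Suc k))" by (rule h_cell[OF t(1) Suc.prems])
    interpret F: pre_cstar "G (Suc k)" by (rule G_pre[OF Suc.prems])
    interpret S: section_space "cube (Suc k)" "\<lambda>_. G (Suc k)" "carrier (cell E (Suc k))"
      unfolding cube_top_eq E_simps by (intro F.section_space_cont compact_cube)
    have Seq: "cell E (Suc k) = S.Alg"
      unfolding cube_top_eq E_simps by (rule F.cont_cstar_eq_sections)
    have "g p = \<zero>\<^bsub>G (Suc k)\<^esub>" if p: "p \<in> cube_boundary (Suc k)" for p
    proof -
      have pc: "p \<in> cube (Suc k)" using p cube_boundary_subset by blast
      have "restrict (x (Suc k)) (cube_boundary (Suc k)) = restrict (h t (Suc k)) (cube_boundary (Suc k))"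
        unfolding att t(2) by (rule attach_E[OF t(1) Suc.prems])
      then have "x (Suc k) p = h t (Suc k) p" using p by (metis restrict_apply')
      moreover have "g p = x (Suc k) p \<ominus>\<^bsub>G (Suc k)\<^esub> h t (Suc k) p"
        unfolding g_def by (rule S.sections_diff[OF xk hk pc, folded Seq])
      ultimately show ?thesis using F.diff_self[OF S.fibre_carrier[OF hk pc]] by simp
    qed
    then obtain s where s: "s \<in> carrier T" "\<And>j. j < Suc k \<Longrightarrow> h s j = \<zero>\<^bsub>cell E j\<^esub>" "h s (Suc k) = g"
      using fill[OF Suc.prems, of g] C.diff_carrier[OF xk hk] by (auto simp: g_def)
    have "x = restrict (h (t \<oplus>\<^bsub>T\<^esub> s)) {..Suc k}"
    proof (rule extensionalityI[of _ "{..Suc k}"])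
      show "x \<in> extensional {..Suc k}" using xc by (simp add: PiE_iff)
      fix j assume j: "j \<in> {..Suc k}"
      have "x j = h (t \<oplus>\<^bsub>T\<^esub> s) j"
      proof (cases "j = Suc k")
        case True
        have "h (t \<oplus>\<^bsub>T\<^esub> s) (Suc k) = h t (Suc k) \<oplus>\<^bsub>cell E (Suc k)\<^esub> g"
          using h_add[OF t(1) s(1) Suc.prems] s(3) by simp
        also have "\<dots> = x (Suc k)" unfolding g_def by (rule C.add_diff_cancel[OF xk hk])
        finally show ?thesis using True by simp
      next
        case False
        then have jk: "j \<le> k" "j \<le> M" using j k by auto
        interpret J: pre_cstar "cell E j" by (rule cell_pre[OF jk(2)])
        have "h (t \<oplus>\<^bsub>T\<^esub> s) j = h t j"
          using h_add[OF t(1) s(1) jk(2)] s(2)[of j] jk h_cell[OF t(1) jk(2)]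
          by (simp del: E_simps)
        also have "h t j = x j" using fun_cong[OF t(2), of j] jk by simp
        finally show ?thesis by simp
      qed
      then show "x j = restrict (h (t \<oplus>\<^bsub>T\<^esub> s)) {..Suc k} j" using j by simp
    qed simp
    then show "x \<in> (\<lambda>t. restrict (h t) {..Suc k}) ` carrier T" using T_add[OF t(1) s(1)] by blast
  next
    fix x assume "x \<in> (\<lambda>t. restrict (h t) {..Suc k}) ` carrier T"
    then obtain t where t: "t \<in> carrier T" and x: "x = restrict (h t) {..Suc k}" by blast
    have "x \<in> carrier (cells_sum E (Suc k))"
      unfolding x using h_cell[OF t] Suc.prems by (auto simp: cells_sum_eq_sections)
    moreover have "restrict x {..k} \<in> skeleton_carrier E k" unfolding x rr IH using t by blast
    moreover have "restrict (x (Suc k)) (cube_boundary (Suc k)) = attach E (Suc k) (restrict x {..k})"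
      unfolding x rr attach_E[OF t Suc.prems] by simp
    ultimately show "x \<in> skeleton_carrier E (Suc k)"
      unfolding skeleton_carrier.simps mem_Collect_eq by blast
  qed
qed

lemma h_skeleton:
  assumes "k \<le> M"
  shows "(\<lambda>t. restrict (h t) {..k}) \<in> star_hom T (skeleton E k)"
proof -
  note r = star_homD[OF restrict_star_hom[OF assms, of E]]
  have ops: "x \<oplus>\<^bsub>skeleton E k\<^esub> y = x \<oplus>\<^bsub>cells_sum E k\<^esub> y" "x \<otimes>\<^bsub>skeleton E k\<^esub> y = x \<otimes>\<^bsub>cells_sum E k\<^esub> y"
    "c \<odot>\<^bsub>skeleton E k\<^esub> x = c \<odot>\<^bsub>cells_sum E k\<^esub> x" "invol (skeleton E k) x = invol (cells_sum E k) x" for x y c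
    by (simp_all add: skeleton_def)
  show ?thesis unfolding star_hom_def ops
    by (simp add: skeleton_eq_sections skeleton_E[OF assms] r h)
qed

text \<open>Elements of \<open>T\<close> restricting to \<open>x\<close> and \<open>y\<close> can be added, multiplied, and so on.\<close>

lemma attach_E_hom:
  assumes k: "Suc k \<le> M"
  shows "attach E (Suc k) \<in> star_hom (skeleton E k) (cell_sphere E (Suc k))"
proof -
  have k': "k \<le> M" using k by simp
  note r = star_homD[OF h_skeleton[OF k']]
  have bh: "(\<lambda>x. restrict (x (Suc k)) (cube_boundary (Suc k))) \<in> star_hom (cells_sum E M) (cell_sphere E (Suc k))"
    using k G_pre by (intro boundary_star_hom) auto
  note b = star_homD[OF bh]
  have lift: "\<exists>t\<in>carrier T. x = restrict (h t) {..k}" if "x \<in> carrier (skeleton E k)" for x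
    using that by (auto simp: skeleton_eq_sections skeleton_E[OF k'])
  show ?thesis unfolding star_hom_def
  proof (intro CollectI conjI ballI allI funcsetI)
    fix x assume "x \<in> carrier (skeleton E k)"
    then obtain s where s: "s \<in> carrier T" and x: "x = restrict (h s) {..k}" using lift by blast
    show "attach E (Suc k) x \<in> carrier (cell_sphere E (Suc k))"
      unfolding x attach_E[OF s k] by (rule b(1)[OF h(1)[OF s]])
    show "attach E (Suc k) (c \<odot>\<^bsub>skeleton E k\<^esub> x) = c \<odot>\<^bsub>cell_sphere E (Suc k)\<^esub> attach E (Suc k) x" for c
      unfolding x r(4)[OF s, symmetric] attach_E[OF s k] attach_E[OF T_smult[OF s] k]
      unfolding h(4)[OF s]
      by (rule b(4)[OF h(1)[OF s]])
    show "attach E (Suc k) (invol (skeleton E k) x) = invol (cell_sphere E (Suc k)) (attach E (Suc k) x)"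
      unfolding x r(5)[OF s, symmetric] attach_E[OF s k] attach_E[OF T_invol[OF s] k]
      unfolding h(5)[OF s]
      by (rule b(5)[OF h(1)[OF s]])
    fix y assume "y \<in> carrier (skeleton E k)"
    then obtain t where t: "t \<in> carrier T" and y: "y = restrict (h t) {..k}" using lift by blast
    show "attach E (Suc k) (x \<oplus>\<^bsub>skeleton E k\<^esub> y) =
        attach E (Suc k) x \<oplus>\<^bsub>cell_sphere E (Suc k)\<^esub> attach E (Suc k) y"
      unfolding x y r(2)[OF s t, symmetric] attach_E[OF s k] attach_E[OF t k] attach_E[OF T_add[OF s t] k]
      unfolding h(2)[OF s t]
      by (rule b(2)[OF h(1)[OF s] h(1)[OF t]])
    show "attach E (Suc k) (x \<otimes>\<^bsub>skeleton E k\<^esub> y) =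
        attach E (Suc k) x \<otimes>\<^bsub>cell_sphere E (Suc k)\<^esub> attach E (Suc k) y"
      unfolding x y r(3)[OF s t, symmetric] attach_E[OF s k] attach_E[OF t k] attach_E[OF T_mult[OF s t] k]
      unfolding h(3)[OF s t]
      by (rule b(3)[OF h(1)[OF s] h(1)[OF t]])
  qed
qed

lemma restrict_h: "t \<in> carrier T \<Longrightarrow> restrict (h t) {..M} = h t"
  using h_carrier by (intro extensional_restrict) (auto simp: PiE_iff)

text \<open>Fill the top cell with a nonzero bump function.\<close>

lemma top_ideal: "canonical_ideal E M \<noteq> {\<zero>\<^bsub>nccw_alg E\<^esub>}"
proof -
  obtain v where v: "v \<in> carrier (G M)" "v \<noteq> \<zero>\<^bsub>G M\<^esub>" using nontrivial by blast
  obtain g where g: "g \<in> carrier (cell E M)" "\<And>p. p \<in> cube_boundary M \<Longrightarrow> g p = \<zero>\<^bsub>G M\<^esub>"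
      "g \<noteq> \<zero>\<^bsub>cell E M\<^esub>"
    using bump_function[OF G_pre[OF order_refl] v, of M] by auto
  obtain t where t: "t \<in> carrier T" "\<And>j. j < M \<Longrightarrow> h t j = \<zero>\<^bsub>cell E j\<^esub>" "h t M = g"
    using fill[OF order_refl, of g] g by auto
  have "h t \<in> (\<lambda>t. restrict (h t) {..M}) ` carrier T"
    by (rule image_eqI[where x = t]) (simp_all only: t(1) restrict_h)
  then have "h t \<in> carrier (nccw_alg E)"
    by (simp only: nccw_alg_def skeleton_eq_sections sections_simps E_simps skeleton_E[OF order_refl])
  moreover have "restrict (h t) {..M - 1} = \<zero>\<^bsub>skeleton E (M - 1)\<^esub>" if "M > 0"
    unfolding skeleton_eq_sections sections_simps using that t(2) by (intro restrict_ext) auto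
  ultimately have "h t \<in> canonical_ideal E M" by (auto simp: canonical_ideal_def)
  moreover have "h t \<noteq> \<zero>\<^bsub>nccw_alg E\<^esub>"
  proof
    assume "h t = \<zero>\<^bsub>nccw_alg E\<^esub>"
    then have "h t M = \<zero>\<^bsub>cell E M\<^esub>" by (simp add: nccw_alg_def skeleton_eq_sections)
    then show False using t(3) g(3) by simp
  qed
  ultimately show ?thesis by blast
qed

theorem nccw_complex_E: "nccw_complex E"
  unfolding nccw_complex_def
proof (intro conjI allI impI ballI)
  show "fin_dim_cstar (cell_alg E k)" if "k \<le> ncdim E" for k using that G by simp
  fix k assume "k \<in> {1..ncdim E}"
  then obtain k' where "k = Suc k'" "Suc k' \<le> M" by (cases k) auto
  then show "attach E k \<in> star_hom (skeleton E (k - 1)) (cont_cstar (sphere_top k) (cell_alg E k))"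
    using attach_E_hom[of k'] by simp
qed (use top_ideal in simp)

theorem iso_E: "cstar_iso T (nccw_alg E)"
  unfolding cstar_iso_def
proof (rule bexI[of _ "\<lambda>t. restrict (h t) {..M}"])
  show "(\<lambda>t. restrict (h t) {..M}) \<in> star_hom T (nccw_alg E)"
    using h_skeleton[OF order_refl] by (simp add: nccw_alg_def)
  have "inj_on (\<lambda>t. restrict (h t) {..M}) (carrier T)"
    using inj restrict_h by (simp add: inj_on_def)
  moreover have "carrier (nccw_alg E) = (\<lambda>t. restrict (h t) {..M}) ` carrier T"
    using skeleton_E[OF order_refl] by (simp add: nccw_alg_def skeleton_eq_sections)
  moreover have "nrm (nccw_alg E) = nrm (dsum_cstar {..M} (\<lambda>k. cont_cstar (cube_top k) (G k)))"
    by (simp add: nccw_alg_def skeleton_def cells_sum_def)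
  ultimately show "bij_betw (\<lambda>t. restrict (h t) {..M}) (carrier T) (carrier (nccw_alg E)) \<and>
      (\<forall>t\<in>carrier T. nrm (nccw_alg E) (restrict (h t) {..M}) = nrm T t)"
    using isometric restrict_h by (simp add: bij_betw_def)
qed

end

section \<open>Paths in NCCW complexes and functions on products with the interval\<close>

lemma cube_upd: "q \<in> cube l \<Longrightarrow> 0 \<le> t \<Longrightarrow> t \<le> 1 \<Longrightarrow> q(l := t) \<in> cube (Suc l)"
  by (auto simp: cube_eq less_Suc_eq)

lemma cube_boundary_upd:
  "q \<in> cube_boundary l \<Longrightarrow> 0 \<le> t \<Longrightarrow> t \<le> 1 \<Longrightarrow> q(l := t) \<in> cube_boundary (Suc l)"
  using cube_upd[of q l t] by (force simp: cube_boundary_eq)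

lemma cube_Suc_proj: "p \<in> cube (Suc l) \<Longrightarrow> p(l := 0) \<in> cube l \<and> p l \<in> {0..1}"
  by (auto simp: cube_eq)

text \<open>If the slices did not converge in norm, there would be points \<open>q N \<in> S\<close> at which the values stay apart; along a
convergent subsequence of them this contradicts joint continuity.\<close>

lemma (in pre_cstar) seq_cont_slices:
  fixes S :: "'q::{first_countable_topology,t2_space} set" and U :: "'t::{first_countable_topology,t2_space} set"
  assumes S: "compact S" and u: "seq_cont (S \<times> U) A u"
  shows "seq_cont U (cont_cstar (top_of_set S) A) (\<lambda>t. \<lambda>q\<in>S. u (q, t))"
proof (rule seq_contI)
  let ?C = "cont_cstar (top_of_set S) A"
  let ?f = "\<lambda>t. \<lambda>q\<in>S. u (q, t)"
  note uc = seq_cont_carrier[OF u]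
  interpret C: section_space S "\<lambda>_. A" "carrier ?C"
    by (rule section_space_cont[OF S])
  note Ceq = cont_cstar_eq_sections[of S]
  show fc: "?f t \<in> carrier ?C" if "t \<in> U" for t
    using that by (auto simp: carrier_cont intro!: seq_cont_compose[OF u] continuous_intros)
  fix t t0 assume t: "\<And>n. t n \<in> U" "t0 \<in> U" "t \<longlonglongrightarrow> t0"
  define c where "c n = nrm ?C (?f (t n) \<ominus>\<^bsub>?C\<^esub> ?f t0)" for n
  have dc: "?f (t n) \<ominus>\<^bsub>C.Alg\<^esub> ?f t0 \<in> carrier ?C" for n
    using C.diff_carrier[of "?f (t n)" "?f t0"] fc t by simp
  have c_le: "c n \<le> e \<longleftrightarrow> 0 \<le> e \<and> (\<forall>q\<in>S. nrm A (u (q, t n) \<ominus> u (q, t0)) \<le> e)" for n e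
    using C.nrm_le_iff[OF dc, of n e] C.sections_diff[OF fc fc, of "t n" t0] t
    by (simp add: c_def flip: Ceq)
  have c0: "0 \<le> c n" for n using c_le[of n "c n"] by simp
  have "c \<longlonglongrightarrow> 0"
  proof (rule ccontr)
    assume "\<not> c \<longlonglongrightarrow> 0"
    then obtain e where e: "e > 0" "\<And>N. \<exists>n\<ge>N. c n \<ge> e"
      using c0 by (auto simp: LIMSEQ_def not_less)
    have "\<exists>n q. n \<ge> N \<and> q \<in> S \<and> nrm A (u (q, t n) \<ominus> u (q, t0)) > e / 2" for N
    proof -
      obtain n where n: "n \<ge> N" "c n \<ge> e" using e(2) by blast
      then have "\<not> c n \<le> e / 2" using e(1) by simp
      then show ?thesis using n(1) c_le[of n "e / 2"] e(1) by (auto simp: not_le)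
    qed
    then obtain r q where r: "\<And>N. r N \<ge> N" and q: "\<And>N. q N \<in> S"
      and big: "\<And>N. nrm A (u (q N, t (r N)) \<ominus> u (q N, t0)) > e / 2"
      by metis
    obtain q0 s where q0: "q0 \<in> S" and s: "strict_mono s" and qs: "(q \<circ> s) \<longlonglongrightarrow> q0"
      using compact_imp_seq_compact[OF S] q unfolding seq_compact_def by blast
    have "filterlim (\<lambda>n. r (s n)) sequentially sequentially"
    proof (rule filterlim_at_top_mono[OF filterlim_ident])
      show "\<forall>\<^sub>F n in sequentially. n \<le> r (s n)"
        by (intro always_eventually allI order_trans[OF seq_suble[OF s] r])
    qed
    then have tl: "(\<lambda>n. t (r (s n))) \<longlonglongrightarrow> t0" by (rule filterlim_compose[OF t(3)])
    have l1: "(\<lambda>n. nrm A (u (q (s n), t (r (s n))) \<ominus> u (q0, t0))) \<longlonglongrightarrow> 0"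
      using qs tl q q0 t by (intro seq_contD[OF u] tendsto_Pair) (auto simp: o_def)
    have l2: "(\<lambda>n. nrm A (u (q (s n), t0) \<ominus> u (q0, t0))) \<longlonglongrightarrow> 0"
      using qs q q0 t by (intro seq_contD[OF u] tendsto_Pair) (auto simp: o_def)
    have "e / 2 \<le> 0"
    proof (rule LIMSEQ_le_const)
      show "(\<lambda>n. nrm A (u (q (s n), t (r (s n))) \<ominus> u (q0, t0)) + nrm A (u (q (s n), t0) \<ominus> u (q0, t0))) \<longlonglongrightarrow> 0"
        using tendsto_add[OF l1 l2] by simp
      have "e / 2 \<le> nrm A (u (q (s n), t (r (s n))) \<ominus> u (q0, t0)) + nrm A (u (q (s n), t0) \<ominus> u (q0, t0))" for n
        using big[of "s n"] nrm_diff_triangle[of "u (q (s n), t (r (s n)))" "u (q0, t0)" "u (q (s n), t0)"]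
          nrm_diff_commute[of "u (q0, t0)" "u (q (s n), t0)"] uc q q0 t by simp
      then show "\<exists>N. \<forall>n\<ge>N. e / 2 \<le> nrm A (u (q (s n), t (r (s n))) \<ominus> u (q0, t0)) + nrm A (u (q (s n), t0) \<ominus> u (q0, t0))"
        by blast
    qed
    then show False using e(1) by simp
  qed
  then show "(\<lambda>n. nrm ?C (?f (t n) \<ominus>\<^bsub>?C\<^esub> ?f t0)) \<longlonglongrightarrow> 0" by (simp add: c_def[abs_def])
qed

context nccw_space
begin

lemma nccw_alg_eq: "nccw_alg X = sections {..n} (cell X) (skeleton_carrier X n)"
  by (simp add: nccw_alg_def skeleton_eq_sections)

lemma nccw_alg_pre: "pre_cstar (nccw_alg X)"
  unfolding nccw_alg_def by (rule skeleton_pre) simp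

lemma nccw_alg_cell: "x \<in> carrier (nccw_alg X) \<Longrightarrow> l \<le> n \<Longrightarrow> x l \<in> carrier (cell X l)"
  by (rule skeleton_carrierD[of n]) (auto simp: nccw_alg_carrier)

lemma nccw_alg_fibre: "x \<in> carrier (nccw_alg X) \<Longrightarrow> l \<le> n \<Longrightarrow> q \<in> cube l \<Longrightarrow> x l q \<in> carrier (cell_alg X l)"
  using nccw_alg_cell[of x l] by (auto simp: cell_carrier seq_cont_carrier)

lemma nccw_alg_ops:
  assumes "l \<le> n" "q \<in> cube l"
  shows "(x \<oplus>\<^bsub>nccw_alg X\<^esub> y) l q = x l q \<oplus>\<^bsub>cell_alg X l\<^esub> y l q"
    "(x \<otimes>\<^bsub>nccw_alg X\<^esub> y) l q = x l q \<otimes>\<^bsub>cell_alg X l\<^esub> y l q"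
    "(c \<odot>\<^bsub>nccw_alg X\<^esub> x) l q = c \<odot>\<^bsub>cell_alg X l\<^esub> x l q"
    "invol (nccw_alg X) x l q = invol (cell_alg X l) (x l q)"
    "\<zero>\<^bsub>nccw_alg X\<^esub> l q = \<zero>\<^bsub>cell_alg X l\<^esub>"
  using assms by (simp_all add: nccw_alg_eq cont_cstar_simps)

lemma nccw_alg_ext:
  assumes "x \<in> carrier (nccw_alg X)" "y \<in> carrier (nccw_alg X)"
    and "\<And>l q. l \<le> n \<Longrightarrow> q \<in> cube l \<Longrightarrow> x l q = y l q"
  shows "x = y"
proof -
  interpret N: section_space "{..n}" "cell X" "skeleton_carrier X n"
    by (rule skeleton_section_space) simp
  show ?thesis
  proof (rule N.section_eqI)
    show "x \<in> extensional {..n}" "y \<in> extensional {..n}"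
      using assms N.section_extensional by (auto simp: nccw_alg_carrier)
    fix l assume "l \<in> {..n}"
    then have l: "l \<le> n" by simp
    show "x l = y l"
      using nccw_alg_cell[OF assms(1) l] nccw_alg_cell[OF assms(2) l] assms(3)[OF l] l
      by (intro extensionalityI[of _ "cube l"]) (auto simp: cell_carrier)
  qed
qed

lemma cell_zeroI:
  assumes "x \<in> carrier (nccw_alg X)" "l \<le> n" "\<And>q. q \<in> cube l \<Longrightarrow> x l q = \<zero>\<^bsub>cell_alg X l\<^esub>"
  shows "x l = \<zero>\<^bsub>cell X l\<^esub>"
  using nccw_alg_cell[OF assms(1,2)] assms
  by (intro extensionalityI[of _ "cube l"]) (auto simp: cell_carrier cell_zero)

lemma nccw_alg_nrm_le_iff:
  assumes x: "x \<in> carrier (nccw_alg X)"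
  shows "nrm (nccw_alg X) x \<le> c \<longleftrightarrow> 0 \<le> c \<and> (\<forall>l\<le>n. \<forall>q\<in>cube l. nrm (cell_alg X l) (x l q) \<le> c)"
proof -
  interpret N: section_space "{..n}" "cell X" "skeleton_carrier X n"
    by (rule skeleton_section_space) simp
  have "nrm (cell X l) (x l) \<le> c \<longleftrightarrow> 0 \<le> c \<and> (\<forall>q\<in>cube l. nrm (cell_alg X l) (x l q) \<le> c)" if l: "l \<le> n" for l
    using section_space.nrm_le_iff[OF cell_section_space[OF l] nccw_alg_cell[OF x l], of c]
    by (simp flip: cell_eq_sections[OF l])
  then show ?thesis
    using N.nrm_le_iff[of x c] x by (auto simp: nccw_alg_eq)
qed

text \<open>A norm continuous path in the complex gives a jointly continuous function of time and position on
each cell.\<close>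

lemma seq_cont_eval:
  assumes \<phi>: "seq_cont U (nccw_alg X) \<phi>" and l: "l \<le> n"
    and \<tau>: "continuous_on S \<tau>" "\<And>p. p \<in> S \<Longrightarrow> \<tau> p \<in> U"
    and \<pi>: "continuous_on S \<pi>" "\<And>p. p \<in> S \<Longrightarrow> \<pi> p \<in> cube l"
  shows "seq_cont S (cell_alg X l) (\<lambda>p. \<phi> (\<tau> p) l (\<pi> p))"
proof (rule seq_contI)
  interpret N: pre_cstar "nccw_alg X" by (rule nccw_alg_pre)
  interpret F: pre_cstar "cell_alg X l" by (rule cell_alg_pre[OF l])
  note c = seq_cont_carrier[OF \<phi>]
  show fc: "\<phi> (\<tau> p) l (\<pi> p) \<in> carrier (cell_alg X l)" if "p \<in> S" for p
    using that c \<tau> \<pi> l by (intro nccw_alg_fibre) auto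
  fix p q assume p: "\<And>n. p n \<in> S" "q \<in> S" "p \<longlonglongrightarrow> q"
  have \<tau>l: "(\<lambda>k. \<tau> (p k)) \<longlonglongrightarrow> \<tau> q" and \<pi>l: "(\<lambda>k. \<pi> (p k)) \<longlonglongrightarrow> \<pi> q"
    using p \<tau>(1) \<pi>(1) unfolding continuous_on_sequentially o_def by blast+
  have x: "\<phi> (\<tau> q) l \<in> carrier (cell X l)" using c \<tau> p by (intro nccw_alg_cell l) auto
  then have xc: "seq_cont (cube l) (cell_alg X l) (\<phi> (\<tau> q) l)" using l by (simp add: cell_carrier)
  show "(\<lambda>k. nrm (cell_alg X l) (\<phi> (\<tau> (p k)) l (\<pi> (p k)) \<ominus>\<^bsub>cell_alg X l\<^esub> \<phi> (\<tau> q) l (\<pi> q))) \<longlonglongrightarrow> 0"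
  proof (rule F.null_sequence_le)
    show "(\<lambda>k. nrm (nccw_alg X) (\<phi> (\<tau> (p k)) \<ominus>\<^bsub>nccw_alg X\<^esub> \<phi> (\<tau> q)) +
        nrm (cell_alg X l) (\<phi> (\<tau> q) l (\<pi> (p k)) \<ominus>\<^bsub>cell_alg X l\<^esub> \<phi> (\<tau> q) l (\<pi> q))) \<longlonglongrightarrow> 0"
      by (rule tendsto_add_zero)
        (intro seq_contD[OF \<phi> _ _ \<tau>l] seq_contD[OF xc _ _ \<pi>l] \<tau>(2) \<pi>(2) p)+
    fix k
    show "\<phi> (\<tau> (p k)) l (\<pi> (p k)) \<ominus>\<^bsub>cell_alg X l\<^esub> \<phi> (\<tau> q) l (\<pi> q) \<in> carrier (cell_alg X l)"
      using fc p by (intro F.diff_carrier) auto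
    have cs: "\<phi> (\<tau> (p k)) \<in> carrier (nccw_alg X)" "\<phi> (\<tau> q) \<in> carrier (nccw_alg X)"
      using c \<tau> p by auto
    have fs: "\<phi> (\<tau> (p k)) l (\<pi> (p k)) \<in> carrier (cell_alg X l)" "\<phi> (\<tau> q) l (\<pi> (p k)) \<in> carrier (cell_alg X l)"
        "\<phi> (\<tau> q) l (\<pi> q) \<in> carrier (cell_alg X l)"
      using cs \<pi> p l by (auto intro: nccw_alg_fibre)
    have "nrm (cell_alg X l) (\<phi> (\<tau> (p k)) l (\<pi> (p k)) \<ominus>\<^bsub>cell_alg X l\<^esub> \<phi> (\<tau> q) l (\<pi> q)) \<le>
        nrm (cell_alg X l) (\<phi> (\<tau> (p k)) l (\<pi> (p k)) \<ominus>\<^bsub>cell_alg X l\<^esub> \<phi> (\<tau> q) l (\<pi> (p k))) +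
        nrm (cell_alg X l) (\<phi> (\<tau> q) l (\<pi> (p k)) \<ominus>\<^bsub>cell_alg X l\<^esub> \<phi> (\<tau> q) l (\<pi> q))"
      by (rule F.nrm_diff_triangle[OF fs])
    also have "\<phi> (\<tau> (p k)) l (\<pi> (p k)) \<ominus>\<^bsub>cell_alg X l\<^esub> \<phi> (\<tau> q) l (\<pi> (p k)) =
        (\<phi> (\<tau> (p k)) \<ominus>\<^bsub>nccw_alg X\<^esub> \<phi> (\<tau> q)) l (\<pi> (p k))"
      using \<pi>(2)[OF p(1), of k] by (simp add: F.diff_conv_smult[OF fs(1,2)] N.diff_conv_smult[OF cs] nccw_alg_ops l)
    also have "nrm (cell_alg X l) \<dots> \<le> nrm (nccw_alg X) (\<phi> (\<tau> (p k)) \<ominus>\<^bsub>nccw_alg X\<^esub> \<phi> (\<tau> q))"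
      using nccw_alg_nrm_le_iff[OF N.diff_carrier[OF cs], of "nrm (nccw_alg X) (\<phi> (\<tau> (p k)) \<ominus>\<^bsub>nccw_alg X\<^esub> \<phi> (\<tau> q))"]
        \<pi>(2)[OF p(1), of k] l by blast
    finally show "nrm (cell_alg X l) (\<phi> (\<tau> (p k)) l (\<pi> (p k)) \<ominus>\<^bsub>cell_alg X l\<^esub> \<phi> (\<tau> q) l (\<pi> q)) \<le>
        nrm (nccw_alg X) (\<phi> (\<tau> (p k)) \<ominus>\<^bsub>nccw_alg X\<^esub> \<phi> (\<tau> q)) +
        nrm (cell_alg X l) (\<phi> (\<tau> q) l (\<pi> (p k)) \<ominus>\<^bsub>cell_alg X l\<^esub> \<phi> (\<tau> q) l (\<pi> q))" by simp
  qed
qed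

text \<open>A function on \<open>\<I>\<^sup>l \<times> \<I>\<close> that vanishes on the boundary is a loop of functions on \<open>\<I>\<^sup>l\<close>, based at zero. As \<open>lift\<close> does not
increase distances, it takes the loop to a norm continuous one.\<close>

lemma lift_path:
  assumes l: "l \<le> n" and g: "seq_cont (cube (Suc l)) (cell_alg X l) g"
    and gb: "\<And>p. p \<in> cube_boundary (Suc l) \<Longrightarrow> g p = \<zero>\<^bsub>cell_alg X l\<^esub>"
  defines "s \<equiv> \<lambda>t. \<lambda>q\<in>cube l. g (q(l := t))"
  shows "t \<in> {0..1} \<Longrightarrow> s t \<in> rel_cells l"
    and "seq_cont {0..1} (nccw_alg X) (\<lambda>t. lift X l (s t))"
    and "lift X l (s 0) = \<zero>\<^bsub>nccw_alg X\<^esub>" "lift X l (s 1) = \<zero>\<^bsub>nccw_alg X\<^esub>"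
proof -
  interpret F: pre_cstar "cell_alg X l" by (rule cell_alg_pre[OF l])
  interpret N: pre_cstar "nccw_alg X" by (rule nccw_alg_pre)
  have "continuous_on (cube l \<times> {0..1}) (\<lambda>x :: (nat \<Rightarrow> real) \<times> real. ((fst x)(l := snd x)) i)" for i
    using continuous_on_product_then_coordinatewise[OF continuous_on_fst[OF continuous_on_id], of "cube l \<times> {0..1}" i]
    by (cases "i = l") (simp_all add: continuous_on_snd)
  then have "continuous_on (cube l \<times> {0..1}) (\<lambda>x :: (nat \<Rightarrow> real) \<times> real. (fst x)(l := snd x))"
    by (rule continuous_on_coordinatewise_then_product)
  then have "seq_cont (cube l \<times> {0..1}) (cell_alg X l) (\<lambda>x. g ((fst x)(l := snd x)))"
    by (rule seq_cont_compose[OF g]) (auto intro: cube_upd)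
  from F.seq_cont_slices[OF compact_cube this]
  have sc: "seq_cont {0..1} (cell X l) s"
    by (simp add: s_def[abs_def] cube_top_eq)
  show sr: "s t \<in> rel_cells l" if "t \<in> {0..1}" for t
    using seq_cont_carrier[OF sc that] that cube_boundary_subset[of l]
    by (auto simp: rel_cells_def s_def intro!: gb cube_boundary_upd)
  show "seq_cont {0..1} (nccw_alg X) (\<lambda>t. lift X l (s t))"
  proof (rule seq_contI)
    show lc: "lift X l (s t) \<in> carrier (nccw_alg X)" if "t \<in> {0..1}" for t
      by (rule lift_mem[OF l sr[OF that]])
    fix t t0 assume t: "\<And>m. t m \<in> {0..1}" "t0 \<in> {0..1}" "t \<longlonglongrightarrow> (t0 :: real)"
    show "(\<lambda>m. nrm (nccw_alg X) (lift X l (s (t m)) \<ominus>\<^bsub>nccw_alg X\<^esub> lift X l (s t0))) \<longlonglongrightarrow> 0"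
      using lc t by (intro N.null_sequence_le[OF seq_contD[OF sc t]] lift_dist_le l sr N.diff_carrier) auto
  qed
  have "s c = \<zero>\<^bsub>cell X l\<^esub>" if "c = 0 \<or> c = 1" for c
    unfolding cell_zero s_def using that
    by (intro restrict_ext gb) (auto simp: cube_boundary_eq intro!: cube_upd exI[of _ l])
  then show "lift X l (s 0) = \<zero>\<^bsub>nccw_alg X\<^esub>" "lift X l (s 1) = \<zero>\<^bsub>nccw_alg X\<^esub>"
    by (simp_all add: lift_zero[OF l])
qed

end

section \<open>The telescope as an NCCW complex\<close>

lemma dsum_cstar_simps:
  "x \<otimes>\<^bsub>dsum_cstar I A\<^esub> y = (\<lambda>i\<in>I. x i \<otimes>\<^bsub>A i\<^esub> y i)"
  "x \<oplus>\<^bsub>dsum_cstar I A\<^esub> y = (\<lambda>i\<in>I. x i \<oplus>\<^bsub>A i\<^esub> y i)"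
  "c \<odot>\<^bsub>dsum_cstar I A\<^esub> x = (\<lambda>i\<in>I. c \<odot>\<^bsub>A i\<^esub> x i)"
  "invol (dsum_cstar I A) x = (\<lambda>i\<in>I. invol (A i) (x i))"
  "\<zero>\<^bsub>dsum_cstar I A\<^esub> = (\<lambda>i\<in>I. \<zero>\<^bsub>A i\<^esub>)"
  "carrier (dsum_cstar I A) = (\<Pi>\<^sub>E i\<in>I. carrier (A i))"
  by (simp_all add: dsum_cstar_def)

lemma star_hom_id: "id \<in> star_hom A A"
  by (simp add: star_hom_def)

lemma star_hom_comp: "g \<in> star_hom B C \<Longrightarrow> f \<in> star_hom A B \<Longrightarrow> g \<circ> f \<in> star_hom A C"
  by (auto simp: star_hom_def Pi_iff)

locale simplicial_sequence =
  fixes n :: nat and A :: "nat \<Rightarrow> 'f nccw" and \<alpha> :: "nat \<Rightarrow> 'f nccw_elem \<Rightarrow> 'f nccw_elem"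
  assumes n: "1 \<le> n"
    and complexes: "j \<in> {1..n + 1} \<Longrightarrow> nccw_complex (A j)"
    and simplicial: "j \<in> {1..n} \<Longrightarrow> simplicial (A j) (A (j + 1)) (\<alpha> j)"
begin

abbreviation N :: "nat \<Rightarrow> 'f nccw_elem cstar" where "N j \<equiv> nccw_alg (A j)"
abbreviation d :: "nat \<Rightarrow> nat" where "d j \<equiv> ncdim (A j)"
abbreviation Tel where "Tel \<equiv> telescope n (\<lambda>j. nccw_alg (A j)) \<alpha>"

lemma nccw_space_A: "j \<in> {1..n + 1} \<Longrightarrow> nccw_space (A j)"
  using complexes by (simp add: nccw_space_def)

lemmas N_pre = nccw_space_A[THEN nccw_space.nccw_alg_pre]

lemma composite_hom: "k \<le> n \<Longrightarrow> composite \<alpha> k \<in> star_hom (N 1) (N (Suc k))"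
proof (induction k)
  case (Suc k)
  then have "\<alpha> (Suc k) \<in> star_hom (N (Suc k)) (N (Suc (Suc k)))"
    using simplicial[of "Suc k"] by (simp add: simplicial_def)
  then show ?case using Suc unfolding composite.simps by (intro star_hom_comp) auto
qed (simp add: star_hom_id)

lemma composite_ideal:
  "k \<le> n \<Longrightarrow> x \<in> canonical_ideal (A 1) i \<Longrightarrow> composite \<alpha> k x \<in> canonical_ideal (A (Suc k)) i"
proof (induction k)
  case (Suc k)
  then have "\<alpha> (Suc k) ` canonical_ideal (A (Suc k)) i \<subseteq> canonical_ideal (A (Suc (Suc k))) i"
    using simplicial[of "Suc k"] by (simp add: simplicial_def)
  then show ?case using Suc by auto
qed simp

subsection \<open>Elements of the telescope\<close>

text \<open>The components of \<open>a \<oplus> f\<^sub>2 \<oplus> \<dots> \<oplus> f\<^sub>n\<^sub>+\<^sub>1\<close> as paths, \<open>a\<close> being a constant one. This treats \<open>A\<^sub>1\<close> and the cylinders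
alike.\<close>

definition leg :: "'f nccw_elem \<times> (nat \<Rightarrow> real \<Rightarrow> 'f nccw_elem) \<Rightarrow> nat \<Rightarrow> real \<Rightarrow> 'f nccw_elem" where
  "leg \<tau> j t = (if j = 1 then fst \<tau> else snd \<tau> j t)"

lemma Tel_iff:
  "\<tau> \<in> carrier Tel \<longleftrightarrow> fst \<tau> \<in> carrier (N 1) \<and> snd \<tau> \<in> extensional {2..n + 1} \<and>
    (\<forall>j\<in>{2..n + 1}. snd \<tau> j \<in> extensional {0..1} \<and> seq_cont {0..1} (N j) (snd \<tau> j)) \<and>
    (\<forall>k\<in>{1..n}. snd \<tau> (k + 1) 1 = composite \<alpha> k (fst \<tau>))"
proof -
  have "carrier (cont_cstar (top_of_set {0..1 :: real}) (N j)) = {f \<in> extensional {0..1}. seq_cont {0..1} (N j) f}"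
    if "j \<in> {2..n + 1}" for j
    using that by (intro pre_cstar.carrier_cont N_pre) auto
  then have "(\<forall>j\<in>{2..n + 1}. f j \<in> carrier (cont_cstar (top_of_set {0..1}) (N j))) \<longleftrightarrow>
      (\<forall>j\<in>{2..n + 1}. f j \<in> extensional {0..1} \<and> seq_cont {0..1} (N j) (f j))"
      for f :: "nat \<Rightarrow> real \<Rightarrow> 'f nccw_elem"
    by (intro ball_cong refl) simp
  then have "f \<in> (\<Pi>\<^sub>E j\<in>{2..n + 1}. carrier (cont_cstar (top_of_set {0..1}) (N j))) \<longleftrightarrow>
      f \<in> extensional {2..n + 1} \<and> (\<forall>j\<in>{2..n + 1}. f j \<in> extensional {0..1} \<and> seq_cont {0..1} (N j) (f j))"
      for f :: "nat \<Rightarrow> real \<Rightarrow> 'f nccw_elem"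
    unfolding PiE_iff by (simp only: conj_commute)
  then show ?thesis
    unfolding telescope_def prod_cstar_def dsum_cstar_def Let_def
    by (cases \<tau>) (simp del: One_nat_def atLeastAtMost_iff add: conj_assoc)
qed

lemma Tel_ops:
  "\<tau> \<oplus>\<^bsub>Tel\<^esub> \<sigma> = (fst \<tau> \<oplus>\<^bsub>N 1\<^esub> fst \<sigma>, \<lambda>j\<in>{2..n + 1}. \<lambda>t\<in>{0..1}. snd \<tau> j t \<oplus>\<^bsub>N j\<^esub> snd \<sigma> j t)"
  "\<tau> \<otimes>\<^bsub>Tel\<^esub> \<sigma> = (fst \<tau> \<otimes>\<^bsub>N 1\<^esub> fst \<sigma>, \<lambda>j\<in>{2..n + 1}. \<lambda>t\<in>{0..1}. snd \<tau> j t \<otimes>\<^bsub>N j\<^esub> snd \<sigma> j t)"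
  "c \<odot>\<^bsub>Tel\<^esub> \<tau> = (c \<odot>\<^bsub>N 1\<^esub> fst \<tau>, \<lambda>j\<in>{2..n + 1}. \<lambda>t\<in>{0..1}. c \<odot>\<^bsub>N j\<^esub> snd \<tau> j t)"
  "invol Tel \<tau> = (invol (N 1) (fst \<tau>), \<lambda>j\<in>{2..n + 1}. \<lambda>t\<in>{0..1}. invol (N j) (snd \<tau> j t))"
  by (simp_all add: telescope_def prod_cstar_def dsum_cstar_def cont_cstar_def Let_def)

lemma leg_ops:
  assumes "j \<in> {1..n + 1}" "t \<in> {0..1}"
  shows "leg (\<tau> \<oplus>\<^bsub>Tel\<^esub> \<sigma>) j t = leg \<tau> j t \<oplus>\<^bsub>N j\<^esub> leg \<sigma> j t"
    "leg (\<tau> \<otimes>\<^bsub>Tel\<^esub> \<sigma>) j t = leg \<tau> j t \<otimes>\<^bsub>N j\<^esub> leg \<sigma> j t"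
    "leg (c \<odot>\<^bsub>Tel\<^esub> \<tau>) j t = c \<odot>\<^bsub>N j\<^esub> leg \<tau> j t"
    "leg (invol Tel \<tau>) j t = invol (N j) (leg \<tau> j t)"
  using assms by (auto simp: leg_def Tel_ops)

lemma leg_cont:
  assumes "\<tau> \<in> carrier Tel" "j \<in> {1..n + 1}"
  shows "seq_cont {0..1} (N j) (leg \<tau> j)"
proof (cases "j = 1")
  case True
  have "pre_cstar (N 1)" by (rule N_pre) simp
  then show ?thesis
    using assms True by (simp add: leg_def[abs_def] Tel_iff pre_cstar.seq_cont_const)
next
  case False
  then show ?thesis
    using assms by (simp add: leg_def[abs_def] Tel_iff)
qed

lemma leg_carrier: "\<tau> \<in> carrier Tel \<Longrightarrow> j \<in> {1..n + 1} \<Longrightarrow> t \<in> {0..1} \<Longrightarrow> leg \<tau> j t \<in> carrier (N j)"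
  using leg_cont seq_cont_carrier by blast

lemma leg_1:
  assumes "\<tau> \<in> carrier Tel" "j \<in> {2..n + 1}"
  shows "leg \<tau> j 1 = composite \<alpha> (j - 1) (fst \<tau>)"
proof -
  obtain k where "j = Suc k" "k \<in> {1..n}" using assms(2) by (cases j) auto
  then show ?thesis using assms(1) by (auto simp: leg_def Tel_iff)
qed

lemma Tel_closed:
  assumes \<tau>: "\<tau> \<in> carrier Tel"
  shows "\<sigma> \<in> carrier Tel \<Longrightarrow> \<tau> \<oplus>\<^bsub>Tel\<^esub> \<sigma> \<in> carrier Tel"
    "\<sigma> \<in> carrier Tel \<Longrightarrow> \<tau> \<otimes>\<^bsub>Tel\<^esub> \<sigma> \<in> carrier Tel"
    "c \<odot>\<^bsub>Tel\<^esub> \<tau> \<in> carrier Tel"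
    "invol Tel \<tau> \<in> carrier Tel"
proof -
  have N1: "pre_cstar (N 1)" by (rule N_pre) simp
  interpret N1: pre_cstar "N 1" by fact
  have Nj: "pre_cstar (N j)" if "j \<in> {2..n + 1}" for j using that by (intro N_pre) auto
  have hom: "composite \<alpha> k \<in> star_hom (N 1) (N (k + 1))" if "k \<in> {1..n}" for k
    using that composite_hom[of k] by simp
  note h = star_homD[OF hom]
  show "\<tau> \<oplus>\<^bsub>Tel\<^esub> \<sigma> \<in> carrier Tel" if "\<sigma> \<in> carrier Tel"
    using \<tau> that unfolding Tel_iff Tel_ops
    by (auto simp: h simp del: One_nat_def intro!: pre_cstar.seq_cont_add Nj)
  show "\<tau> \<otimes>\<^bsub>Tel\<^esub> \<sigma> \<in> carrier Tel" if "\<sigma> \<in> carrier Tel"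
    using \<tau> that unfolding Tel_iff Tel_ops
    by (auto simp: h N1.cstar_mult_closed simp del: One_nat_def intro!: pre_cstar.seq_cont_mult Nj)
  show "c \<odot>\<^bsub>Tel\<^esub> \<tau> \<in> carrier Tel"
    using \<tau> unfolding Tel_iff Tel_ops
    by (auto simp: h simp del: One_nat_def intro!: pre_cstar.seq_cont_smult Nj)
  show "invol Tel \<tau> \<in> carrier Tel"
    using \<tau> unfolding Tel_iff Tel_ops
    by (auto simp: h N1.invol_closed simp del: One_nat_def intro!: pre_cstar.seq_cont_invol Nj)
qed

lemma Tel_eqI:
  assumes \<tau>: "\<tau> \<in> carrier Tel" and \<sigma>: "\<sigma> \<in> carrier Tel"
    and eq: "\<And>j t. j \<in> {1..n + 1} \<Longrightarrow> t \<in> {0..1} \<Longrightarrow> leg \<tau> j t = leg \<sigma> j t"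
  shows "\<tau> = \<sigma>"
proof (rule prod_eqI)
  show "fst \<tau> = fst \<sigma>" using eq[of 1 0] by (simp add: leg_def)
  show "snd \<tau> = snd \<sigma>"
  proof (rule extensionalityI[of _ "{2..n + 1}"])
    fix j assume j: "j \<in> {2..n + 1}"
    show "snd \<tau> j = snd \<sigma> j"
    proof (rule extensionalityI[of _ "{0..1}"])
      show "snd \<tau> j t = snd \<sigma> j t" if "t \<in> {0..1}" for t
        using eq[of j t] j that by (simp add: leg_def)
    qed (use \<tau> \<sigma> j in \<open>auto simp: Tel_iff\<close>)
  qed (use \<tau> \<sigma> in \<open>auto simp: Tel_iff\<close>)
qed

lemma Tel_nrm_le_iff:
  assumes \<tau>: "\<tau> \<in> carrier Tel"
  shows "nrm Tel \<tau> \<le> c \<longleftrightarrow> 0 \<le> c \<and>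
    (\<forall>j\<in>{1..n + 1}. \<forall>t\<in>{0..1}. \<forall>l\<le>d j. \<forall>q\<in>cube l. nrm (cell_alg (A j) l) (leg \<tau> j t l q) \<le> c)"
proof -
  let ?C = "\<lambda>j. cont_cstar (top_of_set {0..1 :: real}) (N j)"
  have Nj: "pre_cstar (N j)" if "j \<in> {2..n + 1}" for j using that by (intro N_pre) auto
  have Cpre: "pre_cstar (?C j)" if "j \<in> {2..n + 1}" for j
    using Nj[OF that] by (rule pre_cstar.pre_cstar_cont) (rule compact_Icc)
  interpret D: section_space "{2..n + 1}" ?C "\<Pi>\<^sub>E j\<in>{2..n + 1}. carrier (?C j)"
    by (rule section_space_dsum) (use Cpre in auto)
  have snd: "snd \<tau> \<in> (\<Pi>\<^sub>E j\<in>{2..n + 1}. carrier (?C j))"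
    using \<tau> by (auto simp: Tel_iff PiE_iff pre_cstar.carrier_cont[OF Nj])
  have C: "nrm (?C j) (snd \<tau> j) \<le> c \<longleftrightarrow> 0 \<le> c \<and> (\<forall>t\<in>{0..1}. nrm (N j) (snd \<tau> j t) \<le> c)"
    if j: "j \<in> {2..n + 1}" for j
    using section_space.nrm_le_iff[OF pre_cstar.section_space_cont[OF Nj[OF j] compact_Icc[of "0 :: real" 1]], of "snd \<tau> j" c]
      D.fibre_carrier[OF snd j] by (simp flip: pre_cstar.cont_cstar_eq_sections[OF Nj[OF j]])
  have P: "nrm (N j) (leg \<tau> j t) \<le> c \<longleftrightarrow>
      0 \<le> c \<and> (\<forall>l\<le>d j. \<forall>q\<in>cube l. nrm (cell_alg (A j) l) (leg \<tau> j t l q) \<le> c)"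
    if "j \<in> {1..n + 1}" "t \<in> {0..1}" for j t
    by (rule nccw_space.nccw_alg_nrm_le_iff[OF nccw_space_A leg_carrier[OF \<tau>]]) (use that in auto)
  have "nrm Tel \<tau> = max (nrm (N 1) (fst \<tau>)) (nrm (dsum_cstar {2..n + 1} ?C) (snd \<tau>))"
    by (simp add: telescope_def prod_cstar_def Let_def)
  then have "nrm Tel \<tau> \<le> c \<longleftrightarrow>
      nrm (N 1) (fst \<tau>) \<le> c \<and> 0 \<le> c \<and> (\<forall>j\<in>{2..n + 1}. \<forall>t\<in>{0..1}. nrm (N j) (snd \<tau> j t) \<le> c)"
    using D.nrm_le_iff[OF snd, of c] C by (auto simp: dsum_cstar_eq_sections)
  also have "\<dots> \<longleftrightarrow> 0 \<le> c \<and> (\<forall>j\<in>{1..n + 1}. \<forall>t\<in>{0..1}. nrm (N j) (leg \<tau> j t) \<le> c)" (is "?L \<longleftrightarrow> ?R")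
  proof
    assume L: ?L
    have "nrm (N j) (leg \<tau> j t) \<le> c" if "j \<in> {1..n + 1}" "t \<in> {0..1}" for j t
      using L that by (cases "j = 1") (auto simp: leg_def)
    then show ?R using L by blast
  next
    assume R: ?R
    have "nrm (N 1) (leg \<tau> 1 0) \<le> c" using R by simp
    moreover have "nrm (N j) (leg \<tau> j t) \<le> c" if "j \<in> {2..n + 1}" "t \<in> {0..1}" for j t
      using R that by auto
    ultimately show ?L using R by (auto simp: leg_def split: if_splits)
  qed
  also have "\<dots> \<longleftrightarrow> 0 \<le> c \<and>
    (\<forall>j\<in>{1..n + 1}. \<forall>t\<in>{0..1}. \<forall>l\<le>d j. \<forall>q\<in>cube l. nrm (cell_alg (A j) l) (leg \<tau> j t l q) \<le> c)"
    by (intro conj_cong refl ball_cong) (simp only: P simp_thms)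
  finally show ?thesis .
qed

subsection \<open>Cells of the telescope\<close>

definition M :: nat where
  "M = Max (insert (d 1) ((\<lambda>j. 1 + d j) ` {2..n + 1}))"

text \<open>The \<open>k\<close>-cells of the telescope. The number \<open>2j\<close> stands for the \<open>k\<close>-cells of \<open>A\<^sub>j\<close> at time 0, and \<open>2j + 1\<close> for
the products of the \<open>(k-1)\<close>-cells of \<open>A\<^sub>j\<close> with the interval, whose coordinate is the last one of the
\<open>k\<close>-cube. The number 3 is left out because \<open>A\<^sub>1\<close> has no cylinder.\<close>

definition slots :: "nat \<Rightarrow> nat set" where
  "slots k = {i. i div 2 \<in> {1..n + 1} \<and> i \<noteq> 3 \<and> i mod 2 \<le> k \<and> k \<le> d (i div 2) + i mod 2}"

definition slot_time :: "nat \<Rightarrow> nat \<Rightarrow> (nat \<Rightarrow> real) \<Rightarrow> real" where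
  "slot_time k i p = (if even i then 0 else p (k - 1))"

definition slot_point :: "nat \<Rightarrow> nat \<Rightarrow> (nat \<Rightarrow> real) \<Rightarrow> nat \<Rightarrow> real" where
  "slot_point k i p = (if even i then p else p(k - 1 := 0))"

abbreviation slot_alg :: "nat \<Rightarrow> nat \<Rightarrow> 'f cstar" where
  "slot_alg k i \<equiv> cell_alg (A (i div 2)) (k - i mod 2)"

definition G :: "nat \<Rightarrow> (nat \<Rightarrow> 'f) cstar" where
  "G k = dsum_cstar (slots k) (slot_alg k)"

abbreviation "C k \<equiv> cont_cstar (cube_top k) (G k)"
abbreviation "Cells \<equiv> dsum_cstar {..M} C"

text \<open>The coordinate of the telescope belonging to the slot \<open>i\<close>: the leg \<open>i div 2\<close> at the time and the position that
the point \<open>p\<close> of the \<open>k\<close>-cube encodes.\<close>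

definition val :: "'f nccw_elem \<times> (nat \<Rightarrow> real \<Rightarrow> 'f nccw_elem) \<Rightarrow> nat \<Rightarrow> (nat \<Rightarrow> real) \<Rightarrow> nat \<Rightarrow> 'f" where
  "val \<tau> k p i = leg \<tau> (i div 2) (slot_time k i p) (k - i mod 2) (slot_point k i p)"

definition h :: "'f nccw_elem \<times> (nat \<Rightarrow> real \<Rightarrow> 'f nccw_elem) \<Rightarrow> (nat \<Rightarrow> 'f) nccw_elem" where
  "h \<tau> = (\<lambda>k\<in>{..M}. \<lambda>p\<in>cube k. \<lambda>i\<in>slots k. val \<tau> k p i)"

lemma finite_slots: "finite (slots k)"
proof (rule finite_subset)
  show "slots k \<subseteq> {..2 * n + 3}" by (auto simp: slots_def)
qed simp

lemma slot_cases:
  assumes "i \<in> slots k"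
  obtains (even) j where "j \<in> {1..n + 1}" "i = 2 * j" "k \<le> d j"
    | (odd) j l where "j \<in> {2..n + 1}" "i = 2 * j + 1" "k = Suc l" "l \<le> d j"
proof (cases "even i")
  case True
  then obtain j where "i = 2 * j" by blast
  then show thesis using assms even[of j] by (auto simp: slots_def)
next
  case False
  then obtain j where j: "i = 2 * j + 1" by (auto elim: oddE)
  moreover obtain l where "k = Suc l" using assms j by (cases k) (auto simp: slots_def)
  ultimately show thesis using assms odd[of j l] by (auto simp: slots_def)
qed

lemma even_slot: "j \<in> {1..n + 1} \<Longrightarrow> k \<le> d j \<Longrightarrow> 2 * j \<in> slots k"
  by (auto simp: slots_def) presburger

lemma odd_slot: "j \<in> {2..n + 1} \<Longrightarrow> l \<le> d j \<Longrightarrow> 2 * j + 1 \<in> slots (Suc l)"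
  by (auto simp: slots_def)

lemma val_even: "val \<tau> k p (2 * j) = leg \<tau> j 0 k p"
  by (simp add: val_def slot_time_def slot_point_def)

lemma val_odd: "val \<tau> (Suc l) p (2 * j + 1) = leg \<tau> j (p l) l (p(l := 0))"
  by (simp add: val_def slot_time_def slot_point_def)

lemma slot_facts:
  assumes "i \<in> slots k"
  shows "i div 2 \<in> {1..n + 1}" "k - i mod 2 \<le> d (i div 2)"
    "p \<in> cube k \<Longrightarrow> slot_time k i p \<in> {0..1}"
    "p \<in> cube k \<Longrightarrow> slot_point k i p \<in> cube (k - i mod 2)"
proof -
  show "i div 2 \<in> {1..n + 1}" "k - i mod 2 \<le> d (i div 2)"
    using assms by (auto simp: slots_def)
  assume p: "p \<in> cube k"
  from assms show "slot_time k i p \<in> {0..1}"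
    by (cases rule: slot_cases) (use p cube_Suc_proj in \<open>auto simp: slot_time_def\<close>)
  from assms show "slot_point k i p \<in> cube (k - i mod 2)"
    by (cases rule: slot_cases) (use p cube_Suc_proj in \<open>auto simp: slot_point_def\<close>)
qed

lemma dim_le_M: "j \<in> {1..n + 1} \<Longrightarrow> d j \<le> M"
proof -
  assume j: "j \<in> {1..n + 1}"
  have fin: "finite (insert (d 1) ((\<lambda>j. 1 + d j) ` {2..n + 1}))" by simp
  show ?thesis
  proof (cases "j = 1")
    case True
    then show ?thesis unfolding M_def by (intro Max_ge[OF fin]) simp
  next
    case False
    then have "1 + d j \<le> M" unfolding M_def using j by (intro Max_ge[OF fin]) auto
    then show ?thesis by simp
  qed
qed

lemma Suc_dim_le_M: "j \<in> {2..n + 1} \<Longrightarrow> Suc (d j) \<le> M"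
proof -
  assume "j \<in> {2..n + 1}"
  then have "1 + d j \<le> M" unfolding M_def by (intro Max_ge) auto
  then show ?thesis by simp
qed

text \<open>Every value of every leg is one of the coordinates; this makes \<open>h\<close> injective and isometric.\<close>

lemma slots_cover:
  assumes "j \<in> {1..n + 1}" "t \<in> {0..1}" "l \<le> d j" "q \<in> cube l"
  obtains k p i where "k \<le> M" "p \<in> cube k" "i \<in> slots k" "i div 2 = j" "k - i mod 2 = l"
    "\<And>\<tau>. val \<tau> k p i = leg \<tau> j t l q"
proof (cases "j = 1")
  case True
  show thesis
  proof (rule that[of l q 2])
    show "val \<tau> l q 2 = leg \<tau> j t l q" for \<tau>
      using val_even[of \<tau> l q 1] True by (simp add: leg_def)
  qed (use assms True even_slot[of 1 l] dim_le_M[of 1] in auto)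
next
  case False
  then have j: "j \<in> {2..n + 1}" using assms(1) by auto
  have "q l = 0" using assms(4) by (simp add: cube_eq)
  then have upd: "q(l := 0) = q" by (metis fun_upd_triv)
  show thesis
  proof (rule that[of "Suc l" "q(l := t)" "2 * j + 1"])
    show "q(l := t) \<in> cube (Suc l)" using assms by (intro cube_upd) auto
    show "val \<tau> (Suc l) (q(l := t)) (2 * j + 1) = leg \<tau> j t l q" for \<tau>
      unfolding val_odd by (simp add: upd)
    show "Suc l \<le> M" using Suc_dim_le_M[OF j] assms(3) by simp
  qed (use j assms odd_slot[of j l] in auto)
qed

lemma slot_alg_fin_dim: "i \<in> slots k \<Longrightarrow> fin_dim_cstar (slot_alg k i)"
  using slot_facts(1,2)[of i k] complexes[of "i div 2"] by (simp add: nccw_complex_def)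

lemma slot_alg_pre: "i \<in> slots k \<Longrightarrow> pre_cstar (slot_alg k i)"
  using slot_alg_fin_dim[of i k] by (simp add: fin_dim_cstar_def cstar_algebra_iff)

lemma fin_dim_G: "fin_dim_cstar (G k)"
  unfolding G_def using finite_slots slot_alg_fin_dim by (rule fin_dim_dsum)

lemma G_pre: "pre_cstar (G k)"
  using fin_dim_G[of k] by (simp add: fin_dim_cstar_def cstar_algebra_iff)

lemma carrier_cell_G:
  "g \<in> carrier (C k) \<longleftrightarrow> g \<in> extensional (cube k) \<and>
    (\<forall>p\<in>cube k. g p \<in> extensional (slots k)) \<and> (\<forall>i\<in>slots k. seq_cont (cube k) (slot_alg k i) (\<lambda>p. g p i))"
proof -
  have "g \<in> carrier (C k) \<longleftrightarrow> g \<in> extensional (cube k) \<and> seq_cont (cube k) (G k) g"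
    by (simp add: cube_top_eq pre_cstar.carrier_cont[OF G_pre])
  then show ?thesis
    unfolding G_def by (simp add: seq_cont_dsum_iff[OF finite_slots slot_alg_pre])
qed

lemma val_cont:
  assumes \<tau>: "\<tau> \<in> carrier Tel" and i: "i \<in> slots k"
  shows "seq_cont (cube k) (slot_alg k i) (\<lambda>p. val \<tau> k p i)"
proof -
  have t: "continuous_on (cube k) (slot_time k i)"
    by (cases "even i") (simp_all add: slot_time_def[abs_def] continuous_on_coordinate)
  have "continuous_on (cube k) (\<lambda>p. slot_point k i p l)" for l
    by (cases "even i"; cases "l = k - 1") (simp_all add: slot_point_def[abs_def] continuous_on_coordinate)
  then have p: "continuous_on (cube k) (slot_point k i)"
    by (rule continuous_on_coordinatewise_then_product)
  show ?thesis unfolding val_def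
    using i slot_facts[OF i] \<tau> t p
    by (intro nccw_space.seq_cont_eval[OF nccw_space_A leg_cont]) auto
qed

lemma val_ops:
  assumes i: "i \<in> slots k" and p: "p \<in> cube k"
  shows "val (\<tau> \<oplus>\<^bsub>Tel\<^esub> \<sigma>) k p i = val \<tau> k p i \<oplus>\<^bsub>slot_alg k i\<^esub> val \<sigma> k p i"
    "val (\<tau> \<otimes>\<^bsub>Tel\<^esub> \<sigma>) k p i = val \<tau> k p i \<otimes>\<^bsub>slot_alg k i\<^esub> val \<sigma> k p i"
    "val (c \<odot>\<^bsub>Tel\<^esub> \<tau>) k p i = c \<odot>\<^bsub>slot_alg k i\<^esub> val \<tau> k p i"
    "val (invol Tel \<tau>) k p i = invol (slot_alg k i) (val \<tau> k p i)"
  unfolding val_def leg_ops[OF slot_facts(1)[OF i] slot_facts(3)[OF i p]]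
  by (rule nccw_space.nccw_alg_ops[OF nccw_space_A[OF slot_facts(1)[OF i]] slot_facts(2)[OF i] slot_facts(4)[OF i p]])+

lemma h_mem: "\<tau> \<in> carrier Tel \<Longrightarrow> h \<tau> \<in> carrier (Cells)"
proof -
  assume \<tau>: "\<tau> \<in> carrier Tel"
  have "(\<lambda>p\<in>cube k. \<lambda>i\<in>slots k. val \<tau> k p i) \<in> carrier (C k)" for k
  proof -
    have "seq_cont (cube k) (slot_alg k i) (\<lambda>p. (\<lambda>p\<in>cube k. \<lambda>i\<in>slots k. val \<tau> k p i) p i)" if "i \<in> slots k" for i
      using val_cont[OF \<tau> that] by (rule seq_cont_cong[THEN iffD1, rotated]) (use that in simp)
    then show ?thesis unfolding carrier_cell_G by simp
  qed
  then show ?thesis by (auto simp: dsum_cstar_simps h_def)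
qed

lemma h_hom: "h \<in> star_hom Tel (Cells)"
proof -
  show ?thesis unfolding star_hom_def
  proof (intro CollectI conjI ballI allI funcsetI h_mem, assumption)
    fix \<tau> \<sigma> c
    show "h (\<tau> \<oplus>\<^bsub>Tel\<^esub> \<sigma>) = h \<tau> \<oplus>\<^bsub>Cells\<^esub> h \<sigma>"
      by (simp add: dsum_cstar_simps cont_cstar_simps G_def h_def val_ops cong: restrict_cong)
    show "h (\<tau> \<otimes>\<^bsub>Tel\<^esub> \<sigma>) = h \<tau> \<otimes>\<^bsub>Cells\<^esub> h \<sigma>"
      by (simp add: dsum_cstar_simps cont_cstar_simps G_def h_def val_ops cong: restrict_cong)
    show "h (c \<odot>\<^bsub>Tel\<^esub> \<tau>) = c \<odot>\<^bsub>Cells\<^esub> h \<tau>"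
      by (simp add: dsum_cstar_simps cont_cstar_simps G_def h_def val_ops cong: restrict_cong)
    show "h (invol Tel \<tau>) = invol Cells (h \<tau>)"
      by (simp add: dsum_cstar_simps cont_cstar_simps G_def h_def val_ops cong: restrict_cong)
  qed
qed

lemma h_apply: "k \<le> M \<Longrightarrow> p \<in> cube k \<Longrightarrow> i \<in> slots k \<Longrightarrow> h \<tau> k p i = val \<tau> k p i"
  by (simp add: h_def)

lemma h_inj: "inj_on h (carrier Tel)"
proof (rule inj_onI)
  fix \<tau> \<sigma> assume \<tau>: "\<tau> \<in> carrier Tel" and \<sigma>: "\<sigma> \<in> carrier Tel" and eq: "h \<tau> = h \<sigma>"
  show "\<tau> = \<sigma>"
  proof (rule Tel_eqI[OF \<tau> \<sigma>])
    fix j t assume jt: "j \<in> {1..n + 1}" "t \<in> {0..(1 :: real)}"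
    show "leg \<tau> j t = leg \<sigma> j t"
    proof (rule nccw_space.nccw_alg_ext[OF nccw_space_A[OF jt(1)] leg_carrier[OF \<tau> jt] leg_carrier[OF \<sigma> jt]])
      fix l q assume "l \<le> d j" "q \<in> cube l"
      from slots_cover[OF jt this] obtain k p i where "k \<le> M" "p \<in> cube k" "i \<in> slots k"
        "\<And>\<tau>. val \<tau> k p i = leg \<tau> j t l q" by metis
      then show "leg \<tau> j t l q = leg \<sigma> j t l q" using h_apply[of k p i] eq by metis
    qed
  qed
qed

lemma h_nrm_le_iff:
  assumes \<tau>: "\<tau> \<in> carrier Tel"
  shows "nrm (Cells) (h \<tau>) \<le> c \<longleftrightarrow>
    0 \<le> c \<and> (\<forall>k\<le>M. \<forall>p\<in>cube k. \<forall>i\<in>slots k. nrm (slot_alg k i) (val \<tau> k p i) \<le> c)"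
proof -
  have Cpre: "pre_cstar (C k)" for k
    unfolding cube_top_eq by (intro pre_cstar.pre_cstar_cont G_pre compact_cube)
  interpret D: section_space "{..M}" C "\<Pi>\<^sub>E k\<in>{..M}. carrier (C k)"
    by (rule section_space_dsum) (use Cpre in auto)
  have hc: "h \<tau> \<in> (\<Pi>\<^sub>E k\<in>{..M}. carrier (C k))" using h_mem[OF \<tau>] by (simp add: dsum_cstar_simps)
  have cell: "nrm (C k) (h \<tau> k) \<le> c \<longleftrightarrow> 0 \<le> c \<and> (\<forall>p\<in>cube k. \<forall>i\<in>slots k. nrm (slot_alg k i) (val \<tau> k p i) \<le> c)"
    if k: "k \<le> M" for k
  proof -
    interpret C: section_space "cube k" "\<lambda>_. G k" "carrier (C k)"
      unfolding cube_top_eq by (intro pre_cstar.section_space_cont G_pre compact_cube)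
    have Ceq: "C k = C.Alg" unfolding cube_top_eq by (rule pre_cstar.cont_cstar_eq_sections[OF G_pre])
    have hk: "h \<tau> k \<in> carrier (C k)" using hc k by auto
    interpret F: section_space "slots k" "slot_alg k" "\<Pi>\<^sub>E i\<in>slots k. carrier (slot_alg k i)"
      by (rule section_space_dsum[OF finite_slots slot_alg_pre])
    have "nrm (G k) (h \<tau> k p) \<le> c \<longleftrightarrow> 0 \<le> c \<and> (\<forall>i\<in>slots k. nrm (slot_alg k i) (val \<tau> k p i) \<le> c)"
      if p: "p \<in> cube k" for p
    proof -
      have "h \<tau> k p \<in> (\<Pi>\<^sub>E i\<in>slots k. carrier (slot_alg k i))"
        using C.fibre_carrier[OF hk p] by (simp add: G_def dsum_cstar_simps)
      then show ?thesis
        using F.nrm_le_iff[of "h \<tau> k p" c] h_apply[OF k p]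
        by (simp add: G_def dsum_cstar_eq_sections[OF finite_slots])
    qed
    then show ?thesis using C.nrm_le_iff[OF hk, of c] unfolding Ceq[symmetric] by auto
  qed
  show ?thesis
    using D.nrm_le_iff[OF hc, of c] cell by (auto simp: dsum_cstar_eq_sections)
qed

lemma h_isometric:
  assumes \<tau>: "\<tau> \<in> carrier Tel"
  shows "nrm (Cells) (h \<tau>) = nrm Tel \<tau>"
proof -
  have "nrm (Cells) (h \<tau>) \<le> c \<longleftrightarrow> nrm Tel \<tau> \<le> c" for c
    unfolding h_nrm_le_iff[OF \<tau>] Tel_nrm_le_iff[OF \<tau>]
  proof (intro conj_cong refl iffI ballI allI impI)
    fix j t l q assume slots: "\<forall>k\<le>M. \<forall>p\<in>cube k. \<forall>i\<in>slots k. nrm (slot_alg k i) (val \<tau> k p i) \<le> c"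
      and "j \<in> {1..n + 1}" "t \<in> {0..(1 :: real)}" "l \<le> d j" "q \<in> cube l"
    from slots_cover[OF this(2-)] obtain k p i where "k \<le> M" "p \<in> cube k" "i \<in> slots k" "i div 2 = j"
      "k - i mod 2 = l" "\<And>\<tau>. val \<tau> k p i = leg \<tau> j t l q" by metis
    with slots show "nrm (cell_alg (A j) l) (leg \<tau> j t l q) \<le> c" by metis
  next
    fix k p i assume legs: "\<forall>j\<in>{1..n + 1}. \<forall>t\<in>{0..1}. \<forall>l\<le>d j. \<forall>q\<in>cube l. nrm (cell_alg (A j) l) (leg \<tau> j t l q) \<le> c"
      and "k \<le> M" "p \<in> cube k" "i \<in> slots k"
    then show "nrm (slot_alg k i) (val \<tau> k p i) \<le> c"
      unfolding val_def using slot_facts(1,2)[of i k] slot_facts(3,4)[of i k p] by blast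
  qed
  from this[of "nrm Tel \<tau>"] this[of "nrm (Cells) (h \<tau>)"]
  show ?thesis by simp
qed

lemma h_zero_iff:
  assumes "k \<le> M"
  shows "h \<tau> k = \<zero>\<^bsub>C k\<^esub> \<longleftrightarrow>
    (\<forall>p\<in>cube k. \<forall>i\<in>slots k. val \<tau> k p i = \<zero>\<^bsub>slot_alg k i\<^esub>)"
proof
  assume eq: "h \<tau> k = \<zero>\<^bsub>C k\<^esub>"
  show "\<forall>p\<in>cube k. \<forall>i\<in>slots k. val \<tau> k p i = \<zero>\<^bsub>slot_alg k i\<^esub>"
  proof (intro ballI)
    fix p i assume p: "p \<in> cube k" and i: "i \<in> slots k"
    have "h \<tau> k p i = \<zero>\<^bsub>slot_alg k i\<^esub>"
      unfolding eq using p i by (simp add: cont_cstar_simps dsum_cstar_simps G_def)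
    then show "val \<tau> k p i = \<zero>\<^bsub>slot_alg k i\<^esub>" using h_apply[OF assms p i] by simp
  qed
next
  assume "\<forall>p\<in>cube k. \<forall>i\<in>slots k. val \<tau> k p i = \<zero>\<^bsub>slot_alg k i\<^esub>"
  then show "h \<tau> k = \<zero>\<^bsub>C k\<^esub>"
    using assms by (simp add: h_def cont_cstar_simps dsum_cstar_simps G_def cong: restrict_cong)
qed

lemma leg_skeleton:
  "\<tau> \<in> carrier Tel \<Longrightarrow> j \<in> {1..n + 1} \<Longrightarrow> t \<in> {0..1} \<Longrightarrow> leg \<tau> j t \<in> skeleton_carrier (A j) (d j)"
  using leg_carrier nccw_space.nccw_alg_carrier[OF nccw_space_A] by blast

text \<open>For a cell at time 0 the attaching condition of \<open>A\<^sub>j\<close> applies. For a cell \<open>\<I>\<^sup>k \<times> \<I>\<close> the point \<open>p\<close> lies on the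
face \<open>t = 0\<close>, where the value is a lower coordinate; on the face \<open>t = 1\<close>, where it is a component of the
image of \<open>a\<close>, which lies in the same canonical ideal as \<open>a\<close>; or on a side, where the attaching condition of \<open>A\<^sub>j\<close>
applies at the time \<open>t\<close>.\<close>

lemma h_boundary:
  assumes \<tau>: "\<tau> \<in> carrier Tel" and k: "Suc k \<le> M"
    and z: "\<And>j. j \<le> k \<Longrightarrow> h \<tau> j = \<zero>\<^bsub>C j\<^esub>"
    and p: "p \<in> cube_boundary (Suc k)"
  shows "h \<tau> (Suc k) p = \<zero>\<^bsub>G (Suc k)\<^esub>"
proof -
  have pc: "p \<in> cube (Suc k)" using p cube_boundary_subset by blast
  have Z: "val \<tau> l q i = \<zero>\<^bsub>slot_alg l i\<^esub>" if "l \<le> k" "q \<in> cube l" "i \<in> slots l" for l q i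
    using z[OF that(1)] h_zero_iff[of l \<tau>] that k by simp
  have Z_even: "leg \<tau> j 0 l = \<zero>\<^bsub>cell (A j) l\<^esub>" if j: "j \<in> {1..n + 1}" and l: "l \<le> k" "l \<le> d j" for j l
  proof (rule nccw_space.cell_zeroI[OF nccw_space_A[OF j] leg_carrier[OF \<tau> j] l(2)])
    fix q assume "q \<in> cube l"
    from Z[OF l(1) this even_slot[OF j l(2)]]
    show "leg \<tau> j 0 l q = \<zero>\<^bsub>cell_alg (A j) l\<^esub>" by (simp add: val_even)
  qed simp
  have Z_odd: "leg \<tau> j t l = \<zero>\<^bsub>cell (A j) l\<^esub>"
    if j: "j \<in> {2..n + 1}" and t: "t \<in> {0..1}" and l: "Suc l \<le> k" "l \<le> d j" for j t l
  proof -
    have j': "j \<in> {1..n + 1}" using j by auto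
    show ?thesis
    proof (rule nccw_space.cell_zeroI[OF nccw_space_A[OF j'] leg_carrier[OF \<tau> j' t] l(2)])
      fix q assume q: "q \<in> cube l"
      have "q(l := t) \<in> cube (Suc l)" using q t by (intro cube_upd) auto
      from Z[OF l(1) this odd_slot[OF j l(2)]]
      have "leg \<tau> j t l (q(l := 0)) = \<zero>\<^bsub>cell_alg (A j) l\<^esub>" unfolding val_odd by simp
      moreover have "q(l := 0) = q" using q by (auto simp: cube_eq fun_eq_iff)
      ultimately show "leg \<tau> j t l q = \<zero>\<^bsub>cell_alg (A j) l\<^esub>" by simp
    qed
  qed
  have "val \<tau> (Suc k) p i = \<zero>\<^bsub>slot_alg (Suc k) i\<^esub>" if i: "i \<in> slots (Suc k)" for i
    using i
  proof (cases rule: slot_cases)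
    case (even j)
    have "leg \<tau> j 0 (Suc k) p = \<zero>\<^bsub>cell_alg (A j) (Suc k)\<^esub>"
      by (rule nccw_space.vanishes_on_boundary[OF nccw_space_A[OF even(1)] leg_skeleton[OF \<tau> even(1)] even(3) order_refl _ p])
        (use even Z_even in auto)
    then show ?thesis unfolding even(2) val_even by simp
  next
    case (odd j l)
    then have l: "l = k" "k \<le> d j" by auto
    have j: "j \<in> {1..n + 1}" using odd(1) by auto
    let ?q = "p(k := 0)"
    have q: "?q \<in> cube k" and t: "p k \<in> {0..1}" using cube_Suc_proj[OF pc] by auto
    have Nj: "\<zero>\<^bsub>cell (A j) k\<^esub> ?q = \<zero>\<^bsub>cell_alg (A j) k\<^esub>"
      using q by (simp add: nccw_space.cell_zero[OF nccw_space_A[OF j]])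
    obtain i' where i': "i' < Suc k" "p i' = 0 \<or> p i' = 1" using p by (auto simp: cube_boundary_eq)
    have "leg \<tau> j (p k) k ?q = \<zero>\<^bsub>cell_alg (A j) k\<^esub>"
    proof (cases "i' = k")
      case True
      show ?thesis
      proof (cases "p k = 0")
        case True
        then show ?thesis using Z_even[OF j order_refl l(2)] Nj by simp
      next
        case False
        then have "p k = 1" using True i' by auto
        have one: "1 \<in> {1..n + 1}" by simp
        have "leg \<tau> 1 0 \<in> canonical_ideal (A 1) (Suc k)"
          unfolding nccw_space.canonical_ideal_iff[OF nccw_space_A[OF one]]
          using leg_carrier[OF \<tau> one] Z_even[OF one] by auto
        then have "composite \<alpha> (j - 1) (fst \<tau>) \<in> canonical_ideal (A (Suc (j - 1))) (Suc k)"
          using odd(1) by (intro composite_ideal) (auto simp: leg_def)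
        moreover have "Suc (j - 1) = j" using odd(1) by simp
        ultimately have "leg \<tau> j 1 \<in> canonical_ideal (A j) (Suc k)"
          using leg_1[OF \<tau> odd(1)] by simp
        then have "leg \<tau> j 1 k = \<zero>\<^bsub>cell (A j) k\<^esub>"
          using l(2) by (simp add: nccw_space.canonical_ideal_iff[OF nccw_space_A[OF j]])
        then show ?thesis using \<open>p k = 1\<close> Nj by simp
      qed
    next
      case False
      then obtain k' where k': "k = Suc k'" using i' by (cases k) auto
      have qb: "?q \<in> cube_boundary (Suc k')"
        using q False i' by (auto simp: cube_boundary_eq k' intro!: exI[of _ i'])
      have "leg \<tau> j (p k) (Suc k') ?q = \<zero>\<^bsub>cell_alg (A j) (Suc k')\<^esub>"
        by (rule nccw_space.vanishes_on_boundary[OF nccw_space_A[OF j] leg_skeleton[OF \<tau> j t] _ order_refl _ qb])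
          (use l(2) k' Z_odd[OF odd(1) t] in auto)
      then show ?thesis by (simp add: k')
    qed
    then show ?thesis unfolding odd(2) val_odd l(1) by simp
  qed
  then show ?thesis
    using k pc by (simp add: h_def G_def dsum_cstar_simps cong: restrict_cong)
qed

lemma even_filler:
  assumes j: "j \<in> {1..n + 1}"
    and g: "\<And>i. i \<in> slots k \<Longrightarrow> seq_cont (cube k) (slot_alg k i) (\<lambda>p. g p i)"
    and gb: "\<And>i p. i \<in> slots k \<Longrightarrow> p \<in> cube_boundary k \<Longrightarrow> g p i = \<zero>\<^bsub>slot_alg k i\<^esub>"
  shows "\<exists>e. e \<in> canonical_ideal (A j) k \<and> (k \<le> d j \<longrightarrow> (\<forall>q\<in>cube k. e k q = g q (2 * j)))"
proof -
  interpret X: nccw_space "A j" by (rule nccw_space_A[OF j])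
  show ?thesis
  proof (cases "k \<le> d j")
    case True
    let ?u = "\<lambda>q\<in>cube k. g q (2 * j)"
    have u: "?u \<in> X.rel_cells k"
      using g[OF even_slot[OF j True]] gb[OF even_slot[OF j True]] True cube_boundary_subset[of k]
      by (auto simp: X.rel_cells_def X.cell_carrier)
    show ?thesis
      by (rule exI[of _ "lift (A j) k ?u"])
        (auto simp: X.canonical_ideal_iff X.lift_mem[OF True u] X.lift_at X.lift_below)
  next
    case False
    interpret N: pre_cstar "N j" by (rule N_pre[OF j])
    have "\<zero>\<^bsub>N j\<^esub> l = \<zero>\<^bsub>cell (A j) l\<^esub>" if "l \<le> d j" for l
      using that by (simp add: X.nccw_alg_eq)
    then have "\<zero>\<^bsub>N j\<^esub> \<in> canonical_ideal (A j) k"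
      by (simp add: X.canonical_ideal_iff)
    then show ?thesis using False by blast
  qed
qed

lemma odd_filler:
  assumes j: "j \<in> {2..n + 1}"
    and g: "\<And>i. i \<in> slots k \<Longrightarrow> seq_cont (cube k) (slot_alg k i) (\<lambda>p. g p i)"
    and gb: "\<And>i p. i \<in> slots k \<Longrightarrow> p \<in> cube_boundary k \<Longrightarrow> g p i = \<zero>\<^bsub>slot_alg k i\<^esub>"
  shows "\<exists>w. seq_cont {0..1} (N j) w \<and> w 0 = \<zero>\<^bsub>N j\<^esub> \<and> w 1 = \<zero>\<^bsub>N j\<^esub> \<and>
    (\<forall>t\<in>{0..1}. \<forall>l\<le>d j. \<forall>q\<in>cube l.
      (Suc l < k \<longrightarrow> w t l q = \<zero>\<^bsub>cell_alg (A j) l\<^esub>) \<and>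
      (Suc l = k \<longrightarrow> w t l q = g (q(l := t)) (2 * j + 1)))"
proof -
  have j': "j \<in> {1..n + 1}" using j by auto
  interpret X: nccw_space "A j" by (rule nccw_space_A[OF j'])
  interpret N: pre_cstar "N j" by (rule N_pre[OF j'])
  show ?thesis
  proof (cases "\<exists>l. k = Suc l \<and> l \<le> d j")
    case True
    then obtain l where k: "k = Suc l" and l: "l \<le> d j" by blast
    have i: "2 * j + 1 \<in> slots (Suc l)" by (rule odd_slot[OF j l])
    have gc: "seq_cont (cube (Suc l)) (cell_alg (A j) l) (\<lambda>p. g p (2 * j + 1))"
      using g[unfolded k, OF i] by simp
    have gz: "g p (2 * j + 1) = \<zero>\<^bsub>cell_alg (A j) l\<^esub>" if "p \<in> cube_boundary (Suc l)" for p
      using gb[unfolded k, OF i that] by simp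
    note L = X.lift_path[OF l gc gz]
    define w where "w t = lift (A j) l (\<lambda>q\<in>cube l. g (q(l := t)) (2 * j + 1))" for t
    have "w t l' q = \<zero>\<^bsub>cell_alg (A j) l'\<^esub>" if "Suc l' < k" "q \<in> cube l'" for t l' q
      using that k by (simp add: w_def X.lift_below X.cell_zero)
    moreover have "w t l q = g (q(l := t)) (2 * j + 1)" if "q \<in> cube l" for t q
      using that by (simp add: w_def X.lift_at)
    ultimately show ?thesis
      using L(2-4) k by (intro exI[of _ w]) (auto simp: w_def[abs_def])
  next
    case False
    show ?thesis
      using False by (intro exI[of _ "\<lambda>_. \<zero>\<^bsub>N j\<^esub>"]) (auto simp: N.seq_cont_const X.nccw_alg_ops)
  qed
qed

text \<open>Lift the prescribed functions on the cells at time 0 to elements \<open>e j\<close>, and those on the products with the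
interval to loops \<open>w j\<close> based at zero. The component \<open>a = e 1\<close> forces the end \<open>c j\<close> of the \<open>j\<close>-th leg, so take the leg
\<open>(1 - t) e j + t c j + w j t\<close>. The linear part has no components below \<open>k\<close>, so it does not disturb
the coordinates that \<open>w j\<close> is responsible for.\<close>

lemma h_fill:
  assumes k: "k \<le> M" and g: "g \<in> carrier (C k)"
    and gb: "\<And>p. p \<in> cube_boundary k \<Longrightarrow> g p = \<zero>\<^bsub>G k\<^esub>"
  shows "\<exists>\<tau>\<in>carrier Tel. (\<forall>j<k. h \<tau> j = \<zero>\<^bsub>C j\<^esub>) \<and> h \<tau> k = g"
proof -
  have gc: "seq_cont (cube k) (slot_alg k i) (\<lambda>p. g p i)" if "i \<in> slots k" for i
    using g that by (simp add: carrier_cell_G)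
  have gz: "g p i = \<zero>\<^bsub>slot_alg k i\<^esub>" if "i \<in> slots k" "p \<in> cube_boundary k" for i p
    using gb[OF that(2)] that(1) by (simp add: G_def dsum_cstar_simps)
  have "\<forall>j\<in>{1..n + 1}. \<exists>e. e \<in> canonical_ideal (A j) k \<and> (k \<le> d j \<longrightarrow> (\<forall>q\<in>cube k. e k q = g q (2 * j)))"
    using even_filler[OF _ gc gz] by blast
  from bchoice[OF this] obtain e where e: "\<And>j. j \<in> {1..n + 1} \<Longrightarrow> e j \<in> canonical_ideal (A j) k"
      "\<And>j q. j \<in> {1..n + 1} \<Longrightarrow> k \<le> d j \<Longrightarrow> q \<in> cube k \<Longrightarrow> e j k q = g q (2 * j)" by blast
  have "\<forall>j\<in>{2..n + 1}. \<exists>w. seq_cont {0..1} (N j) w \<and> w 0 = \<zero>\<^bsub>N j\<^esub> \<and> w 1 = \<zero>\<^bsub>N j\<^esub> \<and>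
    (\<forall>t\<in>{0..1}. \<forall>l\<le>d j. \<forall>q\<in>cube l.
      (Suc l < k \<longrightarrow> w t l q = \<zero>\<^bsub>cell_alg (A j) l\<^esub>) \<and>
      (Suc l = k \<longrightarrow> w t l q = g (q(l := t)) (2 * j + 1)))"
    using odd_filler[OF _ gc gz] by blast
  from bchoice[OF this] obtain w where w: "\<And>j. j \<in> {2..n + 1} \<Longrightarrow> seq_cont {0..1} (N j) (w j)"
      "\<And>j. j \<in> {2..n + 1} \<Longrightarrow> w j 0 = \<zero>\<^bsub>N j\<^esub>" "\<And>j. j \<in> {2..n + 1} \<Longrightarrow> w j 1 = \<zero>\<^bsub>N j\<^esub>"
      "\<And>j t l q. j \<in> {2..n + 1} \<Longrightarrow> t \<in> {0..1} \<Longrightarrow> l \<le> d j \<Longrightarrow> q \<in> cube l \<Longrightarrow> Suc l < k \<Longrightarrow>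
        w j t l q = \<zero>\<^bsub>cell_alg (A j) l\<^esub>"
      "\<And>j t l q. j \<in> {2..n + 1} \<Longrightarrow> t \<in> {0..1} \<Longrightarrow> l \<le> d j \<Longrightarrow> q \<in> cube l \<Longrightarrow> Suc l = k \<Longrightarrow>
        w j t l q = g (q(l := t)) (2 * j + 1)" by blast
  define c where "c j = composite \<alpha> (j - 1) (e 1)" for j
  define f where "f = (\<lambda>j\<in>{2..n + 1}. \<lambda>t\<in>{0..1}.
      (complex_of_real (1 - t) \<odot>\<^bsub>N j\<^esub> e j \<oplus>\<^bsub>N j\<^esub> complex_of_real t \<odot>\<^bsub>N j\<^esub> c j) \<oplus>\<^bsub>N j\<^esub> w j t)"
  define \<tau> where "\<tau> = (e 1, f)"
  have c: "c j \<in> canonical_ideal (A j) k" if "j \<in> {2..n + 1}" for j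
    using composite_ideal[of "j - 1" "e 1" k] e(1)[of 1] that by (simp add: c_def le_diff_conv)
  have ideal_carrier: "x \<in> carrier (N j)" if "j \<in> {1..n + 1}" "x \<in> canonical_ideal (A j) k" for j x
    using that by (simp add: nccw_space.canonical_ideal_iff[OF nccw_space_A])
  have ideal_zero: "x l q = \<zero>\<^bsub>cell_alg (A j) l\<^esub>"
    if "j \<in> {1..n + 1}" "x \<in> canonical_ideal (A j) k" "l < k" "l \<le> d j" "q \<in> cube l" for j x l q
    using that by (simp add: nccw_space.canonical_ideal_iff[OF nccw_space_A] nccw_space.cell_zero[OF nccw_space_A])
  have ec: "e j \<in> carrier (N j)" if "j \<in> {1..n + 1}" for j
    using ideal_carrier[OF that e(1)[OF that]] .
  have cc: "c j \<in> carrier (N j)" if "j \<in> {2..n + 1}" for j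
    using that by (intro ideal_carrier c) auto
  have f_cont: "seq_cont {0..1} (N j) (f j)" if j: "j \<in> {2..n + 1}" for j
  proof -
    have j': "j \<in> {1..n + 1}" using j by auto
    interpret Nj: pre_cstar "N j" by (rule N_pre[OF j'])
    have "seq_cont {0..1} (N j) (\<lambda>t. (complex_of_real (1 - t) \<odot>\<^bsub>N j\<^esub> e j \<oplus>\<^bsub>N j\<^esub> complex_of_real t \<odot>\<^bsub>N j\<^esub> c j) \<oplus>\<^bsub>N j\<^esub> w j t)"
      by (intro Nj.seq_cont_add Nj.seq_cont_smult Nj.seq_cont_const w(1)[OF j] ec[OF j'] cc[OF j]
          continuous_on_of_real continuous_intros)
    then show ?thesis using j by (simp add: f_def)
  qed
  have f_1: "f j 1 = c j" and f_0: "f j 0 = e j" if j: "j \<in> {2..n + 1}" for j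
  proof -
    have j': "j \<in> {1..n + 1}" using j by auto
    interpret Nj: pre_cstar "N j" by (rule N_pre[OF j'])
    show "f j 1 = c j" "f j 0 = e j"
      using j by (simp_all add: f_def w(2,3)[OF j] ec[OF j'] cc[OF j])
  qed
  have \<tau>: "\<tau> \<in> carrier Tel"
    unfolding Tel_iff
  proof (intro conjI ballI)
    show "fst \<tau> \<in> carrier (N 1)" using ec[of 1] by (simp add: \<tau>_def)
    show "snd \<tau> \<in> extensional {2..n + 1}" by (simp add: \<tau>_def f_def)
    fix j assume j: "j \<in> {2..n + 1}"
    show "snd \<tau> j \<in> extensional {0..1}" using j by (simp add: \<tau>_def f_def)
    show "seq_cont {0..1} (N j) (snd \<tau> j)" using f_cont[OF j] by (simp add: \<tau>_def)
  next
    fix i assume "i \<in> {1..n}"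
    then show "snd \<tau> (i + 1) 1 = composite \<alpha> i (fst \<tau>)"
      using f_1[of "i + 1"] by (simp add: \<tau>_def c_def)
  qed
  have leg_0: "leg \<tau> j 0 = e j" if "j \<in> {1..n + 1}" for j
    using f_0[of j] that by (cases "j = 1") (auto simp: leg_def \<tau>_def)
  have leg_w: "leg \<tau> j t l q = w j t l q"
    if j: "j \<in> {2..n + 1}" and t: "t \<in> {0..1}" and l: "l < k" "l \<le> d j" and q: "q \<in> cube l" for j t l q
  proof -
    have j': "j \<in> {1..n + 1}" using j by auto
    interpret X: nccw_space "A j" by (rule nccw_space_A[OF j'])
    interpret F: pre_cstar "cell_alg (A j) l" by (rule X.cell_alg_pre[OF l(2)])
    have "w j t l q \<in> carrier (cell_alg (A j) l)"
      using seq_cont_carrier[OF w(1)[OF j] t] l q by (intro X.nccw_alg_fibre)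
    then show ?thesis
      using j t l q ideal_zero[OF j' e(1)[OF j'] l q] ideal_zero[OF j' c[OF j] l q]
      by (simp add: leg_def \<tau>_def f_def X.nccw_alg_ops)
  qed
  have "val \<tau> k' p i = \<zero>\<^bsub>slot_alg k' i\<^esub>" if k': "k' < k" and p: "p \<in> cube k'" and i: "i \<in> slots k'" for k' p i
    using i
  proof (cases rule: slot_cases)
    case (even j)
    show ?thesis
      unfolding even(2) val_even leg_0[OF even(1)]
      using ideal_zero[OF even(1) e(1)[OF even(1)] k' even(3) p] by simp
  next
    case (odd j l)
    note q = cube_Suc_proj[OF p[unfolded odd(3)]]
    have "leg \<tau> j (p l) l (p(l := 0)) = w j (p l) l (p(l := 0))"
      using odd k' q by (intro leg_w) auto
    also have "\<dots> = \<zero>\<^bsub>cell_alg (A j) l\<^esub>"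
      using odd k' q by (intro w(4)) auto
    finally show ?thesis unfolding odd(2,3) val_odd by simp
  qed
  then have below: "h \<tau> k' = \<zero>\<^bsub>C k'\<^esub>" if "k' < k" for k'
    using that k h_zero_iff[of k' \<tau>] by simp
  have level_k: "val \<tau> k p i = g p i" if p: "p \<in> cube k" and i: "i \<in> slots k" for p i
    using i
  proof (cases rule: slot_cases)
    case (even j)
    show ?thesis
      unfolding even(2) val_even leg_0[OF even(1)] by (rule e(2)[OF even(1,3) p])
  next
    case (odd j l)
    note q = cube_Suc_proj[OF p[unfolded odd(3)]]
    have "leg \<tau> j (p l) l (p(l := 0)) = w j (p l) l (p(l := 0))"
      using odd q by (intro leg_w) auto
    also have "\<dots> = g ((p(l := 0))(l := p l)) (2 * j + 1)"
      using odd q by (intro w(5)) auto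
    finally show ?thesis unfolding odd(2,3) val_odd by simp
  qed
  have "h \<tau> k = g"
  proof (rule extensionalityI[of _ "cube k"])
    show "h \<tau> k \<in> extensional (cube k)" using k by (simp add: h_def)
    show "g \<in> extensional (cube k)" using g by (simp add: carrier_cell_G)
    fix p assume p: "p \<in> cube k"
    show "h \<tau> k p = g p"
    proof (rule extensionalityI[of _ "slots k"])
      show "h \<tau> k p \<in> extensional (slots k)" using k p by (simp add: h_def)
      show "g p \<in> extensional (slots k)" using g p by (simp add: carrier_cell_G)
    qed (use h_apply[OF k p] level_k[OF p] in simp)
  qed
  then show ?thesis using \<tau> below by blast
qed

text \<open>The maximum defining \<open>M\<close> is attained by the top cells of \<open>A\<^sub>1\<close> or of some cylinder.\<close>

lemma top_slot: "\<exists>i\<in>slots M. \<exists>v\<in>carrier (slot_alg M i). v \<noteq> \<zero>\<^bsub>slot_alg M i\<^esub>"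
proof -
  have "M \<in> insert (d 1) ((\<lambda>j. 1 + d j) ` {2..n + 1})"
    unfolding M_def by (intro Max_in) auto
  then consider "M = d 1" | j where "j \<in> {2..n + 1}" "M = Suc (d j)" by auto
  then show ?thesis
  proof cases
    case 1
    then show ?thesis
      using even_slot[of 1 M] nccw_space.top_cell_nontrivial[OF nccw_space_A[of 1]]
      by (intro bexI[of _ 2]) auto
  next
    case 2
    then have "j \<in> {1..n + 1}" by auto
    then show ?thesis
      using odd_slot[OF 2(1) order_refl] nccw_space.top_cell_nontrivial[OF nccw_space_A[of j]] 2(2)
      by (intro bexI[of _ "2 * j + 1"]) auto
  qed
qed

lemma G_nontrivial: "\<exists>v\<in>carrier (G M). v \<noteq> \<zero>\<^bsub>G M\<^esub>"
proof -
  obtain i v where i: "i \<in> slots M" and v: "v \<in> carrier (slot_alg M i)" "v \<noteq> \<zero>\<^bsub>slot_alg M i\<^esub>"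
    using top_slot by blast
  let ?u = "\<lambda>l\<in>slots M. if l = i then v else \<zero>\<^bsub>slot_alg M l\<^esub>"
  have z: "\<zero>\<^bsub>slot_alg M l\<^esub> \<in> carrier (slot_alg M l)" if "l \<in> slots M" for l
    using slot_alg_pre[OF that] by (simp add: pre_cstar_def module_def abelian_group_def abelian_monoid.zero_closed)
  have "?u \<in> carrier (G M)"
    using v z by (auto simp: G_def dsum_cstar_simps)
  moreover have "?u \<noteq> \<zero>\<^bsub>G M\<^esub>"
  proof
    assume "?u = \<zero>\<^bsub>G M\<^esub>"
    from fun_cong[OF this, of i] show False using i v by (simp add: G_def dsum_cstar_simps)
  qed
  ultimately show ?thesis by blast
qed

lemma Tel_cell_filtration: "cell_filtration Tel M G h"
proof (rule cell_filtration.intro)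
  show "fin_dim_cstar (G k)" for k by (rule fin_dim_G)
  show "h \<tau> (Suc k) p = \<zero>\<^bsub>G (Suc k)\<^esub>"
    if "\<tau> \<in> carrier Tel" "Suc k \<le> M" "\<And>j. j \<le> k \<Longrightarrow> h \<tau> j = \<zero>\<^bsub>C j\<^esub>"
      "p \<in> cube_boundary (Suc k)" for \<tau> k p
    using that by (rule h_boundary)
  show "\<exists>\<tau>\<in>carrier Tel. (\<forall>j<k. h \<tau> j = \<zero>\<^bsub>C j\<^esub>) \<and> h \<tau> k = g"
    if "k \<le> M" "g \<in> carrier (C k)" "\<And>p. p \<in> cube_boundary k \<Longrightarrow> g p = \<zero>\<^bsub>G k\<^esub>" for k g
    using that by (rule h_fill)
qed (simp_all only: Tel_closed h_hom h_inj h_isometric G_nontrivial)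

end

theorem proposition5p7:
  fixes n :: nat
    and m :: "nat \<Rightarrow> nat"
    and A :: "nat \<Rightarrow> 'f nccw"
    and \<alpha> :: "nat \<Rightarrow> 'f nccw_elem \<Rightarrow> 'f nccw_elem"
  assumes "1 \<le> n"
    and "\<And>j. j \<in> {1..n+1} \<Longrightarrow> nccw_complex (A j) \<and> ncdim (A j) = m j"
    and "\<And>j. j \<in> {1..n} \<Longrightarrow> simplicial (A j) (A (j + 1)) (\<alpha> j)"
  shows "\<exists>E :: (nat \<Rightarrow> 'f) nccw.
           nccw_complex E \<and>
           ncdim E = Max (insert (m 1) ((\<lambda>j. 1 + m j) ` {2..n+1})) \<and>
           cstar_iso (telescope n (\<lambda>j. nccw_alg (A j)) \<alpha>) (nccw_alg E)"
proof -
  interpret simplicial_sequence n A \<alpha>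
    using assms by unfold_locales auto
  interpret F: cell_filtration Tel M G h
    by (rule Tel_cell_filtration)
  have "insert (m 1) ((\<lambda>j. 1 + m j) ` {2..n+1}) = insert (d 1) ((\<lambda>j. 1 + d j) ` {2..n + 1})"
    using assms(2) by (intro arg_cong2[of _ _ _ _ insert] image_cong) auto
  then have "M = Max (insert (m 1) ((\<lambda>j. 1 + m j) ` {2..n+1}))"
    by (simp only: M_def)
  then have "ncdim F.E = Max (insert (m 1) ((\<lambda>j. 1 + m j) ` {2..n+1}))"
    by (rule trans[OF F.E_simps(1)])
  then show ?thesis using F.nccw_complex_E F.iso_E by blast
qed

end
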